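(* Let $I_h$ be a signed Choquet integral with representation $I_h(X)=\int_0^1\gamma(u)F_X^{-1}(u)\,du$ and non-decreasing distortion weight function $\gamma$. For $k\in\{1,\dots,n\}$, let $\phi_k:\mathcal{X}\to\mathbb{R}$ be strictly convex Bregman generators with $\lim_{x\to\infty}\phi_k'(x)=\infty$ and $\lim_{x\to-\infty}\phi_k'(x)=-\infty$, and define the separable Bregman generator $\Phi(\mathbf{x})=\sum_{k=1}^n\phi_k(x_k)$. Let $g(\mathbf{x})=\boldsymbol\beta^T\mathbf{x}$ for some $\boldsymbol\beta\in\mathbb{R}^n$ with non-negative components. For $i\in\{1,\dots,n\}$ and $\lambda_i>0$ put $G^{-1}_{\lambda_i}(u)=(\phi_i')^{-1}\big(\phi_i'(F_{X_i}^{-1}(u))+\frac1{\lambda_i}\gamma(u)\big)$; let $\overline\lambda_i$ be the smallest solution to $\mathcal{B}_{\phi_i}(G^{-1}_{\overline\lambda_i},F^{-1}_{X_i})=\epsilon$ and $\underline\lambda_i$ the smallest solution to $\mathcal{B}_{\phi_i}(G^{-1}_{\underline\lambda_i},F^{-1}_{X_i})=\frac\epsilon n$. Then, for any $\epsilon>0$ and $\mathbf{X}$ comonotonic, $$\sum_{i=1}^n\beta_i\int_0^1\gamma(u)(\phi_i')^{-1}\Big(\phi_i'\big(F_{X_i}^{-1}(u)\big)+\tfrac1{\underline\lambda_i}\gamma(u)\Big)du\le\sup_{\mathbf{Z}\in\mathfrak{B}^n_{\Phi,\epsilon}(\mathbf{X})}I_h(\boldsymbol\beta^T\mathbf{Z})\le\sum_{i=1}^n\beta_i\int_0^1\gamma(u)(\phi_i')^{-1}\Big(\phi_i'\big(F_{X_i}^{-1}(u)\big)+\tfrac1{\overline\lambda_i}\gamma(u)\Big)du.$$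 Furthermore, if each $(\phi_i')^{-1}$ is $L_i$-Lipschitz, then the difference between the upper and lower bounds is at most $$\sum_{i=1}^n\beta_iL_i\big(\tfrac1{\overline\lambda_i}-\tfrac1{\underline\lambda_i}\big)\|\gamma\|_2^2.$$
   Context: All random variables/vectors live on a fixed non-atomic probability space $(\Omega,\mathcal{B},\mathbb{P})$ with $\mathcal{B}=\mathcal{B}(\mathbb{R}^n)$. $F^{-1}$ denotes the left-continuous quantile function. A signed Choquet integral is $I_h(X)=\int_{-\infty}^0[h(\mathbb{P}(X\ge x))-h(1)]\,dx+\int_0^\infty h(\mathbb{P}(X\ge x))\,dx$, where $h:[0,1]\to\mathbb{R}$ is non-constant, of bounded variation, with $h(0)=0$; it is assumed finite for the random variables considered. When $h$ is absolutely continuous (assumed throughout), $I_h(X)=\int_0^1\gamma(u)F_X^{-1}(u)\,du$ with distortion weight function $\gamma(u)$ the left derivative of $h$ at $1-u$. $\|\gamma\|_2=(\int_0^1\gamma(u)^2du)^{1/2}$. A Bregman generator is a convex differentiable function $\Phi$ on a convex domain, with $B_\Phi(\mathbf{z}_1,\mathbf{z}_2)=\Phi(\mathbf{z}_1)-\Phi(\mathbf{z}_2)-\nabla\Phi(\mathbf{z}_2)\cdot(\mathbf{z}_1-\mathbf{z}_2)$; $\mathcal{X}\subseteq\mathbb{R}$ is the convex domain of the $\phi_k$ (the limits at $\pm\infty$ force $\mathcal X=\mathbb R$). The Bregman-Wasserstein divergence is $\mathcal{B}^n_\Phi[F,G]=\inf\mathbb{E}[B_\Phi(\mathbf{X},\mathbf{Y})]$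 over all couplings with $F_{\mathbf{X}}=F$, $F_{\mathbf{Y}}=G$; for $n=1$, $\mathcal{B}_\phi(G^{-1},F^{-1})=\mathcal{B}_\phi[G,F]=\int_0^1B_\phi(G^{-1}(t),F^{-1}(t))\,dt$. $\mathfrak{B}^n_{\Phi,\epsilon}(\mathbf{X})=\{\mathbf{Z}:\mathcal{B}^n_\Phi[F_{\mathbf{Z}},F_{\mathbf{X}}]\le\epsilon\}$. A random vector $\mathbf{X}=(X_1,\dots,X_n)$ is comonotonic if for every pair $i\ne j$ there is $\Omega_0$ with $\mathbb{P}(\Omega_0)=1$ such that $(X_i(\omega)-X_i(\omega'))(X_j(\omega)-X_j(\omega'))\ge0$ for all $\omega,\omega'\in\Omega_0$. Standing assumption: $g$ is non-constant, i.e. $\boldsymbol\beta\neq\mathbf{0}$. *)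

theory Defs
  imports "HOL-Probability.Probability"
begin

section \<open>Probability\<close>

definition nonatomic :: "'w measure \<Rightarrow> bool" where
  "nonatomic M \<longleftrightarrow>
     (\<forall>A\<in>sets M. 0 < emeasure M A \<longrightarrow>
        (\<exists>B\<in>sets M. B \<subseteq> A \<and> 0 < emeasure M B \<and> emeasure M B < emeasure M A))"

text \<open>The left-continuous quantile function; only its values on $(0,1)$ are meaningful.\<close>

definition quantile :: "'w measure \<Rightarrow> ('w \<Rightarrow> real) \<Rightarrow> real \<Rightarrow> real" where
  "quantile M X u = Inf {x. u \<le> cdf (distr M borel X) x}"

definition comonotonic :: "'w measure \<Rightarrow> ('w \<Rightarrow> real ^ 'n) \<Rightarrow> bool" where
  "comonotonic M X \<longleftrightarrow>
     (\<forall>i j. i \<noteq> j \<longrightarrow>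
        (\<exists>\<Omega>\<^sub>0\<in>sets M. measure M \<Omega>\<^sub>0 = 1 \<and>
           (\<forall>w\<in>\<Omega>\<^sub>0. \<forall>w'\<in>\<Omega>\<^sub>0. 0 \<le> (X w $ i - X w' $ i) * (X w $ j - X w' $ j))))"

section \<open>Signed Choquet integrals\<close>

definition bounded_variation_on :: "real \<Rightarrow> real \<Rightarrow> (real \<Rightarrow> real) \<Rightarrow> bool" where
  "bounded_variation_on a b f \<longleftrightarrow>
     (\<exists>V. \<forall>(t :: nat \<Rightarrow> real) N. mono t \<and> range t \<subseteq> {a..b} \<longrightarrow>
        (\<Sum>i<N. \<bar>f (t (Suc i)) - f (t i)\<bar>) \<le> V)"

definition abs_continuous_on :: "real \<Rightarrow> real \<Rightarrow> (real \<Rightarrow> real) \<Rightarrow> bool" where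
  "abs_continuous_on a b f \<longleftrightarrow>
     (\<forall>e>0. \<exists>d>0. \<forall>(s :: nat \<Rightarrow> real) t N.
        (\<forall>i<N. a \<le> s i \<and> s i \<le> t i \<and> t i \<le> b) \<and>
        disjoint_family_on (\<lambda>i. {s i<..<t i}) {..<N} \<and>
        (\<Sum>i<N. t i - s i) < d \<longrightarrow>
        (\<Sum>i<N. \<bar>f (t i) - f (s i)\<bar>) < e)"

definition distortion :: "(real \<Rightarrow> real) \<Rightarrow> bool" where
  "distortion h \<longleftrightarrow>
     bounded_variation_on 0 1 h \<and> abs_continuous_on 0 1 h \<and> h 0 = 0 \<and>
     \<not> h constant_on {0..1}"

definition distortion_weight :: "(real \<Rightarrow> real) \<Rightarrow> (real \<Rightarrow> real) \<Rightarrow> bool" where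
  "distortion_weight h \<gamma> \<longleftrightarrow>
     (\<forall>u\<in>{0<..<1}. (h has_real_derivative \<gamma> u) (at_left (1 - u)))"

definition signed_choquet :: "'w measure \<Rightarrow> (real \<Rightarrow> real) \<Rightarrow> ('w \<Rightarrow> real) \<Rightarrow> real" where
  "signed_choquet M h X =
     (LBINT x:{..0}. h (measure M {w \<in> space M. x \<le> X w}) - h 1) +
     (LBINT x:{0..}. h (measure M {w \<in> space M. x \<le> X w}))"

definition signed_choquet_finite :: "'w measure \<Rightarrow> (real \<Rightarrow> real) \<Rightarrow> ('w \<Rightarrow> real) \<Rightarrow> bool" where
  "signed_choquet_finite M h X \<longleftrightarrow>
     set_integrable lborel {..0} (\<lambda>x. h (measure M {w \<in> space M. x \<le> X w}) - h 1) \<and>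
     set_integrable lborel {0..} (\<lambda>x. h (measure M {w \<in> space M. x \<le> X w}))"

text \<open>Extended-real valued, so that no square integrability has to be presupposed.\<close>

definition L2norm :: "(real \<Rightarrow> real) \<Rightarrow> ereal" where
  "L2norm f =
     (let s = (\<integral>\<^sup>+u\<in>{0<..<1}. ennreal ((f u)\<^sup>2) \<partial>lborel)
      in if s = \<infinity> then \<infinity> else ereal (sqrt (enn2real s)))"

section \<open>Bregman divergences\<close>

definition strictly_convex :: "(real \<Rightarrow> real) \<Rightarrow> bool" where
  "strictly_convex f \<longleftrightarrow>
     (\<forall>x y t. x \<noteq> y \<and> 0 < t \<and> t < 1 \<longrightarrow>
        f ((1 - t) * x + t * y) < (1 - t) * f x + t * f y)"

definition bregman_generator :: "('a :: euclidean_space \<Rightarrow> real) \<Rightarrow> bool" where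
  "bregman_generator \<Phi> \<longleftrightarrow> convex_on UNIV \<Phi> \<and> (\<forall>x. \<Phi> differentiable (at x))"

definition gradient :: "('a :: euclidean_space \<Rightarrow> real) \<Rightarrow> 'a \<Rightarrow> 'a" where
  "gradient \<Phi> x = (THE D. GDERIV \<Phi> x :> D)"

definition bregman_div :: "('a :: euclidean_space \<Rightarrow> real) \<Rightarrow> 'a \<Rightarrow> 'a \<Rightarrow> real" where
  "bregman_div \<Phi> z1 z2 = \<Phi> z1 - \<Phi> z2 - gradient \<Phi> z2 \<bullet> (z1 - z2)"

text \<open>
  Expectations of Bregman divergences are taken in the extended non-negative reals: the divergence of a convex
  generator is non-negative. The infimum ranges over the pairs of random vectors on the underlying
  probability space that have the prescribed marginal laws.
\<close>

definition bregman_wasserstein ::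
    "'w measure \<Rightarrow> ('a :: euclidean_space \<Rightarrow> real) \<Rightarrow> 'a measure \<Rightarrow> 'a measure \<Rightarrow> ennreal" where
  "bregman_wasserstein M \<Phi> F G =
     (INF (X, Y) \<in> {(X, Y). X \<in> borel_measurable M \<and> Y \<in> borel_measurable M \<and>
                            distr M borel X = F \<and> distr M borel Y = G}.
        \<integral>\<^sup>+w. ennreal (bregman_div \<Phi> (X w) (Y w)) \<partial>M)"

text \<open>The one-dimensional divergence in terms of quantile functions.\<close>

definition bregman_wasserstein_quantile ::
    "(real \<Rightarrow> real) \<Rightarrow> (real \<Rightarrow> real) \<Rightarrow> (real \<Rightarrow> real) \<Rightarrow> ennreal" where
  "bregman_wasserstein_quantile \<phi> p q =
     (\<integral>\<^sup>+t\<in>{0<..<1}. ennreal (bregman_div \<phi> (p t) (q t)) \<partial>lborel)"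

definition bregman_ball ::
    "'w measure \<Rightarrow> ('a :: euclidean_space \<Rightarrow> real) \<Rightarrow> real \<Rightarrow> ('w \<Rightarrow> 'a) \<Rightarrow> ('w \<Rightarrow> 'a) set" where
  "bregman_ball M \<Phi> \<epsilon> X =
     {Z \<in> borel_measurable M.
        bregman_wasserstein M \<Phi> (distr M borel Z) (distr M borel X) \<le> ennreal \<epsilon>}"

definition separable :: "('n \<Rightarrow> real \<Rightarrow> real) \<Rightarrow> real ^ 'n \<Rightarrow> real" where
  "separable \<phi> x = (\<Sum>k\<in>UNIV. \<phi> k (x $ k))"

section \<open>The extremal quantile functions\<close>

definition G_inv ::
    "(real \<Rightarrow> real) \<Rightarrow> (real \<Rightarrow> real) \<Rightarrow> (real \<Rightarrow> real) \<Rightarrow> real \<Rightarrow> real \<Rightarrow> real" where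
  "G_inv \<phi> \<gamma> q l u = inv (deriv \<phi>) (deriv \<phi> (q u) + 1 / l * \<gamma> u)"

definition smallest_multiplier ::
    "(real \<Rightarrow> real) \<Rightarrow> (real \<Rightarrow> real) \<Rightarrow> (real \<Rightarrow> real) \<Rightarrow> real \<Rightarrow> real \<Rightarrow> bool" where
  "smallest_multiplier \<phi> \<gamma> q \<epsilon> l \<longleftrightarrow>
     0 < l \<and> bregman_wasserstein_quantile \<phi> (G_inv \<phi> \<gamma> q l) q = ennreal \<epsilon> \<and>
     (\<forall>\<mu>>0. bregman_wasserstein_quantile \<phi> (G_inv \<phi> \<gamma> q \<mu>) q = ennreal \<epsilon> \<longrightarrow> l \<le> \<mu>)"

definition choquet_bound ::
    "'w measure \<Rightarrow> ('n \<Rightarrow> real \<Rightarrow> real) \<Rightarrow> (real \<Rightarrow> real) \<Rightarrow> real ^ 'n \<Rightarrow> ('w \<Rightarrow> real ^ 'n) \<Rightarrow>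
      ('n \<Rightarrow> real) \<Rightarrow> real" where
  "choquet_bound M \<phi> \<gamma> \<beta> X l =
     (\<Sum>i\<in>UNIV. \<beta> $ i *
        (LBINT u:{0<..<1}. \<gamma> u * G_inv (\<phi> i) \<gamma> (quantile M (\<lambda>w. X w $ i)) (l i) u))"

end

theory Submission
  imports Defs
begin

text \<open>
  Both bounds rest on the representation \<open>I_h(Y) = \<integral> \<gamma> q\<^sub>Y\<close> over the unit interval, with \<open>q\<^sub>Y\<close> the quantile
  function of \<open>Y\<close>.

  Lower bound: on a non-atomic space there is a uniform variable \<open>U\<close>, and by comonotonicity \<open>X\<close> has the law of
  \<open>(q\<^sub>1(U), \<dots>, q\<^sub>n(U))\<close>. The vector with components \<open>G\<^sub>i\<^sup>-\<^sup>1(U)\<close> at budget \<open>\<epsilon>/n\<close> per component is therefore in the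
  ball, and its value is the bound. Perturbing a single component at budget \<open>\<epsilon>\<close> also stays in the ball, which
  gives the integrability needed for the upper bound.

  Upper bound: take a near-optimal coupling \<open>(Z, X)\<close>, and a uniform \<open>U\<close> on an extended space with
  \<open>\<beta> \<bullet> Z = q(U)\<close>. Componentwise, \<open>\<gamma>(U) Z\<^sub>i \<le> \<Psi>(\<gamma>(U), X\<^sub>i) + \<lambda>\<^sub>i B(Z\<^sub>i, X\<^sub>i)\<close>, where \<open>\<Psi>(g, x)\<close> is the
  maximum over \<open>z\<close> of \<open>g z - \<lambda>\<^sub>i B(z, x)\<close>. Since \<open>\<Psi>\<close> is supermodular, replacing \<open>X\<^sub>i\<close> by \<open>q\<^sub>i(U)\<close> increases the
  expectation, and the result is the bound minus \<open>\<lambda>\<^sub>i \<epsilon>\<close>.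
\<close>

section \<open>Strictly convex generators\<close>

text \<open>Integrability shapes the proof. The weight \<open>\<gamma>\<close> is only shown to be
  integrable, \<open>X\<close> need not have moments, and integrability of a product such as
  \<open>\<gamma> u * p u\<close> can come only from the finiteness of Choquet integrals over the
  ball. Signed expectations are therefore compared through non-negative parts in the extended reals.

  The gap between the two bounds comes from the way the budget is shared. A coupling that spends
  \<epsilon> in total spends at most \<epsilon> in each component; the upper bound grants all of
  \<epsilon> to every component at once, the lower bound an equal share. The multiplier terms cancel
  because each extremal quantile function exhausts its budget.

  The law of \<open>\<beta> \<bullet> Z\<close> may have atoms, on which \<open>U\<close> is not
  determined by \<open>Z\<close>; the extension supplies independent randomness to break ties.
  Choquet integrals and quantile functions depend on laws only, so the extension leaves them
  unchanged.

  Since \<open>h\<close> is differentiated from one side only, integrating \<open>\<gamma>\<close>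
  back to \<open>h\<close> rests on the monotonicity of \<open>\<gamma>\<close>.\<close>

locale strict_generator =
  fixes \<phi> :: "real \<Rightarrow> real"
  assumes generator: "bregman_generator \<phi>"
    and strict: "strictly_convex \<phi>"
    and deriv_top: "filterlim (deriv \<phi>) at_top at_top"
    and deriv_bot: "filterlim (deriv \<phi>) at_bot at_bot"
begin

lemma has_deriv: "(\<phi> has_real_derivative deriv \<phi> x) (at x)"
  using generator by (auto simp: bregman_generator_def DERIV_deriv_iff_real_differentiable)

lemma continuous_on_generator: "continuous_on A \<phi>"
  by (rule DERIV_continuous_on[OF has_field_derivative_at_within[OF has_deriv]])

lemma gradient_eq_deriv: "gradient \<phi> x = deriv \<phi> x"
  unfolding gradient_def gderiv_deriv by (rule the_equality) (auto intro: has_deriv DERIV_unique)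

lemma bregman_div_eq: "bregman_div \<phi> z y = \<phi> z - \<phi> y - deriv \<phi> y * (z - y)"
  by (simp add: bregman_div_def gradient_eq_deriv)

lemma bregman_div_nonneg: "0 \<le> bregman_div \<phi> z y"
proof -
  have "\<phi> z - \<phi> y \<ge> deriv \<phi> y * (z - y)"
    using generator has_deriv
    by (intro convex_on_imp_above_tangent[of UNIV]) (auto simp: bregman_generator_def)
  then show ?thesis by (simp add: bregman_div_eq)
qed

lemma bregman_div_self: "bregman_div \<phi> y y = 0"
  by (simp add: bregman_div_eq)

text \<open>At the midpoint of \<open>z\<close> and \<open>y\<close> the linear term of the
  divergence halves, so strict convexity makes the divergence there smaller than half of that at
  \<open>z\<close>, while convexity keeps it non-negative.\<close>

lemma bregman_div_pos:
  assumes "z \<noteq> y"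
  shows "0 < bregman_div \<phi> z y"
proof -
  have "\<phi> ((1 - 1/2) * y + (1/2) * z) < (1 - 1/2) * \<phi> y + (1/2) * \<phi> z"
    using strict assms unfolding strictly_convex_def by (smt (verit, best) field_sum_of_halves half_gt_zero_iff)
  moreover have "0 \<le> bregman_div \<phi> ((1 - 1/2) * y + (1/2) * z) y" by (rule bregman_div_nonneg)
  ultimately show ?thesis by (simp add: bregman_div_eq field_simps)
qed

lemma bregman_div_three_point:
  "bregman_div \<phi> z y = bregman_div \<phi> z x + bregman_div \<phi> x y + (deriv \<phi> x - deriv \<phi> y) * (z - x)"
  by (simp add: bregman_div_eq algebra_simps)

lemma strict_mono_deriv: "strict_mono (deriv \<phi>)"
proof (rule strict_monoI)
  fix x y :: real assume "x < y"
  have "0 < bregman_div \<phi> x y" "0 < bregman_div \<phi> y x" using \<open>x < y\<close> by (auto intro!: bregman_div_pos)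
  then have "0 < (deriv \<phi> y - deriv \<phi> x) * (y - x)" by (simp add: bregman_div_eq algebra_simps)
  then show "deriv \<phi> x < deriv \<phi> y" using \<open>x < y\<close> by (simp add: zero_less_mult_iff)
qed

text \<open>Darboux's argument, which does without continuity of the derivative. The limits give
  \<open>a < b\<close> with slopes below and above \<open>c\<close>. A minimum of
  \<open>\<phi> x - c * x\<close> on this interval is interior, because the function falls just
  after \<open>a\<close> and rises just before \<open>b\<close>, and at an interior minimum the
  derivative vanishes.\<close>

lemma surj_deriv: "surj (deriv \<phi>)"
proof -
  have "\<exists>x. deriv \<phi> x = c" for c
  proof -
    obtain b where b: "c < deriv \<phi> b"
      using filterlim_at_top_dense[THEN iffD1, OF deriv_top]
      by (meson eventually_happens trivial_limit_at_top_linorder)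
    obtain a where a: "deriv \<phi> a < c"
      using filterlim_at_bot_dense[THEN iffD1, OF deriv_bot]
      by (meson eventually_happens trivial_limit_at_bot_linorder)
    have ab: "a < b" using a b strict_mono_deriv
      by (meson less_trans linorder_neqE_linordered_idom not_less_iff_gr_or_eq strict_mono_less)
    define f where "f x = \<phi> x - c * x" for x
    have df: "(f has_real_derivative deriv \<phi> x - c) (at x)" for x
      unfolding f_def by (auto intro!: derivative_eq_intros has_deriv)
    have "continuous_on {a..b} f" unfolding f_def
      by (intro continuous_intros continuous_on_generator)
    then obtain m where m: "m \<in> {a..b}" "\<And>y. y \<in> {a..b} \<Longrightarrow> f m \<le> f y"
      using continuous_attains_inf[of "{a..b}" f] ab by auto
    have "m \<noteq> a"
    proof
      assume "m = a"
      obtain d where "d > 0" "\<And>h. 0 < h \<Longrightarrow> h < d \<Longrightarrow> f (a + h) < f a"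
        using DERIV_neg_dec_right[OF df[of a]] a by auto
      moreover define e where "e = min (d/2) (b - a)"
      ultimately have "0 < e" "e < d" "e \<le> b - a" "f (a + e) < f a" using ab by (auto simp: min_def)
      then show False using m(2)[of "a + e"] \<open>m = a\<close> by auto
    qed
    moreover have "m \<noteq> b"
    proof
      assume "m = b"
      obtain d where "d > 0" "\<And>h. 0 < h \<Longrightarrow> h < d \<Longrightarrow> f (b - h) < f b"
        using DERIV_pos_inc_left[OF df[of b]] b by auto
      moreover define e where "e = min (d/2) (b - a)"
      ultimately have "0 < e" "e < d" "e \<le> b - a" "f (b - e) < f b" using ab by (auto simp: min_def)
      then show False using m(2)[of "b - e"] \<open>m = b\<close> by auto
    qed
    ultimately have "a < m" "m < b" using m(1) by auto
    then have "deriv \<phi> m - c = 0"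
      by (intro DERIV_local_min[OF df, of "min (m - a) (b - m)"]) (auto intro!: m(2))
    then show ?thesis by auto
  qed
  then show ?thesis by (metis surjI)
qed

lemma bij_deriv: "bij (deriv \<phi>)"
  using surj_deriv strict_mono_deriv strict_mono_eq by (auto simp: bij_def inj_def)

lemma deriv_inv_deriv [simp]: "deriv \<phi> (inv (deriv \<phi>) a) = a"
  using surj_deriv by (rule surj_f_inv_f)

lemma inv_deriv_deriv [simp]: "inv (deriv \<phi>) (deriv \<phi> a) = a"
  using bij_deriv by (simp add: bij_def)

lemma inv_deriv_less_iff: "inv (deriv \<phi>) a < x \<longleftrightarrow> a < deriv \<phi> x"
  by (metis deriv_inv_deriv strict_mono_deriv strict_mono_less)

lemma less_inv_deriv_iff: "x < inv (deriv \<phi>) a \<longleftrightarrow> deriv \<phi> x < a"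
  by (metis deriv_inv_deriv strict_mono_deriv strict_mono_less)

lemma inv_deriv_le_iff: "inv (deriv \<phi>) a \<le> x \<longleftrightarrow> a \<le> deriv \<phi> x"
  by (metis less_inv_deriv_iff not_less)

lemma le_inv_deriv_iff: "x \<le> inv (deriv \<phi>) a \<longleftrightarrow> deriv \<phi> x \<le> a"
  by (metis inv_deriv_less_iff not_less)

lemma mono_inv_deriv: "mono (inv (deriv \<phi>))"
  by (rule monoI) (simp add: inv_deriv_le_iff)

text \<open>A monotone function whose range is the whole line cannot jump.\<close>

lemma continuous_on_inv_deriv: "continuous_on A (inv (deriv \<phi>))"
proof -
  have "range (inv (deriv \<phi>)) = UNIV" using bij_deriv by (simp add: bij_imp_bij_inv bij_is_surj)
  then have "continuous_on UNIV (inv (deriv \<phi>))"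
    using mono_inv_deriv by (intro continuous_onI_mono) (auto dest: monoD)
  then show ?thesis by (rule continuous_on_subset) simp
qed

lemma borel_measurable_generator [measurable]: "\<phi> \<in> borel_measurable borel"
  by (intro borel_measurable_continuous_onI continuous_on_generator)

lemma borel_measurable_deriv [measurable]: "deriv \<phi> \<in> borel_measurable borel"
  using strict_mono_deriv by (intro borel_measurable_mono strict_mono_mono)

lemma borel_measurable_inv_deriv [measurable]: "inv (deriv \<phi>) \<in> borel_measurable borel"
  by (intro borel_measurable_mono mono_inv_deriv)

lemma borel_measurable_bregman_div [measurable]:
  assumes [measurable]: "f \<in> borel_measurable N" "g \<in> borel_measurable N"
  shows "(\<lambda>w. bregman_div \<phi> (f w) (g w)) \<in> borel_measurable N"
  unfolding bregman_div_eq by measurable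

text \<open>In the three-point identity with \<open>z\<close> in the middle, the cross term is
  non-negative as long as \<open>z\<close> lies between \<open>y\<close> and
  \<open>z'\<close>.\<close>

lemma bregman_div_mono:
  assumes "(y \<le> z \<and> z \<le> z') \<or> (z' \<le> z \<and> z \<le> y)"
  shows "bregman_div \<phi> z y \<le> bregman_div \<phi> z' y"
proof -
  have "0 \<le> (deriv \<phi> z - deriv \<phi> y) * (z' - z)"
    using assms strict_mono_mono[OF strict_mono_deriv]
    by (auto simp: zero_le_mult_iff dest: monoD)
  then show ?thesis using bregman_div_three_point[of z' y z] bregman_div_nonneg[of z' z] by simp
qed

end

section \<open>Lagrangian relaxation of the one-dimensional problem\<close>

locale lagrangian = strict_generator +
  fixes l :: real
  assumes l_pos: "0 < l"
begin

text \<open>\<open>G g x\<close> maximises the Lagrangian \<open>z \<mapsto> g * z - l * bregman_div \<phi> z x\<close>, with maximum \<open>Psi g x\<close>.\<close>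

definition G :: "real \<Rightarrow> real \<Rightarrow> real" where
  "G g x = inv (deriv \<phi>) (deriv \<phi> x + 1 / l * g)"

definition Psi :: "real \<Rightarrow> real \<Rightarrow> real" where
  "Psi g x = g * G g x - l * bregman_div \<phi> (G g x) x"

lemma deriv_G: "l * (deriv \<phi> (G g x) - deriv \<phi> x) = g"
  using l_pos by (simp add: G_def)

text \<open>In the three-point identity with \<open>G g x\<close> in the middle,
  \<open>deriv_G\<close> turns the cross term into \<open>g * (z - G g x)\<close>. The shortfall
  from the maximum is thus exactly \<open>l * bregman_div \<phi> z (G g x)\<close>.\<close>

lemma Psi_ge: "g * z - l * bregman_div \<phi> z x \<le> Psi g x"
proof -
  have "l * bregman_div \<phi> z x = l * bregman_div \<phi> z (G g x) + l * bregman_div \<phi> (G g x) x + g * (z - G g x)"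
    unfolding bregman_div_three_point[of z x "G g x"] by (metis deriv_G distrib_left mult.assoc)
  moreover have "0 \<le> l * bregman_div \<phi> z (G g x)" using l_pos bregman_div_nonneg by simp
  ultimately show ?thesis by (simp add: Psi_def algebra_simps)
qed

lemma G_mono: "g \<le> g' \<Longrightarrow> x \<le> x' \<Longrightarrow> G g x \<le> G g' x'"
  unfolding G_def using l_pos strict_mono_mono[OF strict_mono_deriv]
  by (intro monoD[OF mono_inv_deriv] add_mono) (auto dest: monoD simp: divide_right_mono)

lemma G_0 [simp]: "G 0 x = x"
  by (simp add: G_def)

lemma Psi_0 [simp]: "Psi 0 x = 0"
  by (simp add: Psi_def bregman_div_self)

lemma isCont_G: "isCont (\<lambda>g. G g x) g"
proof -
  have "continuous_on UNIV (\<lambda>g. G g x)" unfolding G_def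
    by (intro continuous_on_compose2[OF continuous_on_inv_deriv[of UNIV]] continuous_intros) auto
  then show ?thesis by (simp add: continuous_on_eq_continuous_at)
qed

text \<open>Envelope theorem. \<open>Psi\<close> is a maximum of affine functions of
  \<open>g\<close>, with the maximiser as slope. Testing \<open>Psi_ge\<close> at the maximisers for
  \<open>g\<close> and \<open>g + h\<close> encloses the difference quotient between
  \<open>G g x\<close> and \<open>G (g + h) x\<close>, which merge by continuity. No second
  derivative of the generator enters.\<close>

lemma has_deriv_Psi: "((\<lambda>g. Psi g x) has_real_derivative G g x) (at g)"
proof -
  have lower: "(g' - g) * G g x \<le> Psi g' x - Psi g x" for g g'
    using Psi_ge[of g' "G g x" x] by (simp add: Psi_def algebra_simps)
  have upper: "Psi g' x - Psi g x \<le> (g' - g) * G g' x" for g g'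
    using lower[of g g'] lower[of g' g] by (simp add: algebra_simps)
  have bounds: "min (G g x) (G (g + h) x) \<le> (Psi (g + h) x - Psi g x) / h"
    "(Psi (g + h) x - Psi g x) / h \<le> max (G g x) (G (g + h) x)" if "h \<noteq> 0" for h
    using lower[of "g + h" g] upper[of "g + h" g] that
    by (cases "h > 0"; auto simp: min_le_iff_disj le_max_iff_disj field_simps)+
  have lim: "((\<lambda>h. G (g + h) x) \<longlongrightarrow> G g x) (at 0)" using isCont_G[of g x] by (simp add: isCont_iff)
  show ?thesis
    unfolding DERIV_def
  proof (rule tendsto_sandwich)
    show "((\<lambda>h. min (G g x) (G (g + h) x)) \<longlongrightarrow> G g x) (at 0)"
      using tendsto_min[OF tendsto_const[of "G g x"] lim] by simp
    show "((\<lambda>h. max (G g x) (G (g + h) x)) \<longlongrightarrow> G g x) (at 0)"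
      using tendsto_max[OF tendsto_const[of "G g x"] lim] by simp
  qed (use bounds in \<open>auto simp: eventually_at intro!: exI[of _ 1]\<close>)
qed

end

section \<open>Uniform variables and quantile functions\<close>

text \<open>The endpoints are left out because quantile functions carry meaning only on the open
  interval.\<close>

definition unif01 :: "real measure" where
  "unif01 = restrict_space lborel {0<..<1}"

lemma space_unif01 [simp]: "space unif01 = {0<..<1}"
  by (simp add: unif01_def space_restrict_space)

lemma sets_unif01 [measurable_cong]: "sets unif01 = sets (restrict_space borel {0<..<1})"
  unfolding unif01_def by (intro sets_restrict_space_cong) simp

lemma prob_space_unif01: "prob_space unif01"
  by (auto simp: unif01_def emeasure_restrict_space space_restrict_space intro!: prob_spaceI)

lemma nn_integral_unif01: "(\<integral>\<^sup>+u. f u \<partial>unif01) = (\<integral>\<^sup>+u\<in>{0<..<1}. f u \<partial>lborel)"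
  unfolding unif01_def by (subst nn_integral_restrict_space) auto

lemma integral_unif01: "(\<integral>u. f u \<partial>unif01) = (LBINT u:{0<..<1}. f u)" for f :: "real \<Rightarrow> real"
  unfolding unif01_def set_lebesgue_integral_def by (subst integral_restrict_space) auto

lemma integrable_unif01: "integrable unif01 f \<longleftrightarrow> set_integrable lborel {0<..<1} f" for f :: "real \<Rightarrow> real"
  unfolding unif01_def set_integrable_def by (subst integrable_restrict_space) auto

lemma emeasure_unif01: "A \<subseteq> {0<..<1} \<Longrightarrow> emeasure unif01 A = emeasure lborel A"
  unfolding unif01_def by (intro emeasure_restrict_space) auto

lemma measure_unif01_le:
  assumes "0 \<le> u" "u \<le> 1"
  shows "measure unif01 {v \<in> space unif01. v \<le> u} = u"
proof (cases "u = 1")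
  case True
  then have "{v \<in> space unif01. v \<le> u} = space unif01" by auto
  then show ?thesis using True prob_space.prob_space[OF prob_space_unif01] by simp
next
  case False
  then have "{v \<in> space unif01. v \<le> u} = {0<..u}" using assms by auto
  then show ?thesis using False assms by (subst measure_def) (auto simp: emeasure_unif01[of "{0<..u}"] subset_eq)
qed

lemma measurable_mono_unif01: "mono_on {0<..<1} f \<Longrightarrow> f \<in> borel_measurable unif01" for f :: "real \<Rightarrow> real"
  using borel_measurable_mono_on_fnc[of "{0<..<1}" f] measurable_cong_sets[OF sets_unif01 refl] by auto

lemma measurable_ident_unif01: "(\<lambda>u. u) \<in> borel_measurable unif01"
  by (intro measurable_mono_unif01) (simp add: mono_on_def)

lemma AE_unif01_neq: "AE u in unif01. u \<noteq> c"
  using AE_lborel_singleton[of c] unfolding unif01_def by (subst AE_restrict_space_iff) auto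

text \<open>Measurability into \<open>unif01\<close> keeps \<open>U\<close> inside the open interval
  at every point of the space, so quantile functions can be evaluated at \<open>U w\<close> without
  exceptional sets.\<close>

definition uniform01 :: "'w measure \<Rightarrow> ('w \<Rightarrow> real) \<Rightarrow> bool" where
  "uniform01 N U \<longleftrightarrow> U \<in> N \<rightarrow>\<^sub>M unif01 \<and> distr N unif01 U = unif01"

lemma uniform01_nn_integral:
  assumes "uniform01 N U" "f \<in> borel_measurable unif01"
  shows "(\<integral>\<^sup>+w. f (U w) \<partial>N) = (\<integral>\<^sup>+u. f u \<partial>unif01)"
  using assms nn_integral_distr[of U N unif01 f] by (simp add: uniform01_def)

lemma uniform01_integral:
  fixes f :: "real \<Rightarrow> real"
  assumes "uniform01 N U" "f \<in> borel_measurable unif01"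
  shows "(\<integral>w. f (U w) \<partial>N) = (\<integral>u. f u \<partial>unif01)"
  using assms integral_distr[of U N unif01 f] by (simp add: uniform01_def)

lemma uniform01_integrable:
  fixes f :: "real \<Rightarrow> real"
  assumes "uniform01 N U" "f \<in> borel_measurable unif01"
  shows "integrable N (\<lambda>w. f (U w)) \<longleftrightarrow> integrable unif01 f"
  using assms integrable_distr_eq[of U N unif01 f] by (simp add: uniform01_def)

lemma distr_uniform01:
  assumes "uniform01 N U" "f \<in> unif01 \<rightarrow>\<^sub>M K"
  shows "distr N K (\<lambda>w. f (U w)) = distr unif01 K f"
  using assms distr_distr[of f unif01 K U N] by (simp add: uniform01_def comp_def)

lemma uniform01_range:
  assumes "uniform01 N U" "w \<in> space N"
  shows "0 < U w" "U w < 1"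
  using assms by (auto simp: uniform01_def dest: measurable_space)

context prob_space
begin

lemma cdf_distribution_distr:
  assumes [measurable]: "Y \<in> borel_measurable M"
  shows "cdf_distribution (distr M borel Y)"
  by (simp add: cdf_distribution_def)

lemma cdf_distr:
  assumes [measurable]: "Y \<in> borel_measurable M"
  shows "cdf (distr M borel Y) x = prob {w \<in> space M. Y w \<le> x}"
  by (auto simp: cdf_def measure_distr intro!: arg_cong[where f = prob])

lemma quantile_le_iff:
  assumes [measurable]: "Y \<in> borel_measurable M" and "0 < u" "u < 1"
  shows "quantile M Y u \<le> x \<longleftrightarrow> u \<le> prob {w \<in> space M. Y w \<le> x}"
proof -
  interpret D: cdf_distribution "distr M borel Y" by (rule cdf_distribution_distr) measurable
  show ?thesis
    using D.pseudoinverse[of u x] assms(2,3) by (simp add: quantile_def cdf_distr)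
qed

lemma mono_quantile:
  assumes [measurable]: "Y \<in> borel_measurable M"
  shows "mono_on {0<..<1} (quantile M Y)"
proof -
  interpret D: cdf_distribution "distr M borel Y" by (rule cdf_distribution_distr) measurable
  show ?thesis using D.mono_I by (simp add: quantile_def[abs_def])
qed

lemma measurable_quantile [measurable]:
  "Y \<in> borel_measurable M \<Longrightarrow> quantile M Y \<in> borel_measurable unif01"
  by (intro measurable_mono_unif01 mono_quantile)

lemma distr_quantile:
  assumes [measurable]: "Y \<in> borel_measurable M"
  shows "distr unif01 borel (quantile M Y) = distr M borel Y"
proof -
  interpret D: cdf_distribution "distr M borel Y" by (rule cdf_distribution_distr) measurable
  show ?thesis using D.distr_I_eq_M by (simp add: quantile_def[abs_def] unif01_def)
qed

text \<open>At each rational level the sublevel set of \<open>B\<close> is almost surely contained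
  in that of \<open>A\<close> and has the same probability, so they agree up to a null set. Rational
  levels suffice, since one of them separates \<open>A w\<close> from a larger
  \<open>B w\<close>.\<close>

lemma AE_eq_of_le_of_distr_eq:
  fixes A B :: "'a \<Rightarrow> real"
  assumes [measurable]: "A \<in> borel_measurable M" "B \<in> borel_measurable M"
    and le: "AE w in M. A w \<le> B w" and eq: "distr M borel A = distr M borel B"
  shows "AE w in M. A w = B w"
proof -
  have "AE w in M. A w \<le> real_of_rat r \<longrightarrow> B w \<le> real_of_rat r" for r
  proof -
    let ?r = "real_of_rat r"
    let ?A = "{w \<in> space M. A w \<le> ?r}" and ?B = "{w \<in> space M. B w \<le> ?r}"
    have "prob ?A = prob ?B" using eq cdf_distr[of A ?r] cdf_distr[of B ?r] by simp
    also have "prob ?B = prob (?A \<inter> ?B)"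
      by (rule finite_measure_eq_AE) (use le in auto)
    finally have "prob (?A - ?B) = 0"
      using finite_measure_Diff'[of ?A ?B] by simp
    then have "AE w in M. w \<notin> ?A - ?B"
      by (subst (asm) prob_eq_0) auto
    then show ?thesis using AE_space by eventually_elim auto
  qed
  then have "AE w in M. \<forall>r. A w \<le> real_of_rat r \<longrightarrow> B w \<le> real_of_rat r"
    by (simp add: AE_all_countable)
  with le show ?thesis
  proof eventually_elim
    case (elim w)
    then show ?case using of_rat_dense[of "A w" "B w"] by (metis less_le_not_le order_antisym_conv linorder_le_less_linear)
  qed
qed

end

lemma quantile_cong_distr:
  "distr M borel Y = distr N borel Y' \<Longrightarrow> quantile M Y = quantile N Y'"
  by (simp add: quantile_def[abs_def])

text \<open>\<open>p\<close> need not be left-continuous, hence the equality only almost everywhere.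
  The quantile function lies below \<open>p\<close> at every point, because \<open>p\<close> maps
  everything up to \<open>u\<close> below \<open>p u\<close>; both functions have the same law, so
  they coincide almost surely.\<close>

lemma quantile_mono_uniform01:
  assumes "prob_space N" and U: "uniform01 N U" and p: "mono_on {0<..<1} p"
  shows "AE u in unif01. quantile N (\<lambda>w. p (U w)) u = p u"
proof -
  interpret N: prob_space N by fact
  interpret unif01: prob_space unif01 by (rule prob_space_unif01)
  have pm [measurable]: "p \<in> borel_measurable unif01" using p by (rule measurable_mono_unif01)
  have Um [measurable]: "U \<in> N \<rightarrow>\<^sub>M unif01" using U by (simp add: uniform01_def)
  have "quantile N (\<lambda>w. p (U w)) u \<le> p u" if u: "u \<in> {0<..<1}" for u
  proof -
    have "u = measure unif01 {v \<in> space unif01. v \<le> u}"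
      using u measure_unif01_le[of u] by simp
    also have "\<dots> \<le> measure unif01 {v \<in> space unif01. p v \<le> p u}"
      by (rule unif01.finite_measure_mono) (use p u in \<open>auto simp: mono_on_def simp del: space_unif01, simp\<close>)
    also have "\<dots> = measure (distr N unif01 U) {v \<in> space unif01. p v \<le> p u}"
      using U by (simp add: uniform01_def)
    also have "\<dots> = N.prob {w \<in> space N. p (U w) \<le> p u}"
      using measurable_space[OF Um] by (subst measure_distr[OF Um]) (measurable, auto intro!: arg_cong[where f = N.prob])
    finally show ?thesis using u by (subst N.quantile_le_iff) auto
  qed
  then show ?thesis
    using U by (intro unif01.AE_eq_of_le_of_distr_eq)
      (auto simp: N.distr_quantile distr_uniform01)
qed

text \<open>With \<open>p i\<close> centred at \<open>1/2\<close>, all summands have the same sign at every point.\<close>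

lemma integrable_summand_of_comonotone_sum:
  fixes p :: "'i \<Rightarrow> real \<Rightarrow> real"
  assumes \<gamma>: "integrable unif01 \<gamma>"
    and "finite I" "i \<in> I" "\<And>j. j \<in> I \<Longrightarrow> 0 \<le> b j" "\<And>j. j \<in> I \<Longrightarrow> mono_on {0<..<1} (p j)"
    and sum: "integrable unif01 (\<lambda>u. \<gamma> u * (\<Sum>j\<in>I. b j * p j u))"
  shows "integrable unif01 (\<lambda>u. b i * (\<gamma> u * p i u))"
proof -
  define r where "r j u = b j * (p j u - p j (1/2))" for j u
  have "integrable unif01 (\<lambda>u. \<gamma> u * (\<Sum>j\<in>I. b j * p j u) - \<gamma> u * (\<Sum>j\<in>I. b j * p j (1/2)))"
    using sum \<gamma> by auto
  then have int: "integrable unif01 (\<lambda>u. \<gamma> u * (\<Sum>j\<in>I. r j u))"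
    by (simp add: r_def sum_subtractf algebra_simps)
  have [measurable]: "\<gamma> \<in> borel_measurable unif01" "p i \<in> borel_measurable unif01"
    using \<gamma> assms by (auto intro: measurable_mono_unif01)
  have "\<bar>r i u\<bar> \<le> \<bar>\<Sum>j\<in>I. r j u\<bar>" if "u \<in> {0<..<1}" for u
  proof (cases "1/2 \<le> u")
    case True
    then have "0 \<le> r j u" if "j \<in> I" for j
      using assms(4)[OF that] mono_onD[OF assms(5)[OF that], of "1/2" u] \<open>u \<in> _\<close> by (simp add: r_def)
    then show ?thesis using member_le_sum[of i I "\<lambda>j. r j u"] assms(2,3) by (simp add: sum_nonneg)
  next
    case False
    then have "0 \<le> - r j u" if "j \<in> I" for j
      using assms(4)[OF that] mono_onD[OF assms(5)[OF that], of u "1/2"] \<open>u \<in> _\<close>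
      by (simp add: r_def mult_nonneg_nonpos)
    then show ?thesis using member_le_sum[of i I "\<lambda>j. - r j u"] assms(2,3)
      by (simp add: sum_negf sum_nonpos)
  qed
  then have "integrable unif01 (\<lambda>u. \<gamma> u * r i u)"
    using int by (elim Bochner_Integration.integrable_bound) (auto simp: r_def abs_mult intro!: AE_I2 mult_left_mono)
  then have "integrable unif01 (\<lambda>u. \<gamma> u * r i u + b i * p i (1/2) * \<gamma> u)"
    using \<gamma> by auto
  then show ?thesis by (simp add: r_def algebra_simps)
qed

section \<open>Separable generators and comonotonic vectors\<close>

lemma has_derivative_separable:
  assumes "\<And>k. strict_generator (\<phi> k)"
  shows "GDERIV (separable \<phi>) x :> (\<chi> k. deriv (\<phi> k) (x $ k))"
proof -
  have "((\<lambda>x. \<Sum>k\<in>UNIV. \<phi> k (x $ k)) has_derivative (\<lambda>h. \<Sum>k\<in>UNIV. deriv (\<phi> k) (x $ k) * h $ k)) (at x)"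
  proof (rule has_derivative_sum)
    fix k
    have "(\<phi> k has_derivative (\<lambda>h. deriv (\<phi> k) (x $ k) * h)) (at (x $ k))"
      using strict_generator.has_deriv[OF assms] by (simp add: has_field_derivative_def)
    from has_derivative_compose[OF bounded_linear_imp_has_derivative[OF bounded_linear_vec_nth[of k]] this]
    show "((\<lambda>x. \<phi> k (x $ k)) has_derivative (\<lambda>h. deriv (\<phi> k) (x $ k) * h $ k)) (at x)"
      by simp
  qed
  then show ?thesis
    by (simp add: gderiv_def inner_vec_def separable_def[abs_def] mult.commute)
qed

lemma gradient_separable:
  assumes "\<And>k. strict_generator (\<phi> k)"
  shows "gradient (separable \<phi>) x = (\<chi> k. deriv (\<phi> k) (x $ k))"
  unfolding gradient_def
proof (rule the_equality)
  show D: "GDERIV (separable \<phi>) x :> (\<chi> k. deriv (\<phi> k) (x $ k))"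
    by (rule has_derivative_separable[OF assms])
  fix D assume "GDERIV (separable \<phi>) x :> D"
  with D have "(\<lambda>h. h \<bullet> D) = (\<lambda>h. h \<bullet> (\<chi> k. deriv (\<phi> k) (x $ k)))"
    unfolding gderiv_def by (rule has_derivative_unique[rotated])
  then have "\<forall>h. h \<bullet> D = h \<bullet> (\<chi> k. deriv (\<phi> k) (x $ k))"
    by (intro allI) (rule fun_cong)
  then show "D = (\<chi> k. deriv (\<phi> k) (x $ k))"
    by (simp only: vector_eq_ldot)
qed

lemma bregman_div_separable:
  assumes "\<And>k. strict_generator (\<phi> k)"
  shows "bregman_div (separable \<phi>) z y = (\<Sum>k\<in>UNIV. bregman_div (\<phi> k) (z $ k) (y $ k))"
  unfolding strict_generator.bregman_div_eq[OF assms]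
  by (simp add: bregman_div_def gradient_separable[OF assms] separable_def inner_vec_def sum_subtractf)

lemma borel_measurable_vec_lambda [measurable (raw)]:
  fixes f :: "'n::finite \<Rightarrow> 'a \<Rightarrow> real"
  assumes "\<And>i. f i \<in> borel_measurable N"
  shows "(\<lambda>w. \<chi> i. f i w) \<in> borel_measurable N"
proof (rule borel_measurable_euclidean_space[THEN iffD2], rule ballI)
  fix b :: "real ^ 'n" assume "b \<in> Basis"
  then obtain i where "b = axis i 1" by (auto simp: Basis_vec_def)
  then show "(\<lambda>w. (\<chi> i. f i w) \<bullet> b) \<in> borel_measurable N"
    using assms by (simp add: inner_axis)
qed

text \<open>Closed lower orthants are stable under intersection, generate the Borel sets, and those
  with corner \<open>(n, ..., n)\<close> exhaust the space. Joint distribution functions therefore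
  determine laws.\<close>

lemma (in prob_space) distr_vec_eqI:
  fixes A :: "'a \<Rightarrow> real ^ 'n::finite" and B :: "'b \<Rightarrow> real ^ 'n"
  assumes [measurable]: "A \<in> borel_measurable M" "B \<in> borel_measurable N" and "prob_space N"
    and eq: "\<And>x. measure M {w \<in> space M. \<forall>i. A w $ i \<le> x $ i} = measure N {w \<in> space N. \<forall>i. B w $ i \<le> x $ i}"
  shows "distr M borel A = distr N borel B"
proof -
  interpret N: prob_space N by fact
  interpret DA: prob_space "distr M borel A" by (rule prob_space_distr) measurable
  have emb: "emeasure (distr M borel A) {..x} = emeasure (distr N borel B) {..x}" for x
  proof -
    have "emeasure (distr M borel A) {..x} = emeasure M {w \<in> space M. \<forall>i. A w $ i \<le> x $ i}"
      by (simp add: emeasure_distr vimage_def Int_def less_eq_vec_def conj_commute)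
    also have "\<dots> = emeasure N {w \<in> space N. \<forall>i. B w $ i \<le> x $ i}"
      by (simp add: emeasure_eq_measure N.emeasure_eq_measure eq)
    also have "\<dots> = emeasure (distr N borel B) {..x}"
      by (simp add: emeasure_distr vimage_def Int_def less_eq_vec_def conj_commute)
    finally show ?thesis .
  qed
  show ?thesis
  proof (rule measure_eqI_generator_eq[where E = "range atMost" and \<Omega> = UNIV and A = "\<lambda>n. {..\<chi> i. real n}"])
    show "Int_stable (range (atMost :: real^'n \<Rightarrow> _))"
    proof -
      have "{..a} \<inter> {..b} = {..\<chi> i. min (a $ i) (b $ i)}" for a b :: "real^'n"
        by (auto simp: less_eq_vec_def)
      then show ?thesis by (auto simp: Int_stable_def)
    qed
    show "sets (distr M borel A) = sigma_sets UNIV (range atMost)"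
      "sets (distr N borel B) = sigma_sets UNIV (range atMost)"
      by (simp_all add: borel_eq_atMost)
    show "(\<Union>n. {..\<chi> i. real n}) = (UNIV :: (real^'n) set)"
    proof (intro set_eqI iffI UNIV_I)
      fix x :: "real^'n"
      obtain n where "norm x \<le> real n" using real_arch_simple by blast
      then have "x \<le> (\<chi> i. real n)"
        using component_le_norm_cart[of x] by (auto simp: less_eq_vec_def intro: order_trans[OF abs_ge_self] order_trans)
      then show "x \<in> (\<Union>n. {..\<chi> i. real n})" by auto
    qed
    show "\<And>n. emeasure (distr M borel A) {..\<chi> i. real n} \<noteq> \<infinity>"
      using DA.emeasure_finite by simp
  qed (auto simp: emb)
qed

text \<open>On a set of full probability the events \<open>X w $ i \<le> x $ i\<close> form a chain:
  two points witnessing that neither of two events contains the other would violate comonotonicity.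
  Among finitely many sets of a chain, the least one is the intersection.\<close>

lemma (in prob_space) comonotonic_prob_le:
  fixes X :: "'a \<Rightarrow> real ^ 'n::finite"
  assumes [measurable]: "X \<in> borel_measurable M" and X: "comonotonic M X"
  shows "\<exists>i. prob {w \<in> space M. \<forall>j. X w $ j \<le> x $ j} = prob {w \<in> space M. X w $ i \<le> x $ i}"
proof -
  \<comment> \<open>Comonotonicity speaks of distinct components only; for \<open>i = j\<close> the
    product is a square and the whole space serves.\<close>
  have ex: "\<exists>S\<in>sets M. prob S = 1 \<and> (\<forall>w\<in>S. \<forall>w'\<in>S. 0 \<le> (X w $ i - X w' $ i) * (X w $ j - X w' $ j))" for i j
    using X prob_space by (cases "i = j") (auto simp: comonotonic_def intro!: bexI[of _ "space M"])
  let ?P = "\<lambda>i j S. S \<in> sets M \<and> prob S = 1 \<and> (\<forall>w\<in>S. \<forall>w'\<in>S. 0 \<le> (X w $ i - X w' $ i) * (X w $ j - X w' $ j))"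
  have "\<forall>i j. \<exists>S. ?P i j S" using ex unfolding Bex_def by blast
  then have "\<exists>S. \<forall>i j. ?P i j (S i j)" unfolding choice_iff .
  then obtain S where S: "\<And>i j. S i j \<in> sets M" "\<And>i j. prob (S i j) = 1"
    "\<And>i j w w'. w \<in> S i j \<Longrightarrow> w' \<in> S i j \<Longrightarrow> 0 \<le> (X w $ i - X w' $ i) * (X w $ j - X w' $ j)"
    by blast
  define T where "T = (\<Inter>i j. S i j)"
  have AE: "AE w in M. w \<in> T"
    unfolding T_def using S(1,2) by (auto simp: AE_all_countable prob_eq_1[symmetric])
  define E where "E i = {w \<in> T. X w $ i \<le> x $ i}" for i
  have chain: "E i \<subseteq> E j \<or> E j \<subseteq> E i" for i j
  proof (rule ccontr)
    assume "\<not> ?thesis"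
    then obtain w w' where "w \<in> E i - E j" "w' \<in> E j - E i" by blast
    then have "w \<in> T" "X w $ i \<le> x $ i" "x $ j < X w $ j"
      "w' \<in> T" "X w' $ j \<le> x $ j" "x $ i < X w' $ i"
      by (auto simp: E_def)
    moreover then have "0 \<le> (X w $ i - X w' $ i) * (X w $ j - X w' $ j)"
      by (intro S(3)[of _ i j]) (auto simp: T_def)
    ultimately show False by (smt (verit) mult_neg_pos)
  qed
  have "\<exists>i. \<forall>j. E i \<subseteq> E j"
  proof -
    have "finite (range E)" "range E \<noteq> {}" by auto
    from finite_has_minimal[OF this] obtain i where "\<And>j. E j \<subseteq> E i \<Longrightarrow> E i = E j" by auto
    with chain show ?thesis by (metis order_refl)
  qed
  then obtain i where i: "\<And>j. E i \<subseteq> E j" by blast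
  have "AE w in M. (\<forall>j. X w $ j \<le> x $ j) \<longleftrightarrow> X w $ i \<le> x $ i"
    using AE by eventually_elim (use i in \<open>auto simp: E_def\<close>)
  then show ?thesis
    by (intro exI[of _ i] finite_measure_eq_AE) auto
qed

text \<open>Both joint distribution functions are the minimum of the marginal ones: for
  \<open>X\<close> by the chain of events, for the vector of quantile functions because one
  \<open>u\<close> is compared with all marginal values.\<close>

lemma (in prob_space) comonotonic_distr:
  fixes X :: "'a \<Rightarrow> real ^ 'n::finite"
  assumes X[measurable]: "X \<in> borel_measurable M" and "comonotonic M X"
  shows "distr M borel X = distr unif01 borel (\<lambda>u. \<chi> i. quantile M (\<lambda>w. X w $ i) u)"
proof (rule distr_vec_eqI)
  interpret unif01: prob_space unif01 by (rule prob_space_unif01)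
  have [measurable]: "(\<lambda>w. X w $ i) \<in> borel_measurable M" for i
    by (rule measurable_compose[OF X borel_measurable_nth])
  show "(\<lambda>u. \<chi> i. quantile M (\<lambda>w. X w $ i) u) \<in> borel_measurable unif01" by measurable
  show "prob_space unif01" by (rule prob_space_unif01)
  fix x :: "real ^ 'n"
  obtain i where i: "prob {w \<in> space M. \<forall>j. X w $ j \<le> x $ j} = prob {w \<in> space M. X w $ i \<le> x $ i}" (is "?p = ?pi")
    using comonotonic_prob_le[OF assms] by blast
  have le: "?pi \<le> prob {w \<in> space M. X w $ j \<le> x $ j}" for j
    unfolding i[symmetric] by (rule finite_measure_mono) auto
  have "measure unif01 {u \<in> space unif01. \<forall>i. (\<chi> i. quantile M (\<lambda>w. X w $ i) u) $ i \<le> x $ i}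
      = measure unif01 {u \<in> space unif01. u \<le> ?pi}"
    using le by (intro arg_cong[where f = "measure unif01"]) (auto simp: quantile_le_iff, meson le order_trans)
  also have "\<dots> = ?pi"
  proof (cases "?pi < 1")
    case False
    then have "?pi = 1" using prob_le_1[of "{w \<in> space M. X w $ i \<le> x $ i}"] by linarith
    moreover then have "{u \<in> space unif01. u \<le> ?pi} = space unif01" by auto
    ultimately show ?thesis using unif01.prob_space by simp
  qed (use measure_unif01_le[of ?pi] in simp)
  finally show "?p = measure unif01 {u \<in> space unif01. \<forall>i. (\<chi> i. quantile M (\<lambda>w. X w $ i) u) $ i \<le> x $ i}"
    using i by simp
qed (rule X)

section \<open>Uniform variables on non-atomic spaces\<close>

text \<open>The distribution function is prescribed only strictly between 0 and 1; letting
  \<open>t\<close> tend to the two ends shows that \<open>U\<close> leaves the open interval with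
  probability 0.\<close>

lemma (in prob_space) uniform01_of_cdf:
  assumes U[measurable]: "U \<in> borel_measurable M"
    and cdf: "\<And>t. 0 < t \<Longrightarrow> t < 1 \<Longrightarrow> prob {w \<in> space M. U w \<le> t} = t"
  shows "\<exists>U'. uniform01 M U' \<and> (AE w in M. U' w = U w)"
proof -
  interpret unif01: prob_space unif01 by (rule prob_space_unif01)
  have "prob {w \<in> space M. U w \<le> 0} \<le> t" if "0 < t" "t < 1" for t
    by (subst cdf[OF that, symmetric], rule finite_measure_mono) (use that in auto)
  then have "prob {w \<in> space M. U w \<le> 0} \<le> 0"
    by (intro dense_ge_bounded[of 0 1]) auto
  then have "prob {w \<in> space M. U w \<le> 0} = 0" using measure_nonneg by (rule antisym)
  then have pos: "AE w in M. 0 < U w" by (subst (asm) prob_eq_0) (auto simp: not_le)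
  have "t \<le> prob {w \<in> space M. U w < 1}" if "0 < t" "t < 1" for t
    by (subst cdf[OF that, symmetric], rule finite_measure_mono) (use that in auto)
  then have "1 \<le> prob {w \<in> space M. U w < 1}"
    by (intro dense_le_bounded[of 0 1]) auto
  then have "prob {w \<in> space M. U w < 1} = 1" using prob_le_1 by (rule antisym[rotated])
  then have lt1: "AE w in M. U w < 1" by (subst (asm) prob_eq_1) auto
  \<comment> \<open>The value 1/2 is an arbitrary interior point; changing \<open>U\<close> on a
    null set makes the range condition hold everywhere.\<close>
  define U' where "U' w = (if 0 < U w \<and> U w < 1 then U w else 1/2)" for w
  have [measurable]: "U' \<in> borel_measurable M" unfolding U'_def by measurable
  have AE: "AE w in M. U' w = U w" using pos lt1 by eventually_elim (simp add: U'_def)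
  have range: "0 < U' w" "U' w < 1" for w by (auto simp: U'_def)
  have U'01[measurable]: "U' \<in> M \<rightarrow>\<^sub>M unif01"
    using measurable_restrict_space2[of U' M "{0<..<1}" borel] range
    by (subst measurable_cong_sets[OF refl sets_unif01]) auto
  note measurable_ident_unif01[measurable]
  have "distr M borel U' = distr unif01 borel (\<lambda>x. x)"
  proof (rule cdf_unique)
    show "real_distribution (distr M borel U')" "real_distribution (distr unif01 borel (\<lambda>x. x))"
      by (auto intro!: real_distribution_distr unif01.real_distribution_distr)
    show "cdf (distr M borel U') = cdf (distr unif01 borel (\<lambda>x. x))"
    proof
      fix t :: real
      have lhs: "cdf (distr M borel U') t = prob {w \<in> space M. U' w \<le> t}" by (rule cdf_distr) measurable
      have rhs: "cdf (distr unif01 borel (\<lambda>x. x)) t = measure unif01 {u \<in> space unif01. u \<le> t}"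
        by (rule unif01.cdf_distr) measurable
      consider "t \<le> 0" | "0 < t" "t < 1" | "1 \<le> t" by linarith
      then show "cdf (distr M borel U') t = cdf (distr unif01 borel (\<lambda>x. x)) t"
      proof cases
        case 1
        then have empty: "{w \<in> space M. U' w \<le> t} = {}" "{u \<in> space unif01. u \<le> t} = {}"
          using range by (auto simp: not_le intro: le_less_trans)
        show ?thesis unfolding lhs rhs empty by simp
      next
        case 2
        have "prob {w \<in> space M. U' w \<le> t} = prob {w \<in> space M. U w \<le> t}"
          by (rule finite_measure_eq_AE) (use AE in auto)
        then show ?thesis unfolding lhs rhs using 2 cdf[of t] measure_unif01_le[of t] by simp
      next
        case 3
        then have "{w \<in> space M. U' w \<le> t} = space M" "{u \<in> space unif01. u \<le> t} = space unif01"
          using range by (auto intro: less_imp_le less_le_trans)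
        then show ?thesis unfolding lhs rhs using prob_space unif01.prob_space by simp
      qed
    qed
  qed
  then have eq: "emeasure (distr M borel U') A = emeasure (distr unif01 borel (\<lambda>x. x)) A" for A by simp
  have "distr M unif01 U' = unif01"
  proof (rule measure_eqI)
    fix A assume "A \<in> sets (distr M unif01 U')"
    then have A: "A \<in> sets unif01" by simp
    then have B: "A \<in> sets borel" "A \<subseteq> {0<..<1}"
      by (auto simp: sets_unif01 sets_restrict_space)
    have "emeasure (distr M unif01 U') A = emeasure (distr M borel U') A"
      using A B by (simp add: emeasure_distr)
    also have "\<dots> = emeasure unif01 A"
      unfolding eq using B by (simp add: emeasure_distr Int_absorb2)
    finally show "emeasure (distr M unif01 U') A = emeasure unif01 A" .
  qed simp
  with U'01 have "uniform01 M U'" unfolding uniform01_def by (rule conjI)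
  with AE show ?thesis by blast
qed

context prob_space
begin

text \<open>A subset and its relative complement cannot both carry more than half of the mass.
  Repeated halving brings the probability below any \<open>e\<close>.\<close>

lemma nonatomic_small_subset:
  assumes "nonatomic M" and A: "A \<in> sets M" "0 < prob A" and "0 < e"
  shows "\<exists>B\<in>sets M. B \<subseteq> A \<and> 0 < prob B \<and> prob B \<le> e"
proof -
  have half: "\<exists>B\<in>sets M. B \<subseteq> C \<and> 0 < prob B \<and> prob B \<le> prob C / 2"
    if "C \<in> sets M" "0 < prob C" for C
  proof -
    have "\<exists>B\<in>sets M. B \<subseteq> C \<and> 0 < prob B \<and> prob B < prob C"
      using assms(1) that unfolding nonatomic_def
      by (simp add: emeasure_eq_measure ennreal_less_iff)
    then obtain B where B: "B \<in> sets M" "B \<subseteq> C" "0 < prob B" "prob B < prob C" by blast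
    show ?thesis
    proof (cases "prob B \<le> prob C / 2")
      case False
      moreover have "prob (C - B) = prob C - prob B" using B that by (intro finite_measure_Diff) auto
      ultimately show ?thesis using B that by (intro bexI[of _ "C - B"]) auto
    qed (use B in auto)
  qed
  have "\<exists>B\<in>sets M. B \<subseteq> A \<and> 0 < prob B \<and> prob B \<le> prob A / 2 ^ n" for n
  proof (induction n)
    case (Suc n)
    then obtain B where B: "B \<in> sets M" "B \<subseteq> A" "0 < prob B" "prob B \<le> prob A / 2 ^ n" by auto
    from half[OF B(1,3)] obtain C where "C \<in> sets M" "C \<subseteq> B" "0 < prob C" "prob C \<le> prob B / 2" by auto
    moreover then have "prob C \<le> prob A / 2 ^ n / 2" 
      using divide_right_mono[OF B(4), of 2] by linarith
    ultimately show ?case using B by (intro bexI[of _ C]) (auto simp: mult.commute)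
  qed (use A in auto)
  moreover obtain n where "prob A / 2 ^ n \<le> e"
  proof -
    obtain n where "prob A / e < 2 ^ n" using real_arch_pow[of 2 "prob A / e"] by auto
    then show ?thesis using \<open>0 < e\<close> by (intro that[of n]) (simp add: field_simps)
  qed
  ultimately show ?thesis by (meson order_trans)
qed

text \<open>Greedy exhaustion. Each stage adds a set with at least half of the supremal admissible
  mass, as the supremum itself may not be attained. If the limit stayed below \<open>t\<close>, a
  set of positive mass in the remainder would be admissible at every stage, although the increments
  tend to 0.\<close>

lemma nonatomic_subset_prob:
  assumes "nonatomic M" and A: "A \<in> sets M" and t: "0 \<le> t" "t \<le> prob A"
  shows "\<exists>B\<in>sets M. B \<subseteq> A \<and> prob B = t"
proof -
  define P where "P B \<longleftrightarrow> B \<in> sets M \<and> B \<subseteq> A \<and> prob B \<le> t" for B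
  define Q where "Q B B' \<longleftrightarrow> B \<subseteq> B' \<and>
    (\<forall>D\<in>sets M. D \<subseteq> A - B \<longrightarrow> prob D \<le> t - prob B \<longrightarrow> prob D \<le> 2 * (prob B' - prob B))" for B B'
  have step: "\<exists>B'. P B' \<and> Q B B'" if B: "P B" for B
  proof -
    define S where "S = {prob D | D. D \<in> sets M \<and> D \<subseteq> A - B \<and> prob D \<le> t - prob B}"
    have "0 \<in> S" using B by (auto simp: S_def P_def intro!: exI[of _ "{}"])
    have bdd: "bdd_above S" by (rule bdd_aboveI[of _ 1]) (auto simp: S_def)
    have "\<exists>s\<in>S. Sup S \<le> 2 * s"
    proof (cases "Sup S \<le> 0")
      case True
      then show ?thesis using \<open>0 \<in> S\<close> by (intro bexI[of _ 0]) simp_all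
    next
      case False
      then have "Sup S / 2 < Sup S" by simp
      then obtain s where "s \<in> S" "Sup S / 2 < s"
        using less_cSup_iff[of S "Sup S / 2"] bdd \<open>0 \<in> S\<close> by auto
      then show ?thesis by (intro bexI[of _ s]) auto
    qed
    then obtain C where C: "C \<in> sets M" "C \<subseteq> A - B" "prob C \<le> t - prob B" "Sup S \<le> 2 * prob C"
      by (auto simp: S_def)
    have pBC: "prob (B \<union> C) = prob B + prob C"
      using B C by (intro finite_measure_Union) (auto simp: P_def)
    have "prob D \<le> 2 * prob C" if "D \<in> sets M" "D \<subseteq> A - B" "prob D \<le> t - prob B" for D
    proof -
      have "prob D \<in> S" using that by (auto simp: S_def)
      from cSup_upper[OF this bdd] C(4) show ?thesis by linarith
    qed
    then show ?thesis
      using B C pBC by (intro exI[of _ "B \<union> C"]) (auto simp: P_def Q_def)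
  qed
  have "P {}" using t by (simp add: P_def)
  then obtain f where f: "\<And>n. P (f n)" "\<And>n. Q (f n) (f (Suc n))"
    using dependent_nat_choice[of "\<lambda>_. P" "\<lambda>_. Q"] step by blast
  have inc: "incseq f" using f(2) by (auto simp: Q_def intro: incseq_SucI)
  have fm: "f n \<in> sets M" "f n \<subseteq> A" "prob (f n) \<le> t" for n using f(1)[of n] by (auto simp: P_def)
  define L where "L = (\<Union>n. f n)"
  have L: "L \<in> sets M" "L \<subseteq> A" using fm by (auto simp: L_def)
  have lim: "(\<lambda>n. prob (f n)) \<longlonglongrightarrow> prob L"
    unfolding L_def by (rule finite_Lim_measure_incseq) (use fm inc in auto)
  have fL: "prob (f n) \<le> prob L" for n using fm L by (intro finite_measure_mono) (auto simp: L_def)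
  have "prob L \<le> t" using lim fm(3) by (intro LIMSEQ_le_const2) auto
  moreover have "\<not> prob L < t"
  proof
    assume "prob L < t"
    then have "0 < prob (A - L)" using t L A by (subst finite_measure_Diff) auto
    then obtain D where D: "D \<in> sets M" "D \<subseteq> A - L" "0 < prob D" "prob D \<le> t - prob L"
      using nonatomic_small_subset[OF assms(1), of "A - L" "t - prob L"] A L \<open>prob L < t\<close> by auto
    have "prob D \<le> 2 * (prob (f (Suc n)) - prob (f n))" for n
      using f(2)[of n] D fL[of n] unfolding Q_def L_def by (smt (verit) Diff_mono UN_upper UNIV_I order_refl order_trans)
    moreover have "(\<lambda>n. 2 * (prob (f (Suc n)) - prob (f n))) \<longlonglongrightarrow> 2 * (prob L - prob L)"
      by (intro tendsto_intros lim LIMSEQ_Suc)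
    ultimately have "prob D \<le> 2 * (prob L - prob L)" by (intro LIMSEQ_le_const) auto
    with D(3) show False by simp
  qed
  ultimately show ?thesis using L by (intro bexI[of _ L]) auto
qed

text \<open>\<open>V n\<close> consists of the first \<open>n\<close> binary digits of the uniform random variable.\<close>

lemma nonatomic_imp_uniform01:
  assumes na: "nonatomic M"
  shows "\<exists>U. uniform01 M U"
proof -
  define P where "P n V \<longleftrightarrow> V \<in> M \<rightarrow>\<^sub>M count_space UNIV \<and>
     (\<forall>k. prob {w \<in> space M. V w = k} = (if k < 2 ^ n then 1 / 2 ^ n else 0))" for n and V :: "'a \<Rightarrow> nat"
  define Q where "Q V V' \<longleftrightarrow> (\<forall>w. V' w = 2 * V w \<or> V' w = 2 * V w + 1)" for V V' :: "'a \<Rightarrow> nat"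
  have step: "\<exists>V'. P (Suc n) V' \<and> Q V V'" if V: "P n V" for n V
  proof -
    have [measurable]: "V \<in> M \<rightarrow>\<^sub>M count_space UNIV" using V by (simp add: P_def)
    have "\<exists>B. B \<in> sets M \<and> B \<subseteq> {w \<in> space M. V w = k} \<and> prob B = prob {w \<in> space M. V w = k} / 2" for k
      using nonatomic_subset_prob[OF na, of "{w \<in> space M. V w = k}" "prob {w \<in> space M. V w = k} / 2"] by auto
    then have "\<forall>k. \<exists>B. B \<in> sets M \<and> B \<subseteq> {w \<in> space M. V w = k} \<and> prob B = prob {w \<in> space M. V w = k} / 2" by blast
    from choice[OF this] obtain H where
      "\<forall>k. H k \<in> sets M \<and> H k \<subseteq> {w \<in> space M. V w = k} \<and> prob (H k) = prob {w \<in> space M. V w = k} / 2"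
      by (rule exE)
    then have H: "\<And>k. H k \<in> sets M" "\<And>k. H k \<subseteq> {w \<in> space M. V w = k}"
      "\<And>k. prob (H k) = prob {w \<in> space M. V w = k} / 2" by simp_all
    note H(1)[measurable]
    \<comment> \<open>The new digit is 1 on one half of each level set of \<open>V\<close>, so all
      refined level sets get the same probability.\<close>
    define V' where "V' w = 2 * V w + (if w \<in> (\<Union>k. H k) then 1 else 0)" for w
    have [measurable]: "V' \<in> M \<rightarrow>\<^sub>M count_space UNIV" unfolding V'_def by measurable
    have "prob {w \<in> space M. V' w = k} = (if k < 2 ^ Suc n then 1 / 2 ^ Suc n else 0)" for k
    proof (cases "even k")
      case True
      then obtain j where j: "k = 2 * j" by auto
      have "{w \<in> space M. V' w = k} = {w \<in> space M. V w = j} - H j"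
        unfolding j V'_def using H(2) by (auto; presburger)
      then have "prob {w \<in> space M. V' w = k} = prob {w \<in> space M. V w = j} - prob (H j)"
        using H(2)[of j] by (simp add: finite_measure_Diff)
      then show ?thesis using V unfolding H(3) P_def j by (auto simp: field_simps)
    next
      case False
      then obtain j where j: "k = 2 * j + 1" using oddE by blast
      have "{w \<in> space M. V' w = k} = H j"
        unfolding j V'_def using H(2) by (auto; presburger)
      then show ?thesis using V unfolding P_def j by (auto simp: H(3) field_simps)
    qed
    then show ?thesis by (intro exI[of _ V']) (auto simp: P_def Q_def V'_def)
  qed
  have "P 0 (\<lambda>_. 0)" by (auto simp: P_def prob_space)
  then obtain V where V: "\<And>n. P n (V n)" "\<And>n. Q (V n) (V (Suc n))"
    using dependent_nat_choice[of P "\<lambda>_. Q"] step by blast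
  have [measurable]: "V n \<in> M \<rightarrow>\<^sub>M count_space UNIV" for n using V(1)[of n] by (simp add: P_def)
  have PV: "prob {w \<in> space M. V n w < k} = k / 2 ^ n" if "k \<le> 2 ^ n" for n k
    using that
  proof (induction k)
    case (Suc k)
    have "{w \<in> space M. V n w < Suc k} = {w \<in> space M. V n w < k} \<union> {w \<in> space M. V n w = k}"
      by auto
    then have "prob {w \<in> space M. V n w < Suc k} = prob {w \<in> space M. V n w < k} + prob {w \<in> space M. V n w = k}"
      by (simp add: finite_measure_Union disjoint_iff)
    with Suc V(1)[of n] show ?case by (auto simp: P_def field_simps)
  qed simp
  define U where "U w = lim (\<lambda>n. real (V n w) / 2 ^ n)" for w
  \<comment> \<open>The truncated expansions increase and the ones rounded up decrease, so
    \<open>U w\<close> is enclosed in a dyadic interval of length \<open>1 / 2 ^ n\<close> for every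
    \<open>n\<close>.\<close>
  have lo: "incseq (\<lambda>n. real (V n w) / 2 ^ n)" for w
  proof (rule incseq_SucI)
    fix n show "real (V n w) / 2 ^ n \<le> real (V (Suc n) w) / 2 ^ Suc n"
      using V(2)[of n] unfolding Q_def by (auto simp: field_simps dest!: spec[of _ w])
  qed
  have hi: "decseq (\<lambda>n. (real (V n w) + 1) / 2 ^ n)" for w
  proof (rule decseq_SucI)
    fix n show "(real (V (Suc n) w) + 1) / 2 ^ Suc n \<le> (real (V n w) + 1) / 2 ^ n"
      using V(2)[of n] unfolding Q_def by (auto simp: field_simps dest!: spec[of _ w])
  qed
  have conv: "(\<lambda>n. real (V n w) / 2 ^ n) \<longlonglongrightarrow> U w" for w
  proof -
    have "real (V n w) / 2 ^ n \<le> real (V 0 w) + 1" for n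
      using decseqD[OF hi[of w], of 0 n] by (simp add: add_divide_distrib) (smt (verit) divide_nonneg_nonneg zero_le_power)
    then have "convergent (\<lambda>n. real (V n w) / 2 ^ n)"
      using incseq_convergent[OF lo[of w]] by (metis convergentI)
    then show ?thesis by (simp add: U_def convergent_LIMSEQ_iff)
  qed
  have half0: "(\<lambda>n. 1 / 2 ^ n :: real) \<longlonglongrightarrow> 0"
    using LIMSEQ_realpow_zero[of "1/2"] by (simp add: power_divide)
  have conv': "(\<lambda>n. (real (V n w) + 1) / 2 ^ n) \<longlonglongrightarrow> U w" for w
  proof -
    from tendsto_add[OF conv half0] show ?thesis by (simp add: add_divide_distrib)
  qed
  have [measurable]: "U \<in> borel_measurable M" unfolding U_def by measurable
  have "prob {w \<in> space M. U w \<le> t} = t" if t: "0 < t" "t < 1" for t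
  proof (rule antisym)
    \<comment> \<open>\<open>m n\<close> indexes the dyadic interval containing \<open>t\<close>;
      comparing \<open>V n\<close> with it determines the probability of \<open>U w \<le> t\<close>
      up to an error of \<open>1 / 2 ^ n\<close>.\<close>
    define m where "m n = nat \<lfloor>t * 2 ^ n\<rfloor>" for n
    have m: "real (m n) \<le> t * 2 ^ n" "t * 2 ^ n < real (m n) + 1" for n
      using t by (auto simp: m_def)
    have m_lt: "m n < 2 ^ n" for n
    proof -
      have "real (m n) < 2 ^ n" using m(1)[of n] t by (smt (verit) mult_less_cancel_right2 zero_less_power)
      then show ?thesis by (metis of_nat_less_iff of_nat_numeral of_nat_power)
    qed
    have upper: "prob {w \<in> space M. U w \<le> t} \<le> t + 1 / 2 ^ n" for n
    proof -
      have "V n w < Suc (m n)" if "U w \<le> t" for w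
      proof -
        have "real (V n w) / 2 ^ n \<le> t" using incseq_le[OF lo conv] that by (rule order_trans)
        then have "real (V n w) < real (m n) + 1" using m(2)[of n] by (simp add: field_simps)
        then show ?thesis by linarith
      qed
      then have "prob {w \<in> space M. U w \<le> t} \<le> prob {w \<in> space M. V n w < Suc (m n)}"
        by (intro finite_measure_mono) auto
      also have "\<dots> = (real (m n) + 1) / 2 ^ n" using m_lt[of n] by (subst PV) auto
      also have "\<dots> \<le> t + 1 / 2 ^ n" using m(1)[of n] by (simp add: field_simps)
      finally show ?thesis .
    qed
    have lower: "t - 1 / 2 ^ n \<le> prob {w \<in> space M. U w \<le> t}" for n
    proof -
      have "U w \<le> t" if "V n w < m n" for w
      proof -
        have "U w \<le> (real (V n w) + 1) / 2 ^ n" by (rule decseq_ge[OF hi conv'])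
        also have "\<dots> \<le> real (m n) / 2 ^ n" using that by (intro divide_right_mono) auto
        also have "\<dots> \<le> t" using m(1)[of n] by (simp add: field_simps)
        finally show ?thesis .
      qed
      then have "prob {w \<in> space M. V n w < m n} \<le> prob {w \<in> space M. U w \<le> t}"
        by (intro finite_measure_mono) auto
      moreover have "prob {w \<in> space M. V n w < m n} = real (m n) / 2 ^ n" using m_lt[of n] by (subst PV) auto
      moreover have "t \<le> (real (m n) + 1) / 2 ^ n" using m(2)[of n] by (simp add: pos_le_divide_eq)
      then have "t - 1 / 2 ^ n \<le> real (m n) / 2 ^ n" by (simp add: add_divide_distrib)
      ultimately show ?thesis by linarith
    qed
    have "(\<lambda>n. t + 1 / 2 ^ n) \<longlonglongrightarrow> t" "(\<lambda>n. t - 1 / 2 ^ n) \<longlonglongrightarrow> t"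
      using tendsto_add[OF tendsto_const[of t] half0] tendsto_diff[OF tendsto_const[of t] half0] by simp_all
    with upper lower show "prob {w \<in> space M. U w \<le> t} \<le> t" "t \<le> prob {w \<in> space M. U w \<le> t}"
      by (auto intro: LIMSEQ_le_const LIMSEQ_le_const2)
  qed
  then show ?thesis using uniform01_of_cdf[of U] by auto
qed

end

section \<open>Distortions\<close>

declare measurable_ident_unif01 [measurable]

section \<open>One-sided derivatives and monotone slopes\<close>

lemma abs_continuous_on_imp_continuous_on:
  assumes "abs_continuous_on a b f"
  shows "continuous_on {a..b} f"
  unfolding continuous_on_iff
proof (intro ballI allI impI)
  fix x e :: real assume x: "x \<in> {a..b}" and e: "0 < e"
  from assms[unfolded abs_continuous_on_def, rule_format, OF e]
  obtain d where "0 < d" and d: "\<forall>(s :: nat \<Rightarrow> real) t N.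
      (\<forall>i<N. a \<le> s i \<and> s i \<le> t i \<and> t i \<le> b) \<and> disjoint_family_on (\<lambda>i. {s i<..<t i}) {..<N} \<and>
      (\<Sum>i<N. t i - s i) < d \<longrightarrow> (\<Sum>i<N. \<bar>f (t i) - f (s i)\<bar>) < e"
    by (elim exE conjE)
  have "\<bar>f y - f x\<bar> < e" if "y \<in> {a..b}" "\<bar>y - x\<bar> < d" for y
    using d[THEN spec[of _ "\<lambda>_. min x y"], THEN spec[of _ "\<lambda>_. max x y"], THEN spec[of _ 1]] x that
    by (cases "x \<le> y") (simp_all add: disjoint_family_on_def abs_minus_commute)
  with \<open>0 < d\<close> show "\<exists>d>0. \<forall>y\<in>{a..b}. dist y x < d \<longrightarrow> dist (f y) (f x) < e"
    by (auto simp: dist_real_def)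
qed

text \<open>With one-sided derivatives, a maximum argument replaces the mean value theorem. After
  subtracting a line of slope \<open>c + e\<close> every left derivative is negative, so a maximum
  away from \<open>a\<close> would be exceeded just to its left. The slack \<open>e\<close> makes
  the sign strict and then tends to 0.\<close>

lemma left_derivative_le_imp_increment_le:
  fixes f :: "real \<Rightarrow> real"
  assumes "a \<le> b" "continuous_on {a..b} f"
    and deriv: "\<And>x. a < x \<Longrightarrow> x \<le> b \<Longrightarrow> (f has_real_derivative g x) (at_left x)"
    and le: "\<And>x. a < x \<Longrightarrow> x \<le> b \<Longrightarrow> g x \<le> c"
  shows "f b - f a \<le> c * (b - a)"
proof -
  have "f b - f a \<le> (c + e) * (b - a)" if "0 < e" for e
  proof -
    define k where "k x = f x - (c + e) * x" for x
    have "continuous_on {a..b} k" unfolding k_def by (intro continuous_intros assms)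
    then obtain m where m: "m \<in> {a..b}" "\<And>y. y \<in> {a..b} \<Longrightarrow> k y \<le> k m"
      using continuous_attains_sup[of "{a..b}" k] \<open>a \<le> b\<close> by auto
    have "m = a"
    proof (rule ccontr)
      assume "m \<noteq> a"
      then have am: "a < m" "m \<le> b" using m(1) by auto
      have "(k has_real_derivative g m - (c + e)) (at_left m)"
        unfolding k_def using deriv[OF am] by (auto intro!: derivative_eq_intros)
      then obtain d where "0 < d" "\<And>h. 0 < h \<Longrightarrow> m - h \<in> {..<m} \<Longrightarrow> h < d \<Longrightarrow> k m < k (m - h)"
        using has_real_derivative_neg_dec_left[of k "g m - (c + e)" m "{..<m}"] le[OF am] \<open>0 < e\<close> by auto
      moreover define h where "h = min (d / 2) (m - a)"
      ultimately have "0 < h" "h \<le> m - a" "k m < k (m - h)" using am by (auto simp: min_def)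
      then show False using m(2)[of "m - h"] am by auto
    qed
    then have "k b \<le> k a" using m(2)[of b] \<open>a \<le> b\<close> by auto
    then show ?thesis by (simp add: k_def algebra_simps)
  qed
  then have "f b - f a \<le> c * (b - a) + e * (b - a)" if "0 < e" for e
    using that by (simp add: distrib_right)
  moreover have "((\<lambda>e. c * (b - a) + e * (b - a)) \<longlongrightarrow> c * (b - a) + 0 * (b - a)) (at_right 0)"
    by (intro tendsto_intros)
  ultimately show ?thesis
    using tendsto_lowerbound[of "\<lambda>e. c * (b - a) + e * (b - a)" "c * (b - a) + 0 * (b - a)" "at_right 0" "f b - f a"]
    by (simp add: eventually_at_right_less eventually_mono[OF eventually_at_right_less])
qed

text \<open>Two functions whose increments are both squeezed by a monotone slope differ by a constant: refine
  the partition and telescope.\<close>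

lemma monotone_slope_unique:
  fixes F H g :: "real \<Rightarrow> real"
  assumes ab: "a \<le> b" and g: "mono_on {a..b} g"
    and F: "\<And>x y. a \<le> x \<Longrightarrow> x \<le> y \<Longrightarrow> y \<le> b \<Longrightarrow> g x * (y - x) \<le> F y - F x \<and> F y - F x \<le> g y * (y - x)"
    and H: "\<And>x y. a \<le> x \<Longrightarrow> x \<le> y \<Longrightarrow> y \<le> b \<Longrightarrow> g x * (y - x) \<le> H y - H x \<and> H y - H x \<le> g y * (y - x)"
  shows "F b - F a = H b - H a"
proof -
  define D where "D x = F x - H x" for x
  have D: "\<bar>D y - D x\<bar> \<le> (g y - g x) * (y - x)" if "a \<le> x" "x \<le> y" "y \<le> b" for x y
    using F[OF that] H[OF that] by (auto simp: D_def abs_le_iff algebra_simps)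
  have "\<bar>D b - D a\<bar> \<le> (g b - g a) * (b - a) / real (Suc n)" for n
  proof -
    define p where "p k = a + real k * ((b - a) / real (Suc n))" for k
    have p0: "p 0 = a" and pN: "p (Suc n) = b" by (simp_all add: p_def)
    have step: "p (Suc k) - p k = (b - a) / real (Suc n)" for k
      by (simp add: p_def algebra_simps add_divide_distrib diff_divide_distrib)
    have mono: "p i \<le> p j" if "i \<le> j" for i j
      unfolding p_def using ab that by (intro add_left_mono mult_right_mono) auto
    have "\<bar>D (p (Suc n)) - D (p 0)\<bar> = \<bar>\<Sum>k<Suc n. D (p (Suc k)) - D (p k)\<bar>"
      by (subst sum_lessThan_telescope) simp
    also have "\<dots> \<le> (\<Sum>k<Suc n. \<bar>D (p (Suc k)) - D (p k)\<bar>)" by (rule sum_abs)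
    also have "\<dots> \<le> (\<Sum>k<Suc n. (g (p (Suc k)) - g (p k)) * ((b - a) / real (Suc n)))"
    proof (rule sum_mono)
      fix k assume "k \<in> {..<Suc n}"
      then have "a \<le> p k" "p k \<le> p (Suc k)" "p (Suc k) \<le> b"
        using mono[of 0 k] mono[of k "Suc k"] mono[of "Suc k" "Suc n"] p0 pN by auto
      from D[OF this] show "\<bar>D (p (Suc k)) - D (p k)\<bar> \<le> (g (p (Suc k)) - g (p k)) * ((b - a) / real (Suc n))"
        by (simp only: step)
    qed
    also have "\<dots> = (g (p (Suc n)) - g (p 0)) * ((b - a) / real (Suc n))"
      by (subst sum_distrib_right[symmetric], subst sum_lessThan_telescope) simp
    finally show ?thesis by (simp add: p0 pN)
  qed
  moreover have "(\<lambda>n. (g b - g a) * (b - a) / real (Suc n)) \<longlonglongrightarrow> 0"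
    by (rule LIMSEQ_Suc[OF lim_const_over_n])
  ultimately have "\<bar>D b - D a\<bar> \<le> 0"
    by (intro LIMSEQ_le_const) auto
  then show ?thesis by (simp add: D_def)
qed

section \<open>The distortion as an integral of its monotone weight\<close>

locale monotone_distortion =
  fixes h \<gamma> :: "real \<Rightarrow> real"
  assumes distortion: "distortion h"
    and weight: "distortion_weight h \<gamma>"
    and mono_weight: "mono_on {0<..<1} \<gamma>"
begin

lemma continuous_on_distortion: "continuous_on {0..1} h"
  using distortion abs_continuous_on_imp_continuous_on by (auto simp: distortion_def)

lemma h_0: "h 0 = 0"
  using distortion by (simp add: distortion_def)

text \<open>Under the reflection \<open>t \<mapsto> 1 - t\<close> the weight becomes the left
  derivative of \<open>h\<close>, bounded between its values at the two ends by monotonicity. The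
  lower bound is the upper one applied to \<open>- h\<close>.\<close>

lemma distortion_increment:
  assumes "0 < x" "x \<le> y" "y < 1"
  shows "\<gamma> x * (y - x) \<le> h (1 - x) - h (1 - y)" "h (1 - x) - h (1 - y) \<le> \<gamma> y * (y - x)"
proof -
  have cont: "continuous_on {1 - y..1 - x} h"
    using assms by (intro continuous_on_subset[OF continuous_on_distortion]) auto
  have deriv: "(h has_real_derivative \<gamma> (1 - t)) (at_left t)" if "1 - y < t" "t \<le> 1 - x" for t
    using weight that assms unfolding distortion_weight_def by (auto dest!: bspec[of _ _ "1 - t"])
  have \<gamma>: "\<gamma> x \<le> \<gamma> (1 - t)" "\<gamma> (1 - t) \<le> \<gamma> y" if "1 - y < t" "t \<le> 1 - x" for t
    using that assms by (auto intro!: mono_onD[OF mono_weight])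
  have "h (1 - x) - h (1 - y) \<le> \<gamma> y * (1 - x - (1 - y))"
    by (rule left_derivative_le_imp_increment_le[OF _ cont deriv \<gamma>(2)]) (use assms in simp)
  then show "h (1 - x) - h (1 - y) \<le> \<gamma> y * (y - x)" by simp
  have "(- h (1 - x)) - (- h (1 - y)) \<le> (- \<gamma> x) * (1 - x - (1 - y))"
  proof (rule left_derivative_le_imp_increment_le)
    show "((\<lambda>t. - h t) has_real_derivative - \<gamma> (1 - t)) (at_left t)" if "1 - y < t" "t \<le> 1 - x" for t
      by (rule DERIV_minus[OF deriv[OF that]])
  qed (use assms \<gamma> cont in \<open>auto intro: continuous_on_minus\<close>)
  then show "\<gamma> x * (y - x) \<le> h (1 - x) - h (1 - y)" by simp
qed

lemma measurable_weight [measurable]: "\<gamma> \<in> borel_measurable unif01"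
  using mono_weight by (rule measurable_mono_unif01)

lemma set_integrable_weight:
  assumes "0 < a" "b < 1"
  shows "set_integrable lborel {a..b} \<gamma>"
proof (cases "a \<le> b")
  case True
  have "(\<lambda>u. indicator {a..b} u *\<^sub>R \<gamma> u) \<in> borel_measurable lborel"
  proof -
    have "mono_on {a..b} \<gamma>" using assms by (intro mono_on_subset[OF mono_weight]) auto
    from borel_measurable_mono_on_fnc[OF this] show ?thesis
      using borel_measurable_restrict_space_iff[of "{a..b}" borel \<gamma>] by simp
  qed
  moreover have "norm (indicator {a..b} u *\<^sub>R \<gamma> u) \<le> indicator {a..b} u *\<^sub>R (\<bar>\<gamma> a\<bar> + \<bar>\<gamma> b\<bar>)" for u
    using mono_onD[OF mono_weight, of a u] mono_onD[OF mono_weight, of u b] assms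
    by (auto simp: indicator_def)
  moreover have "integrable lborel (\<lambda>u. indicator {a..b} u *\<^sub>R (\<bar>\<gamma> a\<bar> + \<bar>\<gamma> b\<bar>))"
    by (auto intro!: integrable_real_indicator simp: emeasure_lborel_Icc_eq)
  ultimately show ?thesis
    unfolding set_integrable_def by (elim Bochner_Integration.integrable_bound) (auto intro!: AE_I2 simp: abs_of_nonneg)
qed simp

text \<open>A fundamental theorem of calculus for a weight that may be discontinuous: the indefinite
  integral of \<open>\<gamma>\<close> and \<open>x \<mapsto> - h (1 - x)\<close> both have
  increments squeezed by \<open>\<gamma>\<close>, which determines them up to a constant.\<close>

lemma set_integral_weight:
  assumes "0 < a" "a \<le> b" "b < 1"
  shows "(LBINT u:{a..b}. \<gamma> u) = h (1 - a) - h (1 - b)"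
proof -
  define F where "F x = (LBINT u:{a..x}. \<gamma> u)" for x
  have F: "\<gamma> x * (y - x) \<le> F y - F x \<and> F y - F x \<le> \<gamma> y * (y - x)" if "a \<le> x" "x \<le> y" "y \<le> b" for x y
  proof -
    have "(LBINT u:{a..x} \<union> {x<..y}. \<gamma> u) = F x + (LBINT u:{x<..y}. \<gamma> u)"
      unfolding F_def using set_integrable_weight[of a y] assms that
      by (intro set_integral_Un) (auto intro: set_integrable_subset)
    moreover have "{a..x} \<union> {x<..y} = {a..y}" using that by auto
    ultimately have "F y - F x = (LBINT u:{x<..y}. \<gamma> u)" by (simp add: F_def)
    moreover have int: "set_integrable lborel {x<..y} \<gamma>"
      using set_integrable_weight[of a y] assms that by (auto intro: set_integrable_subset)
    have "(LBINT u:{x<..y}. \<gamma> x) \<le> (LBINT u:{x<..y}. \<gamma> u)"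
      using that assms by (intro set_integral_mono int) (auto intro!: mono_onD[OF mono_weight] simp: set_integrable_def)
    moreover have "(LBINT u:{x<..y}. \<gamma> u) \<le> (LBINT u:{x<..y}. \<gamma> y)"
      using that assms by (intro set_integral_mono int) (auto intro!: mono_onD[OF mono_weight] simp: set_integrable_def)
    ultimately show ?thesis using that by (simp add: set_lebesgue_integral_def mult.commute)
  qed
  have "F b - F a = (- h (1 - b)) - (- h (1 - a))"
  proof (rule monotone_slope_unique[OF \<open>a \<le> b\<close> _ F])
    show "mono_on {a..b} \<gamma>" using assms by (intro mono_on_subset[OF mono_weight]) auto
    show "\<gamma> x * (y - x) \<le> - h (1 - y) - - h (1 - x) \<and> - h (1 - y) - - h (1 - x) \<le> \<gamma> y * (y - x)"
      if "a \<le> x" "x \<le> y" "y \<le> b" for x y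
      using distortion_increment[of x y] assms that by auto
  qed
  moreover have "F a = 0"
    unfolding F_def set_lebesgue_integral_def
    by (rule integral_eq_zero_AE) (use AE_lborel_singleton[of a] in eventually_elim, simp)
  ultimately show ?thesis by (simp add: F_def)
qed

lemma has_bochner_integral_unif01_Icc:
  assumes "0 < a" "b < 1" "set_integrable lborel {a..b} f"
  shows "has_bochner_integral unif01 (\<lambda>u. indicator {a..b} u * f u :: real) (LBINT u:{a..b}. f u)"
proof -
  have "(\<lambda>u. indicator {0<..<1} u *\<^sub>R (indicator {a..b} u * f u)) = (\<lambda>u. indicator {a..b} u *\<^sub>R f u)"
    using assms by (auto simp: indicator_def fun_eq_iff)
  then show ?thesis
    using assms(3) by (simp add: has_bochner_integral_iff integrable_unif01 integral_unif01
        set_integrable_def set_lebesgue_integral_def)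
qed

text \<open>\<open>\<gamma>\<close> may be unbounded near 1. Subtracting \<open>\<gamma> a\<close>
  makes the integrand non-negative, so monotone convergence along \<open>b n\<close> tending to 1
  gives integrability and value at once; continuity of \<open>h\<close> at 0 supplies the
  limit.\<close>

lemma weight_upper:
  assumes a: "0 < a" "a < 1"
  shows "has_bochner_integral unif01 (\<lambda>u. indicator {a..} u * (\<gamma> u - \<gamma> a)) (h (1 - a) - \<gamma> a * (1 - a))"
proof (rule has_bochner_integral_monotone_convergence)
  define b where "b n = 1 - (1 - a) / real (Suc n)" for n
  have b: "a \<le> b n" "b n < 1" for n
    using a divide_left_mono[of 1 "real (Suc n)" "1 - a"] by (auto simp: b_def)
  have incb: "b n \<le> b m" if "n \<le> m" for n m
    using a that by (auto simp: b_def intro!: divide_left_mono)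
  have blim: "b \<longlonglongrightarrow> 1"
    unfolding b_def using tendsto_diff[OF tendsto_const LIMSEQ_Suc[OF lim_const_over_n[of "1 - a"]], of 1] by simp
  define f where "f n u = indicator {a..b n} u * (\<gamma> u - \<gamma> a)" for n u
  have f: "has_bochner_integral unif01 (f n) (h (1 - a) - h (1 - b n) - \<gamma> a * (b n - a))" for n
  proof -
    have *: "has_bochner_integral unif01 (\<lambda>u. indicator {a..b n} u * \<gamma> u) (h (1 - a) - h (1 - b n))"
      using has_bochner_integral_unif01_Icc[OF a(1) b(2) set_integrable_weight[OF a(1) b(2)]]
        set_integral_weight[OF a(1) b] by simp
    have "has_bochner_integral unif01 (\<lambda>u. indicator {a..b n} u * 1) (b n - a)"
      using has_bochner_integral_unif01_Icc[OF a(1) b(2), of n "\<lambda>_. 1"] b(1)[of n]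
      by (simp add: set_integrable_def set_lebesgue_integral_def)
    from has_bochner_integral_diff[OF * has_bochner_integral_mult_right[OF this, of "\<gamma> a"]]
    show ?thesis by (simp add: f_def[abs_def] algebra_simps)
  qed
  show "integrable unif01 (f n)" for n using f by (simp add: has_bochner_integral_iff)
  have "(\<lambda>n. h (1 - b n)) \<longlonglongrightarrow> h (1 - 1)"
  proof (intro continuous_on_tendsto_compose[OF continuous_on_distortion] tendsto_intros blim)
    have "1 - b n \<in> {0..1}" for n using b[of n] a by auto
    then show "\<forall>\<^sub>F n in sequentially. 1 - b n \<in> {0..1}" by (intro always_eventually) auto
  qed auto
  then have "(\<lambda>n. h (1 - a) - h (1 - b n) - \<gamma> a * (b n - a)) \<longlonglongrightarrow> h (1 - a) - h (1 - 1) - \<gamma> a * (1 - a)"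
    by (intro tendsto_intros blim)
  then show "(\<lambda>n. integral\<^sup>L unif01 (f n)) \<longlonglongrightarrow> h (1 - a) - \<gamma> a * (1 - a)"
    by (simp add: has_bochner_integral_integral_eq[OF f] h_0)
  show "AE u in unif01. mono (\<lambda>n. f n u)"
  proof (rule AE_I2, rule monoI)
    fix u n m assume "u \<in> space unif01" "(n::nat) \<le> m"
    then show "f n u \<le> f m u"
      using incb[of n m] a mono_onD[OF mono_weight, of a u] by (auto simp: f_def indicator_def)
  qed
  show "AE u in unif01. (\<lambda>n. f n u) \<longlonglongrightarrow> indicator {a..} u * (\<gamma> u - \<gamma> a)"
  proof (rule AE_I2)
    fix u assume "u \<in> space unif01"
    then have "\<forall>\<^sub>F n in sequentially. u < b n" using order_tendstoD(1)[OF blim, of u] by simp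
    then have "\<forall>\<^sub>F n in sequentially. f n u = indicator {a..} u * (\<gamma> u - \<gamma> a)"
      by eventually_elim (auto simp: f_def indicator_def)
    then show "(\<lambda>n. f n u) \<longlonglongrightarrow> indicator {a..} u * (\<gamma> u - \<gamma> a)" by (rule tendsto_eventually)
  qed
  show "(\<lambda>u. indicator {a..} u * (\<gamma> u - \<gamma> a)) \<in> borel_measurable unif01" by measurable
qed

text \<open>Mirror image at the left end, where \<open>\<gamma>\<close> may be unbounded below; the
  limit now comes from continuity of \<open>h\<close> at 1.\<close>

lemma weight_lower:
  assumes a: "0 < a" "a < 1"
  shows "has_bochner_integral unif01 (\<lambda>u. indicator {..a} u * (\<gamma> a - \<gamma> u)) (\<gamma> a * a - (h 1 - h (1 - a)))"
proof (rule has_bochner_integral_monotone_convergence)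
  define b where "b n = a / real (Suc n)" for n
  have b: "b n \<le> a" "0 < b n" for n using a by (auto simp: b_def field_simps)
  have decb: "b m \<le> b n" if "n \<le> m" for n m
    using a that by (auto simp: b_def intro!: divide_left_mono)
  have blim: "b \<longlonglongrightarrow> 0"
    unfolding b_def by (rule LIMSEQ_Suc[OF lim_const_over_n])
  define f where "f n u = indicator {b n..a} u * (\<gamma> a - \<gamma> u)" for n u
  have f: "has_bochner_integral unif01 (f n) (\<gamma> a * (a - b n) - (h (1 - b n) - h (1 - a)))" for n
  proof -
    have *: "has_bochner_integral unif01 (\<lambda>u. indicator {b n..a} u * \<gamma> u) (h (1 - b n) - h (1 - a))"
      using has_bochner_integral_unif01_Icc[OF b(2) a(2) set_integrable_weight[OF b(2) a(2)]]
        set_integral_weight[OF b(2,1) a(2)] by simp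
    have "has_bochner_integral unif01 (\<lambda>u. indicator {b n..a} u * 1) (a - b n)"
      using has_bochner_integral_unif01_Icc[OF b(2) a(2), of n "\<lambda>_. 1"] b(1)[of n]
      by (simp add: set_integrable_def set_lebesgue_integral_def)
    from has_bochner_integral_diff[OF has_bochner_integral_mult_right[OF this, of "\<gamma> a"] *]
    show ?thesis by (simp add: f_def[abs_def] algebra_simps)
  qed
  show "integrable unif01 (f n)" for n using f by (simp add: has_bochner_integral_iff)
  have "(\<lambda>n. h (1 - b n)) \<longlonglongrightarrow> h (1 - 0)"
  proof (intro continuous_on_tendsto_compose[OF continuous_on_distortion] tendsto_intros blim)
    show "\<forall>\<^sub>F n in sequentially. 1 - b n \<in> {0..1}"
      using b a by (intro always_eventually) (auto intro: order_trans[OF _ less_imp_le])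
  qed auto
  then have "(\<lambda>n. \<gamma> a * (a - b n) - (h (1 - b n) - h (1 - a))) \<longlonglongrightarrow> \<gamma> a * (a - 0) - (h (1 - 0) - h (1 - a))"
    by (intro tendsto_intros blim)
  then show "(\<lambda>n. integral\<^sup>L unif01 (f n)) \<longlonglongrightarrow> \<gamma> a * a - (h 1 - h (1 - a))"
    by (simp add: has_bochner_integral_integral_eq[OF f])
  show "AE u in unif01. mono (\<lambda>n. f n u)"
  proof (rule AE_I2, rule monoI)
    fix u n m assume "u \<in> space unif01" "(n::nat) \<le> m"
    then show "f n u \<le> f m u"
      using decb[of n m] a mono_onD[OF mono_weight, of u a] by (auto simp: f_def indicator_def)
  qed
  show "AE u in unif01. (\<lambda>n. f n u) \<longlonglongrightarrow> indicator {..a} u * (\<gamma> a - \<gamma> u)"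
  proof (rule AE_I2)
    fix u assume "u \<in> space unif01"
    then have "\<forall>\<^sub>F n in sequentially. b n < u" using order_tendstoD(2)[OF blim, of u] by simp
    then have "\<forall>\<^sub>F n in sequentially. f n u = indicator {..a} u * (\<gamma> a - \<gamma> u)"
      by eventually_elim (auto simp: f_def indicator_def)
    then show "(\<lambda>n. f n u) \<longlonglongrightarrow> indicator {..a} u * (\<gamma> a - \<gamma> u)" by (rule tendsto_eventually)
  qed
  show "(\<lambda>u. indicator {..a} u * (\<gamma> a - \<gamma> u)) \<in> borel_measurable unif01" by measurable
qed

lemma has_bochner_integral_cong_neq:
  assumes "has_bochner_integral unif01 f x" "g \<in> borel_measurable unif01"
    and "\<And>u. 0 < u \<Longrightarrow> u < 1 \<Longrightarrow> u \<noteq> a \<Longrightarrow> f u = g u"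
  shows "has_bochner_integral unif01 g (x :: real)"
proof -
  have "AE u in unif01. f u = g u"
    using AE_unif01_neq[of a] AE_space by eventually_elim (auto intro: assms(3))
  moreover have "f \<in> borel_measurable unif01" using assms(1) by (auto dest: borel_measurable_has_bochner_integral)
  ultimately show ?thesis using assms(1,2) has_bochner_integral_cong_AE[of f unif01 g x] by auto
qed

text \<open>The shift by \<open>\<gamma> a\<close> is undone with the uniform measure of each half.
  The two halves overlap or differ only at the point \<open>a\<close>, a null set.\<close>

lemma weight_tail_interior:
  assumes a: "0 < a" "a < 1"
  shows "has_bochner_integral unif01 (\<lambda>u. indicator {a<..} u * \<gamma> u) (h (1 - a))"
    and "has_bochner_integral unif01 \<gamma> (h 1)"
proof -
  interpret unif01: prob_space unif01 by (rule prob_space_unif01)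
  have "has_bochner_integral unif01 (indicator {u \<in> space unif01. u \<le> a}) (measure unif01 {u \<in> space unif01. u \<le> a})"
  proof (rule has_bochner_integral_real_indicator)
    show "{u \<in> space unif01. u \<le> a} \<in> sets unif01" by measurable
  qed (simp add: unif01.emeasure_finite less_top[symmetric])
  then have "has_bochner_integral unif01 (indicator {u \<in> space unif01. u \<le> a}) a"
    using measure_unif01_le[of a] a by simp
  then have le: "has_bochner_integral unif01 (indicator {..a}) a"
    by (rule has_bochner_integral_cong_neq[of _ _ _ a]) (auto simp: indicator_def)
  have one: "has_bochner_integral unif01 (\<lambda>_. 1 :: real) 1"
    using unif01.prob_space by (simp add: has_bochner_integral_iff lebesgue_integral_const)
  have lower: "has_bochner_integral unif01 (\<lambda>u. indicator {..a} u * \<gamma> u) (h 1 - h (1 - a))"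
    using has_bochner_integral_diff[OF has_bochner_integral_mult_right[OF le, of "\<gamma> a"] weight_lower[OF a]]
    by (simp add: algebra_simps)
  have "has_bochner_integral unif01 (\<lambda>u. 1 - indicator {..a} u) (1 - a)"
    by (rule has_bochner_integral_diff[OF one le])
  from has_bochner_integral_add[OF has_bochner_integral_mult_right[OF this, of "\<gamma> a"] weight_upper[OF a]]
  show upper: "has_bochner_integral unif01 (\<lambda>u. indicator {a<..} u * \<gamma> u) (h (1 - a))"
    unfolding add_diff_cancel_left' add_diff_eq
    by (rule has_bochner_integral_cong_neq[of _ _ _ a]) (auto simp: indicator_def)
  show "has_bochner_integral unif01 \<gamma> (h 1)"
    using has_bochner_integral_add[OF lower upper] unfolding diff_add_cancel
    by (rule has_bochner_integral_cong_neq[of _ _ _ a]) (auto simp: indicator_def)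
qed

lemma has_bochner_integral_weight: "has_bochner_integral unif01 \<gamma> (h 1)"
  by (rule weight_tail_interior[of "1/2"]) auto

lemma integrable_weight: "integrable unif01 \<gamma>"
  using has_bochner_integral_weight by (simp add: has_bochner_integral_iff)

lemma weight_tail:
  assumes "0 \<le> a" "a \<le> 1"
  shows "(\<integral>u. indicator {a<..} u * \<gamma> u \<partial>unif01) = h (1 - a)"
proof -
  consider "a = 0" | "0 < a" "a < 1" | "a = 1" using assms by linarith
  then show ?thesis
  proof cases
    case 1
    have "(\<integral>u. indicator {0<..} u * \<gamma> u \<partial>unif01) = (\<integral>u. \<gamma> u \<partial>unif01)"
      by (intro Bochner_Integration.integral_cong) auto
    with 1 show ?thesis using has_bochner_integral_weight by (simp add: has_bochner_integral_integral_eq)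
  next
    case 2
    then show ?thesis using weight_tail_interior(1) by (simp add: has_bochner_integral_integral_eq)
  next
    case 3
    have "(\<integral>u. indicator {1<..} u * \<gamma> u \<partial>unif01) = (\<integral>u. 0 \<partial>unif01)"
      by (intro Bochner_Integration.integral_cong) auto
    with 3 show ?thesis by (simp add: h_0)
  qed
qed

end

section \<open>Signed Choquet integrals as quantile integrals\<close>

text \<open>Layer-cake formula for a signed weight. Fubini asks for an absolute integral, whereas
  only the outer integral of the signed inner one is assumed finite. Outside \<open>{a..b}\<close>
  the inner integrand has one sign, so the absolute value can be taken after integration; inside,
  the inner integral is bounded by that of \<open>\<bar>\<gamma> u\<bar>\<close> and the interval
  has finite length.\<close>

lemma signed_layer_integral:
  fixes \<gamma> r :: "real \<Rightarrow> real" and E :: "real \<Rightarrow> real \<Rightarrow> bool"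
  assumes \<gamma>: "integrable unif01 \<gamma>"
    and [measurable]: "D \<in> sets borel" "Measurable.pred (lborel \<Otimes>\<^sub>M unif01) (\<lambda>(x, u). E x u)"
    and int: "set_integrable lborel D (\<lambda>x. \<integral>u. of_bool (E x u) * \<gamma> u \<partial>unif01)"
    and sgn: "\<And>x. x \<in> D \<Longrightarrow> x \<notin> {a..b} \<Longrightarrow>
      (\<forall>u\<in>{0<..<1}. E x u \<longrightarrow> 0 \<le> \<gamma> u) \<or> (\<forall>u\<in>{0<..<1}. E x u \<longrightarrow> \<gamma> u \<le> 0)"
    and r: "\<And>u. u \<in> {0<..<1} \<Longrightarrow> measure lborel {x \<in> D. E x u} = r u"
  shows "has_bochner_integral unif01 (\<lambda>u. \<gamma> u * r u) (LBINT x:D. \<integral>u. of_bool (E x u) * \<gamma> u \<partial>unif01)"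
proof -
  interpret unif01: prob_space unif01 by (rule prob_space_unif01)
  interpret P: pair_sigma_finite lborel unif01 ..
  have [measurable]: "\<gamma> \<in> borel_measurable unif01" using \<gamma> by simp
  define f where "f x u = indicator D x * (of_bool (E x u) * \<gamma> u)" for x u
  have fm [measurable]: "(\<lambda>(x, u). f x u) \<in> borel_measurable (lborel \<Otimes>\<^sub>M unif01)"
    unfolding f_def by measurable
  have intE: "integrable unif01 (f x)" for x
    using \<gamma> by (rule Bochner_Integration.integrable_bound) (auto simp: f_def indicator_def)
  have int_f: "integrable lborel (\<lambda>x. \<integral>u. f x u \<partial>unif01)"
    using int by (simp add: f_def set_integrable_def)
  have "integrable lborel (\<lambda>x. \<integral>u. norm (f x u) \<partial>unif01)"
  proof (rule Bochner_Integration.integrable_bound)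
    let ?C = "\<integral>u. \<bar>\<gamma> u\<bar> \<partial>unif01"
    show "integrable lborel (\<lambda>x. \<bar>\<integral>u. f x u \<partial>unif01\<bar> + indicator {a..b} x * ?C)"
      using int_f by (intro Bochner_Integration.integrable_add integrable_abs integrable_mult_left)
        (auto intro!: integrable_real_indicator simp: emeasure_lborel_Icc_eq)
    show "AE x in lborel. norm (\<integral>u. norm (f x u) \<partial>unif01) \<le> norm (\<bar>\<integral>u. f x u \<partial>unif01\<bar> + indicator {a..b} x * ?C)"
    proof (rule AE_I2)
      fix x
      have nn: "0 \<le> (\<integral>u. norm (f x u) \<partial>unif01)" "0 \<le> ?C" by (auto intro!: integral_nonneg_AE)
      have "(\<integral>u. norm (f x u) \<partial>unif01) \<le> \<bar>\<integral>u. f x u \<partial>unif01\<bar> + indicator {a..b} x * ?C"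
      proof (cases "x \<in> {a..b}")
        case True
        have "(\<integral>u. norm (f x u) \<partial>unif01) \<le> ?C"
          by (rule integral_mono[OF integrable_norm[OF intE] integrable_abs[OF \<gamma>]])
            (auto simp: f_def indicator_def)
        then show ?thesis using True by simp
      next
        case False
        have "(\<forall>u\<in>{0<..<1}. 0 \<le> f x u) \<or> (\<forall>u\<in>{0<..<1}. f x u \<le> 0)"
          using sgn[of x] False by (auto simp: f_def indicator_def)
        then have "(\<integral>u. norm (f x u) \<partial>unif01) \<le> \<bar>\<integral>u. f x u \<partial>unif01\<bar>"
        proof
          assume "\<forall>u\<in>{0<..<1}. 0 \<le> f x u"
          then have "(\<integral>u. norm (f x u) \<partial>unif01) = (\<integral>u. f x u \<partial>unif01)"
            by (intro Bochner_Integration.integral_cong) auto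
          then show ?thesis by simp
        next
          assume "\<forall>u\<in>{0<..<1}. f x u \<le> 0"
          then have "(\<integral>u. norm (f x u) \<partial>unif01) = (\<integral>u. - f x u \<partial>unif01)"
            by (intro Bochner_Integration.integral_cong) auto
          then show ?thesis by simp
        qed
        then show ?thesis using nn by (simp add: add_increasing2)
      qed
      then show "norm (\<integral>u. norm (f x u) \<partial>unif01) \<le> norm (\<bar>\<integral>u. f x u \<partial>unif01\<bar> + indicator {a..b} x * ?C)"
        using nn by simp
    qed
  qed measurable
  then have pair: "integrable (lborel \<Otimes>\<^sub>M unif01) (\<lambda>(x, u). f x u)"
    by (intro P.Fubini_integrable fm) (auto intro: intE)
  have inner: "(\<integral>x. f x u \<partial>lborel) = \<gamma> u * r u" if "u \<in> {0<..<1}" for u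
  proof -
    have "(\<lambda>x. f x u) = (\<lambda>x. \<gamma> u * indicator {x \<in> D. E x u} x)"
      by (auto simp: f_def indicator_def fun_eq_iff)
    then show ?thesis using r[OF that] by simp
  qed
  have "has_bochner_integral unif01 (\<lambda>u. \<integral>x. f x u \<partial>lborel) (\<integral>x. \<integral>u. f x u \<partial>unif01 \<partial>lborel)"
    using P.integrable_snd[OF pair] P.Fubini_integral[OF pair] by (simp add: has_bochner_integral_iff)
  also have "?this \<longleftrightarrow> has_bochner_integral unif01 (\<lambda>u. \<gamma> u * r u) (\<integral>x. \<integral>u. f x u \<partial>unif01 \<partial>lborel)"
    by (rule has_bochner_integral_cong) (auto simp: inner)
  finally show ?thesis by (simp add: f_def[abs_def] set_lebesgue_integral_def)
qed

context monotone_distortion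
begin

text \<open>Either a monotone weight is non-negative from some point on, or it is negative
  throughout. This feeds the sign condition of \<open>signed_layer_integral\<close> for layers at
  large values.\<close>

lemma weight_sign_upper:
  obtains c where "0 < c" "c < 1" "(\<forall>u. c < u \<and> u < 1 \<longrightarrow> 0 \<le> \<gamma> u) \<or> (\<forall>u. c < u \<and> u < 1 \<longrightarrow> \<gamma> u \<le> 0)"
proof (cases "\<exists>c. 0 < c \<and> c < 1 \<and> 0 \<le> \<gamma> c")
  case True
  then obtain c where c: "0 < c" "c < 1" "0 \<le> \<gamma> c" by blast
  moreover have "0 \<le> \<gamma> u" if "c < u" "u < 1" for u
    using mono_onD[OF mono_weight, of c u] c that by auto
  ultimately show thesis by (intro that) auto
next
  case False
  then show thesis by (intro that[of "1/2"]) (auto simp: not_le intro: less_imp_le)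
qed

text \<open>The same near 0, for layers at very negative values.\<close>

lemma weight_sign_lower:
  obtains c where "0 < c" "c < 1" "(\<forall>u. 0 < u \<and> u < c \<longrightarrow> 0 \<le> \<gamma> u) \<or> (\<forall>u. 0 < u \<and> u < c \<longrightarrow> \<gamma> u \<le> 0)"
proof (cases "\<exists>c. 0 < c \<and> c < 1 \<and> \<gamma> c \<le> 0")
  case True
  then obtain c where c: "0 < c" "c < 1" "\<gamma> c \<le> 0" by blast
  moreover have "\<gamma> u \<le> 0" if "0 < u" "u < c" for u
    using mono_onD[OF mono_weight, of u c] c that by auto
  ultimately show thesis by (intro that) auto
next
  case False
  then show thesis by (intro that[of "1/2"]) (auto simp: not_le intro: less_imp_le)
qed

text \<open>With \<open>p\<close> the probability of \<open>x \<le> Y\<close>, the set of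
  \<open>u\<close> with \<open>x \<le> quantile M Y u\<close> contains the interval from
  \<open>1 - p\<close> to 1 and has the same measure \<open>p\<close>. The two differ by a null set,
  and the integral is a tail integral of the weight.\<close>

lemma distortion_prob_eq_integral:
  assumes "prob_space M" and [measurable]: "Y \<in> borel_measurable M"
  shows "(\<integral>u. of_bool (x \<le> quantile M Y u) * \<gamma> u \<partial>unif01) = h (measure M {w \<in> space M. x \<le> Y w})"
proof -
  interpret prob_space M by fact
  interpret unif01: prob_space unif01 by (rule prob_space_unif01)
  let ?q = "quantile M Y"
  define p where "p = prob {w \<in> space M. x \<le> Y w}"
  have p: "0 \<le> p" "p \<le> 1" by (auto simp: p_def)
  have lt: "prob {w \<in> space M. Y w < x} = 1 - p"
  proof -
    have "{w \<in> space M. Y w < x} = space M - {w \<in> space M. x \<le> Y w}" by auto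
    then show ?thesis unfolding p_def by (simp only: prob_compl) (subst prob_compl, auto)
  qed
  have sub: "x \<le> ?q u" if "u \<in> {0<..<1}" "1 - p < u" for u
  proof (rule ccontr)
    assume "\<not> x \<le> ?q u"
    then have "u \<le> prob {w \<in> space M. Y w \<le> ?q u}" using that by (subst quantile_le_iff[symmetric]) auto
    also have "\<dots> \<le> prob {w \<in> space M. Y w < x}"
      using \<open>\<not> x \<le> ?q u\<close> by (intro finite_measure_mono) auto
    finally show False using lt that by simp
  qed
  let ?A = "{u \<in> space unif01. 1 - p < u}" and ?B = "{u \<in> space unif01. x \<le> ?q u}"
  have A[measurable]: "?A \<in> sets unif01" and B[measurable]: "?B \<in> sets unif01" by measurable
  have "measure unif01 ?B = measure (distr unif01 borel ?q) {x..}"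
    by (subst measure_distr) (auto intro!: arg_cong[where f = unif01.prob])
  also have "\<dots> = p"
    unfolding distr_quantile[OF assms(2)] p_def
    by (subst measure_distr) (auto intro!: arg_cong[where f = prob])
  finally have mB: "measure unif01 ?B = p" .
  have m: "measure unif01 {u \<in> space unif01. u \<le> 1 - p} = 1 - p"
  proof (cases "p = 0")
    case True
    then have "{u \<in> space unif01. u \<le> 1 - p} = space unif01" by auto
    then show ?thesis using True unif01.prob_space by simp
  qed (use measure_unif01_le[of "1 - p"] p in auto)
  have S: "{u \<in> space unif01. u \<le> 1 - p} \<in> sets unif01" by measurable
  have "?A = space unif01 - {u \<in> space unif01. u \<le> 1 - p}" by auto
  then have mA: "measure unif01 ?A = p" using m unif01.prob_compl[OF S] by simp
  have "?A \<subseteq> ?B" using sub by auto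
  then have "measure unif01 (?B - ?A) = 0"
    using mA mB unif01.finite_measure_Diff[OF B A] by simp
  then have "AE u in unif01. u \<notin> ?B - ?A"
    by (rule unif01.prob_eq_0[OF sets.Diff[OF B A], THEN iffD1])
  then have "AE u in unif01. of_bool (x \<le> ?q u) * \<gamma> u = indicator {1 - p<..} u * \<gamma> u"
    using AE_space by eventually_elim (use sub in \<open>auto simp: indicator_def\<close>)
  then have "(\<integral>u. of_bool (x \<le> ?q u) * \<gamma> u \<partial>unif01) = (\<integral>u. indicator {1 - p<..} u * \<gamma> u \<partial>unif01)"
    by (intro integral_cong_AE) measurable
  also have "\<dots> = h p" using weight_tail[of "1 - p"] p by simp
  finally show ?thesis by (simp add: p_def)
qed

text \<open>The two half-line integrals yield the positive and the negative part of the quantile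
  function, weighted by \<open>\<gamma>\<close>. Each half is finite on its own, so the two may be
  subtracted.\<close>

lemma signed_choquet_eq_integral_quantile:
  assumes "prob_space M" and [measurable]: "Y \<in> borel_measurable M"
    and fin: "signed_choquet_finite M h Y"
  shows "has_bochner_integral unif01 (\<lambda>u. \<gamma> u * quantile M Y u) (signed_choquet M h Y)"
proof -
  interpret prob_space M by fact
  interpret unif01: prob_space unif01 by (rule prob_space_unif01)
  let ?q = "quantile M Y"
  note eq = distortion_prob_eq_integral[OF assms(1,2)]
  have mono: "?q u \<le> ?q v" if "u \<in> {0<..<1}" "v \<in> {0<..<1}" "u \<le> v" for u v
    using mono_onD[OF mono_quantile[OF assms(2)]] that by auto
  have eq': "(\<integral>u. of_bool (?q u < x) * \<gamma> u \<partial>unif01) = h 1 - h (measure M {w \<in> space M. x \<le> Y w})" for x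
  proof -
    have "(\<integral>u. of_bool (?q u < x) * \<gamma> u \<partial>unif01) = (\<integral>u. \<gamma> u - of_bool (x \<le> ?q u) * \<gamma> u \<partial>unif01)"
      by (intro Bochner_Integration.integral_cong) auto
    also have "\<dots> = (\<integral>u. \<gamma> u \<partial>unif01) - (\<integral>u. of_bool (x \<le> ?q u) * \<gamma> u \<partial>unif01)"
      by (intro Bochner_Integration.integral_diff integrable_weight
          Bochner_Integration.integrable_bound[OF integrable_weight]) auto
    finally show ?thesis using has_bochner_integral_weight by (simp add: eq has_bochner_integral_integral_eq)
  qed
  have "has_bochner_integral unif01 (\<lambda>u. \<gamma> u * max 0 (?q u)) (LBINT x:{0..}. h (measure M {w \<in> space M. x \<le> Y w}))"
  proof -
    obtain c where c: "0 < c" "c < 1" "(\<forall>u. c < u \<and> u < 1 \<longrightarrow> 0 \<le> \<gamma> u) \<or> (\<forall>u. c < u \<and> u < 1 \<longrightarrow> \<gamma> u \<le> 0)"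
      by (rule weight_sign_upper)
    \<comment> \<open>A level above \<open>?q c\<close> is reached only at \<open>u > c\<close>,
      where the sign of \<open>\<gamma>\<close> is fixed; the exceptional interval is therefore
      \<open>{0..?q c}\<close>.\<close>
    have lt: "c < u" if "x \<le> ?q u" "?q c < x" "u \<in> {0<..<1}" for x u
      using mono[of u c] that c by (cases "c < u") auto
    have "has_bochner_integral unif01 (\<lambda>u. \<gamma> u * max 0 (?q u))
      (LBINT x:{0..}. \<integral>u. of_bool (x \<le> ?q u) * \<gamma> u \<partial>unif01)"
    proof (rule signed_layer_integral[OF integrable_weight, where a = 0 and b = "?q c"])
      show "set_integrable lborel {0..} (\<lambda>x. \<integral>u. of_bool (x \<le> ?q u) * \<gamma> u \<partial>unif01)"
        using fin by (simp add: eq signed_choquet_finite_def)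
      show "measure lborel {x \<in> {0..}. x \<le> ?q u} = max 0 (?q u)" for u
      proof -
        have "{x \<in> {0..}. x \<le> ?q u} = {0..?q u}" by auto
        then show ?thesis by (simp add: max_def)
      qed
      show "(\<forall>u\<in>{0<..<1}. x \<le> ?q u \<longrightarrow> 0 \<le> \<gamma> u) \<or> (\<forall>u\<in>{0<..<1}. x \<le> ?q u \<longrightarrow> \<gamma> u \<le> 0)"
        if "x \<in> {0..}" "x \<notin> {0..?q c}" for x
        using c(3) lt[of x] that by fastforce
    qed measurable
    then show ?thesis by (simp add: eq)
  qed
  moreover have "has_bochner_integral unif01 (\<lambda>u. \<gamma> u * max 0 (- ?q u)) (- (LBINT x:{..0}. h (measure M {w \<in> space M. x \<le> Y w}) - h 1))"
  proof -
    obtain c where c: "0 < c" "c < 1" "(\<forall>u. 0 < u \<and> u < c \<longrightarrow> 0 \<le> \<gamma> u) \<or> (\<forall>u. 0 < u \<and> u < c \<longrightarrow> \<gamma> u \<le> 0)"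
      by (rule weight_sign_lower)
    \<comment> \<open>A level below \<open>?q c\<close> lies above the quantile function only at
      \<open>u < c\<close>, the region of fixed sign near 0.\<close>
    have lt: "u < c" if "?q u < x" "x < ?q c" "u \<in> {0<..<1}" for x u
      using mono[of c u] that c by (cases "u < c") auto
    have "has_bochner_integral unif01 (\<lambda>u. \<gamma> u * max 0 (- ?q u))
      (LBINT x:{..0}. \<integral>u. of_bool (?q u < x) * \<gamma> u \<partial>unif01)"
    proof (rule signed_layer_integral[OF integrable_weight, where a = "?q c" and b = 0])
      have "integrable lborel (\<lambda>x. - (indicator {..0} x *\<^sub>R (h (measure M {w \<in> space M. x \<le> Y w}) - h 1)))"
        using fin unfolding set_integrable_def signed_choquet_finite_def
        by (intro Bochner_Integration.integrable_minus) simp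
      also have "(\<lambda>x. - (indicator {..0} x *\<^sub>R (h (measure M {w \<in> space M. x \<le> Y w}) - h 1)))
          = (\<lambda>x. indicator {..0} x *\<^sub>R (h 1 - h (measure M {w \<in> space M. x \<le> Y w})))"
        by (auto simp: fun_eq_iff algebra_simps)
      finally have "set_integrable lborel {..0} (\<lambda>x. h 1 - h (measure M {w \<in> space M. x \<le> Y w}))"
        by (simp add: set_integrable_def)
      then show "set_integrable lborel {..0} (\<lambda>x. \<integral>u. of_bool (?q u < x) * \<gamma> u \<partial>unif01)"
        by (simp add: eq')
      show "measure lborel {x \<in> {..0}. ?q u < x} = max 0 (- ?q u)" for u
      proof -
        have "{x \<in> {..0}. ?q u < x} = {?q u<..0}" by auto
        then show ?thesis by (simp add: max_def)
      qed
      show "(\<forall>u\<in>{0<..<1}. ?q u < x \<longrightarrow> 0 \<le> \<gamma> u) \<or> (\<forall>u\<in>{0<..<1}. ?q u < x \<longrightarrow> \<gamma> u \<le> 0)"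
        if "x \<in> {..0}" "x \<notin> {?q c..0}" for x
        using c(3) lt[of _ x] that by fastforce
    qed measurable
    also have "(LBINT x:{..0}. \<integral>u. of_bool (?q u < x) * \<gamma> u \<partial>unif01)
        = - (LBINT x:{..0}. h (measure M {w \<in> space M. x \<le> Y w}) - h 1)"
      unfolding eq' set_lebesgue_integral_def by (subst Bochner_Integration.integral_minus[symmetric]) (simp add: algebra_simps)
    finally show ?thesis .
  qed
  ultimately have "has_bochner_integral unif01 (\<lambda>u. \<gamma> u * max 0 (?q u) - \<gamma> u * max 0 (- ?q u)) (signed_choquet M h Y)"
    unfolding signed_choquet_def by (rule has_bochner_integral_diff[THEN has_bochner_integral_cong[THEN iffD1, rotated -1]]) auto
  also have "(\<lambda>u. \<gamma> u * max 0 (?q u) - \<gamma> u * max 0 (- ?q u)) = (\<lambda>u. \<gamma> u * ?q u)"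
    by (auto simp: max_def fun_eq_iff)
  finally show ?thesis .
qed

end

section \<open>Comonotone elements of the ball\<close>

locale comonotone_ball = prob_space M + monotone_distortion h \<gamma>
  for M :: "'w measure" and h \<gamma> :: "real \<Rightarrow> real" +
  fixes \<phi> :: "'n::finite \<Rightarrow> real \<Rightarrow> real" and \<beta> :: "real ^ 'n" and X :: "'w \<Rightarrow> real ^ 'n" and \<epsilon> :: real
  assumes nonatomic: "nonatomic M"
    and generators: "\<And>k. strict_generator (\<phi> k)"
    and \<beta>_nonneg: "\<And>i. 0 \<le> \<beta> $ i"
    and X_measurable [measurable]: "X \<in> borel_measurable M"
    and X_comonotonic: "comonotonic M X"
    and finite_on_ball: "\<And>Z. Z \<in> bregman_ball M (separable \<phi>) \<epsilon> X \<Longrightarrow> signed_choquet_finite M h (\<lambda>w. \<beta> \<bullet> Z w)"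
begin

definition q :: "'n \<Rightarrow> real \<Rightarrow> real" where
  "q i = quantile M (\<lambda>w. X w $ i)"

lemma X_component_measurable [measurable]: "(\<lambda>w. X w $ i) \<in> borel_measurable M"
  by (rule measurable_compose[OF X_measurable borel_measurable_nth])

lemma mono_q: "mono_on {0<..<1} (q i)"
  unfolding q_def by (rule mono_quantile) measurable

lemma q_measurable [measurable]: "q i \<in> borel_measurable unif01"
  by (intro measurable_mono_unif01 mono_q)

lemma bregman_div_measurable [measurable]:
  assumes "f \<in> borel_measurable N" "g \<in> borel_measurable N"
  shows "(\<lambda>w. bregman_div (\<phi> k) (f w) (g w)) \<in> borel_measurable N"
  using strict_generator.borel_measurable_bregman_div[OF generators] assms by blast

lemma ennreal_bregman_div_separable:
  "ennreal (bregman_div (separable \<phi>) z y) = (\<Sum>k\<in>UNIV. ennreal (bregman_div (\<phi> k) (z $ k) (y $ k)))"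
  by (simp add: bregman_div_separable[OF generators] sum_ennreal strict_generator.bregman_div_nonneg[OF generators])

text \<open>A single \<open>U\<close> drives both vectors. They form an admissible coupling whose
  cost splits into one-dimensional quantile divergences, and membership in the ball asks only for an
  upper bound on the infimum.\<close>

lemma mem_ballI:
  assumes U: "uniform01 M U" and p: "\<And>i. mono_on {0<..<1} (p i)"
    and le: "(\<Sum>i\<in>UNIV. bregman_wasserstein_quantile (\<phi> i) (p i) (q i)) \<le> ennreal \<epsilon>"
  shows "(\<lambda>w. \<chi> i. p i (U w)) \<in> bregman_ball M (separable \<phi>) \<epsilon> X"
proof -
  have [measurable]: "U \<in> M \<rightarrow>\<^sub>M unif01" using U by (simp add: uniform01_def)
  have [measurable]: "p i \<in> borel_measurable unif01" for i using p by (rule measurable_mono_unif01)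
  let ?Z = "\<lambda>w. \<chi> i. p i (U w)" and ?X = "\<lambda>w. \<chi> i. q i (U w)"
  have Z: "?Z \<in> borel_measurable M" and X: "?X \<in> borel_measurable M" by measurable
  have "distr M borel ?X = distr unif01 borel (\<lambda>u. \<chi> i. q i u)"
    by (rule distr_uniform01[OF U]) measurable
  also have "\<dots> = distr M borel X"
    using comonotonic_distr[OF X_measurable X_comonotonic] by (simp add: q_def)
  finally have distr: "distr M borel ?X = distr M borel X" .
  have "bregman_wasserstein M (separable \<phi>) (distr M borel ?Z) (distr M borel X)
      \<le> (\<integral>\<^sup>+w. ennreal (bregman_div (separable \<phi>) (?Z w) (?X w)) \<partial>M)"
    unfolding bregman_wasserstein_def
    by (rule INF_lower2[of "(?Z, ?X)"]) (use Z X distr in simp_all)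
  also have "\<dots> = (\<integral>\<^sup>+w. (\<Sum>k\<in>UNIV. ennreal (bregman_div (\<phi> k) (p k (U w)) (q k (U w)))) \<partial>M)"
    by (simp add: ennreal_bregman_div_separable)
  also have "\<dots> = (\<Sum>k\<in>UNIV. \<integral>\<^sup>+w. ennreal (bregman_div (\<phi> k) (p k (U w)) (q k (U w))) \<partial>M)"
    by (rule nn_integral_sum) measurable
  also have "\<dots> = (\<Sum>k\<in>UNIV. bregman_wasserstein_quantile (\<phi> k) (p k) (q k))"
  proof (rule sum.cong[OF refl])
    fix k
    have "(\<integral>\<^sup>+w. ennreal (bregman_div (\<phi> k) (p k (U w)) (q k (U w))) \<partial>M)
        = (\<integral>\<^sup>+u. ennreal (bregman_div (\<phi> k) (p k u) (q k u)) \<partial>unif01)"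
      by (rule uniform01_nn_integral[OF U, where f = "\<lambda>u. ennreal (bregman_div (\<phi> k) (p k u) (q k u))"]) measurable
    then show "(\<integral>\<^sup>+w. ennreal (bregman_div (\<phi> k) (p k (U w)) (q k (U w))) \<partial>M)
        = bregman_wasserstein_quantile (\<phi> k) (p k) (q k)"
      by (simp add: bregman_wasserstein_quantile_def nn_integral_unif01)
  qed
  finally show ?thesis
    using Z le by (simp add: bregman_ball_def)
qed

text \<open>Non-negative coefficients keep the combination of the \<open>p i\<close> monotone, so it
  is almost everywhere its own quantile function and the Choquet integral becomes additive.
  Finiteness on the ball yields integrability of the combined integrand only;
  \<open>integrable_summand_of_comonotone_sum\<close> passes it on to the summands.\<close>

lemma signed_choquet_comonotone:
  assumes U: "uniform01 M U" and p: "\<And>i. mono_on {0<..<1} (p i)"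
    and le: "(\<Sum>i\<in>UNIV. bregman_wasserstein_quantile (\<phi> i) (p i) (q i)) \<le> ennreal \<epsilon>"
  shows "integrable unif01 (\<lambda>u. \<beta> $ i * (\<gamma> u * p i u))"
    and "signed_choquet M h (\<lambda>w. \<beta> \<bullet> (\<chi> i. p i (U w))) = (\<Sum>i\<in>UNIV. \<beta> $ i * (\<integral>u. \<gamma> u * p i u \<partial>unif01))"
proof -
  have [measurable]: "U \<in> M \<rightarrow>\<^sub>M unif01" using U by (simp add: uniform01_def)
  have [measurable]: "p i \<in> borel_measurable unif01" for i using p by (rule measurable_mono_unif01)
  define P where "P u = (\<Sum>i\<in>UNIV. \<beta> $ i * p i u)" for u
  have dot: "\<beta> \<bullet> (\<chi> i. p i (U w)) = P (U w)" for w
    by (simp add: P_def inner_vec_def)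
  have "mono_on {0<..<1} P"
    unfolding P_def by (intro mono_onI sum_mono mult_left_mono \<beta>_nonneg) (auto intro: mono_onD[OF p])
  then have AE: "AE u in unif01. quantile M (\<lambda>w. P (U w)) u = P u"
    by (intro quantile_mono_uniform01 U) unfold_locales
  have [measurable]: "P \<in> borel_measurable unif01" unfolding P_def by measurable
  have [measurable]: "(\<lambda>w. P (U w)) \<in> borel_measurable M" by measurable
  have fin: "signed_choquet_finite M h (\<lambda>w. P (U w))"
    using finite_on_ball[OF mem_ballI[OF assms]] by (simp add: dot)
  have "has_bochner_integral unif01 (\<lambda>u. \<gamma> u * quantile M (\<lambda>w. P (U w)) u) (signed_choquet M h (\<lambda>w. P (U w)))"
    by (rule signed_choquet_eq_integral_quantile[OF _ _ fin]) (unfold_locales, measurable)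
  also have "?this \<longleftrightarrow> has_bochner_integral unif01 (\<lambda>u. \<gamma> u * P u) (signed_choquet M h (\<lambda>w. P (U w)))"
    using AE by (intro has_bochner_integral_cong_AE) auto
  finally have hb: "has_bochner_integral unif01 (\<lambda>u. \<gamma> u * P u) (signed_choquet M h (\<lambda>w. P (U w)))" .
  show int: "integrable unif01 (\<lambda>u. \<beta> $ i * (\<gamma> u * p i u))" for i
    using hb \<beta>_nonneg p
    by (intro integrable_summand_of_comonotone_sum[OF integrable_weight, of UNIV]) (auto simp: P_def has_bochner_integral_iff)
  have "signed_choquet M h (\<lambda>w. P (U w)) = (\<integral>u. \<gamma> u * P u \<partial>unif01)"
    using hb by (simp add: has_bochner_integral_iff)
  also have "\<dots> = (\<integral>u. (\<Sum>i\<in>UNIV. \<beta> $ i * (\<gamma> u * p i u)) \<partial>unif01)"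
    by (simp add: P_def sum_distrib_left algebra_simps)
  also have "\<dots> = (\<Sum>i\<in>UNIV. \<beta> $ i * (\<integral>u. \<gamma> u * p i u \<partial>unif01))"
    by (subst Bochner_Integration.integral_sum) (use int in auto)
  finally show "signed_choquet M h (\<lambda>w. \<beta> \<bullet> (\<chi> i. p i (U w))) = (\<Sum>i\<in>UNIV. \<beta> $ i * (\<integral>u. \<gamma> u * p i u \<partial>unif01))"
    by (simp add: dot)
qed

lemma lagrangian_generator: "0 < l \<Longrightarrow> lagrangian (\<phi> i) l"
  using generators by (simp add: lagrangian_def lagrangian_axioms_def)

lemma G_inv_eq: "0 < l \<Longrightarrow> G_inv (\<phi> i) \<gamma> (q i) l u = lagrangian.G (\<phi> i) l (\<gamma> u) (q i u)"
  using lagrangian.G_def[OF lagrangian_generator] by (simp add: G_inv_def)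

lemma mono_G_inv: "0 < l \<Longrightarrow> mono_on {0<..<1} (G_inv (\<phi> i) \<gamma> (q i) l)"
  by (intro mono_onI) (auto simp: G_inv_eq intro!: lagrangian.G_mono[OF lagrangian_generator]
      mono_onD[OF mono_weight] mono_onD[OF mono_q])

text \<open>The Choquet integral of the perturbed vector sees component \<open>i\<close> only
  through the factor \<open>\<beta> $ i\<close>, which can be cancelled when it is positive. The
  other components stay at \<open>q j\<close> and cost nothing.\<close>

lemma integrable_G_inv:
  assumes l: "0 < l" and i: "0 < \<beta> $ i"
    and le: "bregman_wasserstein_quantile (\<phi> i) (G_inv (\<phi> i) \<gamma> (q i) l) (q i) \<le> ennreal \<epsilon>"
  shows "integrable unif01 (\<lambda>u. \<gamma> u * G_inv (\<phi> i) \<gamma> (q i) l u)"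
proof -
  obtain U where U: "uniform01 M U" using nonatomic_imp_uniform01[OF nonatomic] by blast
  define p where "p j = (if j = i then G_inv (\<phi> i) \<gamma> (q i) l else q j)" for j
  have "integrable unif01 (\<lambda>u. \<beta> $ i * (\<gamma> u * p i u))"
  proof (rule signed_choquet_comonotone(1)[OF U])
    show "mono_on {0<..<1} (p j)" for j
      using mono_G_inv[OF l] mono_q by (simp add: p_def)
    have "(\<Sum>j\<in>UNIV. bregman_wasserstein_quantile (\<phi> j) (p j) (q j))
        = (\<Sum>j\<in>UNIV. if j = i then bregman_wasserstein_quantile (\<phi> i) (G_inv (\<phi> i) \<gamma> (q i) l) (q i) else 0)"
      by (intro sum.cong refl) (simp add: p_def bregman_wasserstein_quantile_def
          strict_generator.bregman_div_self[OF generators])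
    then show "(\<Sum>j\<in>UNIV. bregman_wasserstein_quantile (\<phi> j) (p j) (q j)) \<le> ennreal \<epsilon>"
      using le by simp
  qed
  then show ?thesis using i by (simp add: p_def)
qed

end

section \<open>The distributional transform\<close>

lemma measure_unif01_greater:
  assumes "0 \<le> u" "u \<le> 1"
  shows "measure unif01 {v \<in> space unif01. u < v} = 1 - u"
proof -
  interpret unif01: prob_space unif01 by (rule prob_space_unif01)
  have S: "{v \<in> space unif01. v \<le> u} \<in> sets unif01" by measurable
  have "{v \<in> space unif01. u < v} = space unif01 - {v \<in> space unif01. v \<le> u}" by auto
  then show ?thesis using unif01.prob_compl[OF S] measure_unif01_le[OF assms] by simp
qed

text \<open>The distributional transform: on an atom \<open>S = c\<close>, the jump of the distribution function of \<open>S\<close> is spread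
  out by an independent uniform variable.\<close>

lemma (in prob_space) distributional_transform:
  assumes S[measurable]: "S \<in> borel_measurable M"
  shows "\<exists>U. uniform01 (M \<Otimes>\<^sub>M unif01) U \<and> (AE z in M \<Otimes>\<^sub>M unif01. quantile M S (U z) = S (fst z))"
proof -
  interpret unif01: prob_space unif01 by (rule prob_space_unif01)
  interpret N: pair_prob_space M unif01 ..
  let ?N = "M \<Otimes>\<^sub>M unif01"
  define F where "F x = prob {w \<in> space M. S w \<le> x}" for x
  define Fm where "Fm x = prob {w \<in> space M. S w < x}" for x
  have monoF: "F x \<le> F y" and monoFm: "Fm x \<le> Fm y" if "x \<le> y" for x y
    unfolding F_def Fm_def using that by (auto intro!: finite_measure_mono)
  have FFm: "F x \<le> Fm y" if "x < y" for x y
    unfolding F_def Fm_def using that by (auto intro!: finite_measure_mono)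
  have FmF: "Fm x \<le> F x" for x
    unfolding F_def Fm_def by (auto intro!: finite_measure_mono)
  have bnd: "0 \<le> Fm x" "F x \<le> 1" for x by (auto simp: F_def Fm_def)
  have [measurable]: "F \<in> borel_measurable borel" "Fm \<in> borel_measurable borel"
    using monoF monoFm by (auto intro!: borel_measurable_mono monoI)
  define U0 where "U0 z = Fm (S (fst z)) + snd z * (F (S (fst z)) - Fm (S (fst z)))" for z :: "'a \<times> real"
  have U0[measurable]: "U0 \<in> borel_measurable ?N" unfolding U0_def by measurable
  have U0_le: "U0 z \<le> F (S (fst z))" and U0_ge: "Fm (S (fst z)) \<le> U0 z" if "z \<in> space ?N" for z
  proof -
    have "snd z \<in> {0<..<1}" using that by (auto simp: space_pair_measure)
    then show "U0 z \<le> F (S (fst z))" "Fm (S (fst z)) \<le> U0 z"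
      using FmF[of "S (fst z)"] mult_right_mono[of "snd z" 1 "F (S (fst z)) - Fm (S (fst z))"]
      by (auto simp: U0_def)
  qed
  have prod: "N.prob (A \<times> B) = prob A * measure unif01 B" if "A \<in> sets M" "B \<in> sets unif01" for A B
    using that by (simp add: measure_def unif01.emeasure_pair_measure_Times enn2real_mult)
  \<comment> \<open>Two closed one-sided estimates, each obtained by fitting two disjoint rectangles
    into the event; together they pin down the distribution function of \<open>U0\<close>.\<close>
  have key: "t \<le> N.prob {z \<in> space ?N. U0 z \<le> t}" "1 - t \<le> N.prob {z \<in> space ?N. t \<le> U0 z}"
    if t: "0 < t" "t < 1" for t
  proof -
    define c where "c = quantile M S t"
    have c: "t \<le> F c" using quantile_le_iff[OF S t, of c] by (simp add: c_def F_def)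
    have cm: "Fm c \<le> t"
    proof -
      interpret D: real_distribution "distr M borel S" by (rule real_distribution_distr) measurable
      have "(F \<longlongrightarrow> measure (distr M borel S) {..<c}) (at_left c)"
      proof -
        have "cdf (distr M borel S) = F" by (simp add: fun_eq_iff cdf_distr[OF S] F_def)
        then show ?thesis using D.cdf_at_left[of c] by simp
      qed
      moreover have "measure (distr M borel S) {..<c} = Fm c"
        unfolding Fm_def by (subst measure_distr) (auto intro!: arg_cong[where f = prob])
      moreover have "\<forall>\<^sub>F x in at_left c. F x \<le> t"
      proof -
        have "F x \<le> t" if "x < c" for x
          using quantile_le_iff[OF S t, of x] that by (auto simp: c_def F_def)
        then show ?thesis by (auto simp: eventually_at_filter)
      qed
      ultimately show ?thesis by (intro tendsto_upperbound[of F "Fm c" "at_left c"]) auto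
    qed
    \<comment> \<open>\<open>r\<close> is the fraction of the jump at \<open>c\<close> that lies
      below \<open>t\<close>. Without a jump the quotient is 0 by convention, and
      \<open>t = Fm c\<close>, so the product identity for \<open>r\<close> still holds.\<close>
    define r where "r = (t - Fm c) / (F c - Fm c)"
    have r: "0 \<le> r" "r \<le> 1" "(F c - Fm c) * r = t - Fm c"
      using c cm FmF[of c] by (auto simp: r_def divide_le_eq_1)
    let ?lt = "{w \<in> space M. S w < c}" and ?eq = "{w \<in> space M. S w = c}" and ?gt = "{w \<in> space M. c < S w}"
    have eq: "prob ?eq = F c - Fm c"
    proof -
      have "{w \<in> space M. S w \<le> c} - ?lt = ?eq" by auto
      moreover have "prob ({w \<in> space M. S w \<le> c} - ?lt) = F c - Fm c"
        unfolding F_def Fm_def by (rule finite_measure_Diff) auto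
      ultimately show ?thesis by simp
    qed
    have gt: "prob ?gt = 1 - F c"
    proof -
      have m: "{w \<in> space M. S w \<le> c} \<in> events" by measurable
      have "space M - {w \<in> space M. S w \<le> c} = ?gt" by auto
      with prob_compl[OF m] show ?thesis by (simp add: F_def)
    qed
    have [measurable]: "?lt \<in> events" "?eq \<in> events" "?gt \<in> events" by measurable
    have [measurable]: "{v \<in> space unif01. v \<le> r} \<in> sets unif01" "{v \<in> space unif01. r < v} \<in> sets unif01"
      by measurable
    have "t = prob ?lt * measure unif01 (space unif01) + prob ?eq * measure unif01 {v \<in> space unif01. v \<le> r}"
      using r eq by (simp only: measure_unif01_le[OF r(1,2)] unif01.prob_space) (simp add: Fm_def)
    also have "\<dots> = N.prob (?lt \<times> space unif01) + N.prob (?eq \<times> {v \<in> space unif01. v \<le> r})"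
      by (simp only: prod \<open>?lt \<in> events\<close> \<open>?eq \<in> events\<close> sets.top \<open>{v \<in> space unif01. v \<le> r} \<in> sets unif01\<close>)
    also have "\<dots> = N.prob (?lt \<times> space unif01 \<union> ?eq \<times> {v \<in> space unif01. v \<le> r})"
      by (rule N.finite_measure_Union[symmetric]) (auto simp del: space_unif01 intro!: pair_measureI)
    also have "\<dots> \<le> N.prob {z \<in> space ?N. U0 z \<le> t}"
    proof (rule N.finite_measure_mono)
      show "{z \<in> space ?N. U0 z \<le> t} \<in> N.events" by measurable
      show "?lt \<times> space unif01 \<union> ?eq \<times> {v \<in> space unif01. v \<le> r} \<subseteq> {z \<in> space ?N. U0 z \<le> t}"
      proof (rule subsetI)
        fix z assume z: "z \<in> ?lt \<times> space unif01 \<union> ?eq \<times> {v \<in> space unif01. v \<le> r}"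
        then have zN: "z \<in> space ?N" by (auto simp: space_pair_measure)
        have "U0 z \<le> t"
        proof (cases "S (fst z) < c")
          case True
          then show ?thesis using U0_le[OF zN] FFm[of "S (fst z)" c] cm by linarith
        next
          case False
          then have "S (fst z) = c" "snd z \<le> r" using z by auto
          then have "U0 z \<le> Fm c + r * (F c - Fm c)"
            using FmF[of c] by (auto simp: U0_def intro!: mult_right_mono)
          then show ?thesis using r(3) by (simp add: mult.commute)
        qed
        with zN show "z \<in> {z \<in> space ?N. U0 z \<le> t}" by simp
      qed
    qed
    finally show "t \<le> N.prob {z \<in> space ?N. U0 z \<le> t}" .
    have "1 - t = prob ?gt * measure unif01 (space unif01) + prob ?eq * measure unif01 {v \<in> space unif01. r < v}"
      using r eq gt by (simp only: measure_unif01_greater[OF r(1,2)] unif01.prob_space) (simp add: right_diff_distrib)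
    also have "\<dots> = N.prob (?gt \<times> space unif01) + N.prob (?eq \<times> {v \<in> space unif01. r < v})"
      by (simp only: prod \<open>?gt \<in> events\<close> \<open>?eq \<in> events\<close> sets.top \<open>{v \<in> space unif01. r < v} \<in> sets unif01\<close>)
    also have "\<dots> = N.prob (?gt \<times> space unif01 \<union> ?eq \<times> {v \<in> space unif01. r < v})"
      by (rule N.finite_measure_Union[symmetric]) (auto simp del: space_unif01 intro!: pair_measureI)
    also have "\<dots> \<le> N.prob {z \<in> space ?N. t \<le> U0 z}"
    proof (rule N.finite_measure_mono)
      show "{z \<in> space ?N. t \<le> U0 z} \<in> N.events" by measurable
      show "?gt \<times> space unif01 \<union> ?eq \<times> {v \<in> space unif01. r < v} \<subseteq> {z \<in> space ?N. t \<le> U0 z}"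
      proof (rule subsetI)
        fix z assume z: "z \<in> ?gt \<times> space unif01 \<union> ?eq \<times> {v \<in> space unif01. r < v}"
        then have zN: "z \<in> space ?N" by (auto simp: space_pair_measure)
        have "t \<le> U0 z"
        proof (cases "c < S (fst z)")
          case True
          then show ?thesis using U0_ge[OF zN] FFm[of c "S (fst z)"] c by linarith
        next
          case False
          then have "S (fst z) = c" "r \<le> snd z" using z by auto
          then have "Fm c + r * (F c - Fm c) \<le> U0 z"
            using FmF[of c] by (auto simp: U0_def intro!: mult_right_mono)
          then show ?thesis using r(3) by (simp add: mult.commute)
        qed
        with zN show "z \<in> {z \<in> space ?N. t \<le> U0 z}" by simp
      qed
    qed
    finally show "1 - t \<le> N.prob {z \<in> space ?N. t \<le> U0 z}" .
  qed
  have "N.prob {z \<in> space ?N. U0 z \<le> t} = t" if t: "0 < t" "t < 1" for t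
  proof (rule antisym)
    \<comment> \<open>The second estimate controls the complement of \<open>s \<le> U0 z\<close>,
      which contains the event as soon as \<open>s > t\<close>; then \<open>s\<close> is lowered to
      \<open>t\<close>.\<close>
    have "N.prob {z \<in> space ?N. U0 z \<le> t} \<le> s" if s: "t < s" "s < 1" for s
    proof -
      have m: "{z \<in> space ?N. s \<le> U0 z} \<in> N.events" by measurable
      have "{z \<in> space ?N. U0 z \<le> t} \<subseteq> space ?N - {z \<in> space ?N. s \<le> U0 z}" using s by auto
      then have "N.prob {z \<in> space ?N. U0 z \<le> t} \<le> N.prob (space ?N - {z \<in> space ?N. s \<le> U0 z})"
        by (rule N.finite_measure_mono) (use m in auto)
      also have "\<dots> \<le> s" using N.prob_compl[OF m] key(2)[of s] s t by simp
      finally show ?thesis .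
    qed
    then show "N.prob {z \<in> space ?N. U0 z \<le> t} \<le> t" by (intro dense_ge_bounded[OF t(2)]) auto
  qed (rule key(1)[OF t])
  from N.uniform01_of_cdf[OF U0 this] obtain U where U: "uniform01 ?N U" "AE z in ?N. U z = U0 z" by blast
  have [measurable]: "U \<in> ?N \<rightarrow>\<^sub>M unif01" using U by (simp add: uniform01_def)
  \<comment> \<open>\<open>U0 z \<le> F (S (fst z))\<close> puts the quantile below
    \<open>S\<close>; the two sides have equal laws, which forces equality almost surely.\<close>
  have "AE z in ?N. quantile M S (U z) = S (fst z)"
  proof (rule N.AE_eq_of_le_of_distr_eq)
    show "AE z in ?N. quantile M S (U z) \<le> S (fst z)"
      using U(2) AE_space
    proof eventually_elim
      case (elim z)
      then show ?case
        using U0_le[of z] uniform01_range[OF U(1), of z] quantile_le_iff[OF S, of "U z" "S (fst z)"]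
        by (simp add: F_def)
    qed
    have "distr ?N borel (\<lambda>z. quantile M S (U z)) = distr M borel S"
      by (subst distr_uniform01[OF U(1)]) (auto simp: distr_quantile)
    also have "\<dots> = distr (distr ?N M fst) borel S"
      by (simp only: unif01.distr_pair_fst)
    also have "\<dots> = distr ?N borel (\<lambda>z. S (fst z))"
      by (subst distr_distr) (auto simp: comp_def)
    finally show "distr ?N borel (\<lambda>z. quantile M S (U z)) = distr ?N borel (\<lambda>z. S (fst z))" .
  qed measurable
  with U(1) show ?thesis by blast
qed

section \<open>Rearrangement\<close>

context prob_space
begin

lemma nn_integral_quantile:
  assumes Y: "Y \<in> borel_measurable M" and f: "f \<in> borel_measurable borel"
  shows "(\<integral>\<^sup>+w. f (Y w) \<partial>M) = (\<integral>\<^sup>+u. f (quantile M Y u) \<partial>unif01)"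
proof -
  have "(\<integral>\<^sup>+w. f (Y w) \<partial>M) = (\<integral>\<^sup>+x. f x \<partial>distr M borel Y)" by (subst nn_integral_distr) (use Y f in simp_all)
  also have "\<dots> = (\<integral>\<^sup>+x. f x \<partial>distr unif01 borel (quantile M Y))" by (simp only: distr_quantile[OF Y])
  also have "\<dots> = (\<integral>\<^sup>+u. f (quantile M Y u) \<partial>unif01)"
    by (subst nn_integral_distr) (use measurable_quantile[OF Y] f in simp_all)
  finally show ?thesis .
qed

text \<open>Threshold argument. With \<open>c\<close> the infimum of \<open>k\<close> along the
  quantile function on \<open>A\<close>, the integrand is at most \<open>c\<close> on
  \<open>A\<close> plus the truncated excess over \<open>c\<close>. The expectation of this majorant
  depends only on the separate laws of \<open>U\<close> and \<open>Y\<close>. The comonotone pair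
  attains it, since there \<open>k\<close> is at least \<open>c\<close> on \<open>A\<close> and at
  most \<open>c\<close> off it.\<close>

lemma concordant_rearrangement:
  assumes U: "uniform01 M U" and Y[measurable]: "Y \<in> borel_measurable M"
    and A[measurable]: "Measurable.pred unif01 A" and k[measurable]: "k \<in> borel_measurable borel"
    and concordant: "\<And>u v. u \<in> {0<..<1} \<Longrightarrow> v \<in> {0<..<1} \<Longrightarrow> A u \<Longrightarrow> \<not> A v \<Longrightarrow>
      (k (quantile M Y v) :: real) \<le> k (quantile M Y u)"
  shows "(\<integral>\<^sup>+w. of_bool (A (U w)) * ennreal (k (Y w)) \<partial>M)
    \<le> (\<integral>\<^sup>+u. of_bool (A u) * ennreal (k (quantile M Y u)) \<partial>unif01)"
proof -
  have [measurable]: "U \<in> M \<rightarrow>\<^sub>M unif01" using U by (simp add: uniform01_def)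
  define c where "c = (INF u\<in>{u \<in> {0<..<1}. A u}. ennreal (k (quantile M Y u)))"
  have cl: "c \<le> ennreal (k (quantile M Y u))" if "u \<in> {0<..<1}" "A u" for u
    unfolding c_def using that by (intro INF_lower) auto
  have cg: "ennreal (k (quantile M Y v)) \<le> c" if "v \<in> {0<..<1}" "\<not> A v" for v
    unfolding c_def using that concordant by (intro INF_greatest ennreal_leI) auto
  have "(\<integral>\<^sup>+w. of_bool (A (U w)) * ennreal (k (Y w)) \<partial>M)
      \<le> (\<integral>\<^sup>+w. of_bool (A (U w)) * c + (ennreal (k (Y w)) - c) \<partial>M)"
  proof (rule nn_integral_mono)
    fix w
    have "ennreal (k (Y w)) \<le> c + (ennreal (k (Y w)) - c)"
      by (cases "c \<le> ennreal (k (Y w))") (simp_all add: add_diff_inverse_ennreal add_increasing2 not_le less_imp_le)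
    then show "of_bool (A (U w)) * ennreal (k (Y w)) \<le> of_bool (A (U w)) * c + (ennreal (k (Y w)) - c)" by simp
  qed
  also have "\<dots> = (\<integral>\<^sup>+w. of_bool (A (U w)) * c \<partial>M) + (\<integral>\<^sup>+w. ennreal (k (Y w)) - c \<partial>M)"
    by (rule nn_integral_add) measurable
  also have "(\<integral>\<^sup>+w. of_bool (A (U w)) * c \<partial>M) = (\<integral>\<^sup>+u. of_bool (A u) * c \<partial>unif01)"
    by (rule uniform01_nn_integral[OF U]) measurable
  also have "(\<integral>\<^sup>+w. ennreal (k (Y w)) - c \<partial>M) = (\<integral>\<^sup>+u. ennreal (k (quantile M Y u)) - c \<partial>unif01)"
    by (rule nn_integral_quantile[OF Y, of "\<lambda>y. ennreal (k y) - c"]) measurable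
  also have "(\<integral>\<^sup>+u. of_bool (A u) * c \<partial>unif01) + (\<integral>\<^sup>+u. ennreal (k (quantile M Y u)) - c \<partial>unif01)
      = (\<integral>\<^sup>+u. of_bool (A u) * c + (ennreal (k (quantile M Y u)) - c) \<partial>unif01)"
    by (rule nn_integral_add[symmetric]) measurable
  also have "\<dots> = (\<integral>\<^sup>+u. of_bool (A u) * ennreal (k (quantile M Y u)) \<partial>unif01)"
    using cl cg by (intro nn_integral_cong) (auto simp: add_diff_inverse_ennreal diff_eq_0_iff_ennreal)
  finally show ?thesis .
qed

text \<open>The dual threshold inequality bounds \<open>c\<close> on \<open>A\<close> by the deficit
  below \<open>c\<close> plus the integrand, with \<open>c\<close> the infimum off \<open>A\<close>.
  Cancelling the expected deficit requires \<open>c\<close> to be finite; if \<open>A\<close> is the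
  whole interval, the infimum over the empty set is infinite, and both sides are compared
  directly.\<close>

lemma discordant_rearrangement:
  assumes U: "uniform01 M U" and Y[measurable]: "Y \<in> borel_measurable M"
    and A[measurable]: "Measurable.pred unif01 A" and k[measurable]: "k \<in> borel_measurable borel"
    and discordant: "\<And>u v. u \<in> {0<..<1} \<Longrightarrow> v \<in> {0<..<1} \<Longrightarrow> A u \<Longrightarrow> \<not> A v \<Longrightarrow>
      (k (quantile M Y u) :: real) \<le> k (quantile M Y v)"
  shows "(\<integral>\<^sup>+u. of_bool (A u) * ennreal (k (quantile M Y u)) \<partial>unif01)
    \<le> (\<integral>\<^sup>+w. of_bool (A (U w)) * ennreal (k (Y w)) \<partial>M)"
proof (cases "\<forall>u\<in>{0<..<1}. A u")
  case True
  have "(\<integral>\<^sup>+u. of_bool (A u) * ennreal (k (quantile M Y u)) \<partial>unif01)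
      = (\<integral>\<^sup>+u. ennreal (k (quantile M Y u)) \<partial>unif01)"
    using True by (intro nn_integral_cong) auto
  also have "\<dots> = (\<integral>\<^sup>+w. ennreal (k (Y w)) \<partial>M)"
    by (rule nn_integral_quantile[OF Y, of "\<lambda>y. ennreal (k y)", symmetric]) measurable
  also have "\<dots> = (\<integral>\<^sup>+w. of_bool (A (U w)) * ennreal (k (Y w)) \<partial>M)"
    using True uniform01_range[OF U] by (intro nn_integral_cong) auto
  finally show ?thesis by simp
next
  case False
  interpret unif01: prob_space unif01 by (rule prob_space_unif01)
  have [measurable]: "U \<in> M \<rightarrow>\<^sub>M unif01" using U by (simp add: uniform01_def)
  define c where "c = (INF u\<in>{u \<in> {0<..<1}. \<not> A u}. ennreal (k (quantile M Y u)))"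
  have cl: "c \<le> ennreal (k (quantile M Y u))" if "u \<in> {0<..<1}" "\<not> A u" for u
    unfolding c_def using that by (intro INF_lower) auto
  have cg: "ennreal (k (quantile M Y u)) \<le> c" if "u \<in> {0<..<1}" "A u" for u
    unfolding c_def using that discordant by (intro INF_greatest ennreal_leI) auto
  obtain v where "v \<in> {0<..<1}" "\<not> A v" using False by blast
  from cl[OF this] have c: "c < \<infinity>" using le_less_trans[of c _ \<infinity>] by auto
  let ?K = "\<integral>\<^sup>+u. c - ennreal (k (quantile M Y u)) \<partial>unif01"
  have "?K \<le> (\<integral>\<^sup>+u. c \<partial>unif01)" by (intro nn_integral_mono) (simp add: diff_le_self_ennreal)
  also have "\<dots> = c" using unif01.emeasure_space_1 by simp
  finally have K: "?K \<noteq> \<infinity>" using c by auto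
  have "?K + (\<integral>\<^sup>+u. of_bool (A u) * ennreal (k (quantile M Y u)) \<partial>unif01)
      = (\<integral>\<^sup>+u. (c - ennreal (k (quantile M Y u))) + of_bool (A u) * ennreal (k (quantile M Y u)) \<partial>unif01)"
    by (rule nn_integral_add[symmetric]) measurable
  also have "\<dots> = (\<integral>\<^sup>+u. of_bool (A u) * c \<partial>unif01)"
    using cl cg c by (intro nn_integral_cong)
      (auto simp: add_diff_inverse_ennreal diff_eq_0_iff_ennreal add.commute)
  also have "\<dots> = (\<integral>\<^sup>+w. of_bool (A (U w)) * c \<partial>M)"
    by (rule uniform01_nn_integral[OF U, symmetric]) measurable
  also have "\<dots> \<le> (\<integral>\<^sup>+w. (c - ennreal (k (Y w))) + of_bool (A (U w)) * ennreal (k (Y w)) \<partial>M)"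
  proof (rule nn_integral_mono)
    fix w
    have "c \<le> ennreal (k (Y w)) + (c - ennreal (k (Y w)))"
      by (cases "ennreal (k (Y w)) \<le> c") (simp_all add: add_diff_inverse_ennreal add_increasing2 not_le less_imp_le)
    then show "of_bool (A (U w)) * c \<le> (c - ennreal (k (Y w))) + of_bool (A (U w)) * ennreal (k (Y w))"
      by (simp add: add.commute)
  qed
  also have "\<dots> = (\<integral>\<^sup>+w. c - ennreal (k (Y w)) \<partial>M) + (\<integral>\<^sup>+w. of_bool (A (U w)) * ennreal (k (Y w)) \<partial>M)"
    by (rule nn_integral_add) measurable
  also have "(\<integral>\<^sup>+w. c - ennreal (k (Y w)) \<partial>M) = ?K"
    by (rule nn_integral_quantile[OF Y, of "\<lambda>y. c - ennreal (k y)"]) measurable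
  finally show ?thesis using K by (simp add: ennreal_add_left_cancel_le)
qed

end

text \<open>Tonelli reduces a comparison of integrated layers to one at each single level
  \<open>s\<close>.\<close>

lemma nn_integral_mono_layers:
  fixes f :: "real \<Rightarrow> 'a \<Rightarrow> ennreal" and g :: "real \<Rightarrow> 'b \<Rightarrow> ennreal"
  assumes "sigma_finite_measure N" "sigma_finite_measure K"
    and f: "(\<lambda>(s, w). f s w) \<in> borel_measurable (lborel \<Otimes>\<^sub>M N)"
    and g: "(\<lambda>(s, u). g s u) \<in> borel_measurable (lborel \<Otimes>\<^sub>M K)"
    and le: "\<And>s. (\<integral>\<^sup>+w. f s w \<partial>N) \<le> (\<integral>\<^sup>+u. g s u \<partial>K)"
  shows "(\<integral>\<^sup>+w. \<integral>\<^sup>+s. f s w \<partial>lborel \<partial>N) \<le> (\<integral>\<^sup>+u. \<integral>\<^sup>+s. g s u \<partial>lborel \<partial>K)"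
proof -
  interpret N: pair_sigma_finite lborel N using assms(1) by (simp add: pair_sigma_finite_def lborel.sigma_finite_measure_axioms)
  interpret K: pair_sigma_finite lborel K using assms(2) by (simp add: pair_sigma_finite_def lborel.sigma_finite_measure_axioms)
  show ?thesis
    unfolding N.Fubini'[OF f] K.Fubini'[OF g] by (rule nn_integral_mono[OF le])
qed

section \<open>Layers of the Lagrangian value and their rearrangement\<close>

context lagrangian
begin

lemma G_measurable [measurable]:
  assumes [measurable]: "f \<in> borel_measurable N" "g \<in> borel_measurable N"
  shows "(\<lambda>w. G (f w) (g w)) \<in> borel_measurable N"
  unfolding G_def by measurable

lemma Psi_measurable [measurable]:
  assumes [measurable]: "f \<in> borel_measurable N" "g \<in> borel_measurable N"
  shows "(\<lambda>w. Psi (f w) (g w)) \<in> borel_measurable N"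
  unfolding Psi_def by measurable

text \<open>The four parts of \<open>Psi g x\<close>, the integral of \<open>G s x\<close> over \<open>s\<close> from \<open>0\<close> to \<open>g\<close>, according to the sign of
  \<open>s\<close> and of \<open>G s x\<close>. The positive contributions \<open>Pp\<close>, \<open>Nn\<close> are largest, and the negative ones \<open>Pn\<close>, \<open>Np\<close>
  smallest, for comonotone arguments.\<close>

definition Pp where "Pp g x = (\<integral>\<^sup>+s. of_bool (0 \<le> s \<and> s \<le> g) * ennreal (G s x) \<partial>lborel)"
definition Pn where "Pn g x = (\<integral>\<^sup>+s. of_bool (0 \<le> s \<and> s \<le> g) * ennreal (- G s x) \<partial>lborel)"
definition Np where "Np g x = (\<integral>\<^sup>+s. of_bool (g \<le> s \<and> s \<le> 0) * ennreal (G s x) \<partial>lborel)"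
definition Nn where "Nn g x = (\<integral>\<^sup>+s. of_bool (g \<le> s \<and> s \<le> 0) * ennreal (- G s x) \<partial>lborel)"

lemma parts_measurable [measurable]:
  assumes [measurable]: "f \<in> borel_measurable N" "g \<in> borel_measurable N"
  shows "(\<lambda>w. Pp (f w) (g w)) \<in> borel_measurable N" "(\<lambda>w. Pn (f w) (g w)) \<in> borel_measurable N"
    "(\<lambda>w. Np (f w) (g w)) \<in> borel_measurable N" "(\<lambda>w. Nn (f w) (g w)) \<in> borel_measurable N"
  unfolding Pp_def Pn_def Np_def Nn_def by measurable

lemma has_bochner_integral_G:
  assumes "a \<le> b"
  shows "has_bochner_integral lborel (\<lambda>s. of_bool (a \<le> s \<and> s \<le> b) * G s x) (Psi b x - Psi a x)"
proof -
  have "has_bochner_integral lborel (\<lambda>s. G s x * indicator {a..b} s) (Psi b x - Psi a x)"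
    using assms has_deriv_Psi isCont_G by (intro has_bochner_integral_FTC_Icc_real) auto
  also have "(\<lambda>s. G s x * indicator {a..b} s) = (\<lambda>s. of_bool (a \<le> s \<and> s \<le> b) * G s x)"
    by (auto simp: indicator_def fun_eq_iff)
  finally show ?thesis .
qed

lemma nn_integral_of_bool_ennreal:
  "(\<integral>\<^sup>+s. of_bool (P s) * ennreal (f s) \<partial>M) = (\<integral>\<^sup>+s. ennreal (of_bool (P s) * f s) \<partial>M)"
  by (intro nn_integral_cong) auto

lemma parts_finite: "Pp g x < \<infinity>" "Pn g x < \<infinity>" "Np g x < \<infinity>" "Nn g x < \<infinity>"
proof -
  have fin: "(\<integral>\<^sup>+s. ennreal (of_bool (a \<le> s \<and> s \<le> b) * G s x) \<partial>lborel) < \<infinity> \<and>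
    (\<integral>\<^sup>+s. ennreal (of_bool (a \<le> s \<and> s \<le> b) * - G s x) \<partial>lborel) < \<infinity>" for a b
  proof (cases "a \<le> b")
    case True
    from has_bochner_integral_G[OF this, of x] have "integrable lborel (\<lambda>s. of_bool (a \<le> s \<and> s \<le> b) * G s x)"
      by (simp add: has_bochner_integral_iff)
    then show ?thesis by (simp add: real_integrable_def less_top)
  next
    case False
    then have empty: "(a \<le> s \<and> s \<le> b) = False" for s by auto
    show ?thesis unfolding empty by simp
  qed
  show "Pp g x < \<infinity>" "Pn g x < \<infinity>"
    unfolding Pp_def Pn_def nn_integral_of_bool_ennreal using fin[of 0 g] by (rule conjunct1 conjunct2)+
  show "Np g x < \<infinity>" "Nn g x < \<infinity>"
    unfolding Np_def Nn_def nn_integral_of_bool_ennreal using fin[of g 0] by (rule conjunct1 conjunct2)+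
qed

text \<open>Since \<open>Psi 0 x = 0\<close>, the integral of \<open>G\<close> between 0 and
  \<open>g\<close> is \<open>Psi g x\<close> up to orientation. Only the two parts on the side of
  the sign of \<open>g\<close> contribute; the level sets of the others are empty or the single
  point 0.\<close>

lemma Psi_eq_parts: "Psi g x = enn2real (Pp g x + Nn g x) - enn2real (Pn g x + Np g x)"
proof -
  have pos: "enn2real (Pp g x) - enn2real (Pn g x) = Psi g x" if "0 \<le> g"
    using has_bochner_integral_G[OF that, of x]
      real_lebesgue_integral_def[of lborel "\<lambda>s. of_bool (0 \<le> s \<and> s \<le> g) * G s x"]
    by (simp add: has_bochner_integral_iff Pp_def Pn_def nn_integral_of_bool_ennreal)
  have neg: "enn2real (Nn g x) - enn2real (Np g x) = Psi g x" if "g \<le> 0"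
    using has_bochner_integral_G[OF that, of x]
      real_lebesgue_integral_def[of lborel "\<lambda>s. of_bool (g \<le> s \<and> s \<le> 0) * G s x"]
    by (simp add: has_bochner_integral_iff Np_def Nn_def nn_integral_of_bool_ennreal)
  have null: "Pp g x = 0" "Pn g x = 0" if "g \<le> 0"
  proof -
    have "AE s in lborel. of_bool (0 \<le> s \<and> s \<le> g) * f s = (0::ennreal)" for f
      using AE_lborel_singleton[of 0] by eventually_elim (use that in auto)
    then show "Pp g x = 0" "Pn g x = 0"
      unfolding Pp_def Pn_def by (subst nn_integral_0_iff_AE; simp)+
  qed
  have null': "Np g x = 0" "Nn g x = 0" if "0 \<le> g"
  proof -
    have "AE s in lborel. of_bool (g \<le> s \<and> s \<le> 0) * f s = (0::ennreal)" for f
      using AE_lborel_singleton[of 0] by eventually_elim (use that in auto)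
    then show "Np g x = 0" "Nn g x = 0"
      unfolding Np_def Nn_def by (subst nn_integral_0_iff_AE; simp)+
  qed
  show ?thesis using pos neg null null' by (cases "0 \<le> g") auto
qed

text \<open>\<open>G\<close> increases in its first argument, so between 0 and \<open>g\<close> the
  positive contributions are at most \<open>\<bar>G g x\<bar>\<close>, over a range of length
  \<open>\<bar>g\<bar>\<close>. Integrability of the product of \<open>\<gamma>\<close> and
  \<open>G\<close> thus controls the positive parts; the factor 2 just adds the two bounds.\<close>

lemma positive_parts_le: "Pp g x + Nn g x \<le> ennreal (2 * \<bar>g * G g x\<bar>)"
proof -
  have "Pp g x \<le> (\<integral>\<^sup>+s. ennreal \<bar>G g x\<bar> * indicator {0..g} s \<partial>lborel)"
    unfolding Pp_def by (intro nn_integral_mono)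
      (auto simp: indicator_def intro!: ennreal_leI order_trans[OF G_mono[OF _ order_refl] abs_ge_self])
  also have "\<dots> = ennreal \<bar>G g x\<bar> * emeasure lborel {0..g}" by (rule nn_integral_cmult_indicator) simp
  also have "\<dots> \<le> ennreal \<bar>g * G g x\<bar>"
    by (cases "0 \<le> g") (simp_all add: abs_mult ennreal_mult'[symmetric] mult.commute)
  finally have 1: "Pp g x \<le> ennreal \<bar>g * G g x\<bar>" .
  have "- G s x \<le> \<bar>G g x\<bar>" if "g \<le> s" for s
    using G_mono[OF that order_refl, of x] by linarith
  then have "Nn g x \<le> (\<integral>\<^sup>+s. ennreal \<bar>G g x\<bar> * indicator {g..0} s \<partial>lborel)"
    unfolding Nn_def by (intro nn_integral_mono) (auto simp: indicator_def intro!: ennreal_leI)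
  also have "\<dots> = ennreal \<bar>G g x\<bar> * emeasure lborel {g..0}" by (rule nn_integral_cmult_indicator) simp
  also have "\<dots> \<le> ennreal \<bar>g * G g x\<bar>"
    by (cases "g \<le> 0") (simp_all add: abs_mult ennreal_mult'[symmetric] mult.commute)
  finally have 2: "Nn g x \<le> ennreal \<bar>g * G g x\<bar>" .
  have "Pp g x + Nn g x \<le> ennreal \<bar>g * G g x\<bar> + ennreal \<bar>g * G g x\<bar>" by (intro add_mono 1 2)
  also have "\<dots> = ennreal (2 * \<bar>g * G g x\<bar>)" by (simp flip: ennreal_plus)
  finally show ?thesis .
qed

lemma negative_parts_finite: "Pn g x + Np g x < \<infinity>" and positive_parts_finite: "Pp g x + Nn g x < \<infinity>"
  using parts_finite[of g x] by simp_all

text \<open>At a fixed level \<open>s\<close> the indicator selects large values of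
  \<open>\<gamma>\<close> in \<open>Pp\<close> and \<open>Pn\<close>, small ones in
  \<open>Np\<close> and \<open>Nn\<close>, and the factor is \<open>G s\<close> or its negative.
  Indicator and factor move together in \<open>Pp\<close> and \<open>Nn\<close> and against each
  other in the remaining two, so the rearrangement inequalities apply level by level.\<close>

lemma parts_rearrangement:
  assumes "prob_space N" and U: "uniform01 N U" and Y[measurable]: "Y \<in> borel_measurable N"
    and \<gamma>: "mono_on {0<..<1} \<gamma>"
  shows "(\<integral>\<^sup>+w. Pp (\<gamma> (U w)) (Y w) + Nn (\<gamma> (U w)) (Y w) \<partial>N)
      \<le> (\<integral>\<^sup>+u. Pp (\<gamma> u) (quantile N Y u) + Nn (\<gamma> u) (quantile N Y u) \<partial>unif01)" (is ?pos)
    and "(\<integral>\<^sup>+u. Pn (\<gamma> u) (quantile N Y u) + Np (\<gamma> u) (quantile N Y u) \<partial>unif01)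
      \<le> (\<integral>\<^sup>+w. Pn (\<gamma> (U w)) (Y w) + Np (\<gamma> (U w)) (Y w) \<partial>N)" (is ?neg)
proof -
  interpret N: prob_space N by fact
  interpret unif01: prob_space unif01 by (rule prob_space_unif01)
  let ?q = "quantile N Y"
  have [measurable]: "U \<in> N \<rightarrow>\<^sub>M unif01" using U by (simp add: uniform01_def)
  have [measurable]: "\<gamma> \<in> borel_measurable unif01" using \<gamma> by (rule measurable_mono_unif01)
  have q: "?q u \<le> ?q v" if "u \<in> {0<..<1}" "v \<in> {0<..<1}" "u \<le> v" for u v
    using mono_onD[OF N.mono_quantile[OF Y]] that by auto
  have lower: "?q v \<le> ?q u" if "u \<in> {0<..<1}" "v \<in> {0<..<1}" "s \<le> \<gamma> u" "\<not> s \<le> \<gamma> v" for s u v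
    using q[of v u] mono_onD[OF \<gamma>, of u v] that by (cases "v \<le> u") auto
  have upper: "?q u \<le> ?q v" if "u \<in> {0<..<1}" "v \<in> {0<..<1}" "\<gamma> u \<le> s" "\<not> \<gamma> v \<le> s" for s u v
    using q[of u v] mono_onD[OF \<gamma>, of v u] that by (cases "u \<le> v") auto
  note G = G_mono[OF order_refl]
  have "(\<integral>\<^sup>+w. Pp (\<gamma> (U w)) (Y w) \<partial>N) \<le> (\<integral>\<^sup>+u. Pp (\<gamma> u) (?q u) \<partial>unif01)"
    unfolding Pp_def
    by (rule nn_integral_mono_layers[OF N.sigma_finite_measure_axioms unif01.sigma_finite_measure_axioms];
        (rule N.concordant_rearrangement[OF U Y])?) (measurable, auto intro!: G lower)
  moreover have "(\<integral>\<^sup>+w. Nn (\<gamma> (U w)) (Y w) \<partial>N) \<le> (\<integral>\<^sup>+u. Nn (\<gamma> u) (?q u) \<partial>unif01)"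
    unfolding Nn_def
    by (rule nn_integral_mono_layers[OF N.sigma_finite_measure_axioms unif01.sigma_finite_measure_axioms];
        (rule N.concordant_rearrangement[OF U Y])?) (measurable, auto intro!: G upper)
  ultimately show ?pos by (subst (1 2) nn_integral_add) (measurable, rule add_mono)
  have "(\<integral>\<^sup>+u. Pn (\<gamma> u) (?q u) \<partial>unif01) \<le> (\<integral>\<^sup>+w. Pn (\<gamma> (U w)) (Y w) \<partial>N)"
    unfolding Pn_def
    by (rule nn_integral_mono_layers[OF unif01.sigma_finite_measure_axioms N.sigma_finite_measure_axioms];
        (rule N.discordant_rearrangement[OF U Y])?) (measurable, auto intro!: G lower)
  moreover have "(\<integral>\<^sup>+u. Np (\<gamma> u) (?q u) \<partial>unif01) \<le> (\<integral>\<^sup>+w. Np (\<gamma> (U w)) (Y w) \<partial>N)"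
    unfolding Np_def
    by (rule nn_integral_mono_layers[OF unif01.sigma_finite_measure_axioms N.sigma_finite_measure_axioms];
        (rule N.discordant_rearrangement[OF U Y])?) (measurable, auto intro!: G upper)
  ultimately show ?neg by (subst (1 2) nn_integral_add) (measurable, rule add_mono)
qed

text \<open>Rearrangement bounds the positive parts from above but the negative parts only from
  below, so it does not make \<open>Psi\<close> integrable along a coupling. An integrable majorant
  is therefore stated unconditionally, while the comparison of integrals takes integrability as a
  premise.\<close>

lemma Psi_rearrangement:
  assumes N: "prob_space N" and U: "uniform01 N U" and Y[measurable]: "Y \<in> borel_measurable N"
    and \<gamma>: "mono_on {0<..<1} \<gamma>"
    and intG: "integrable unif01 (\<lambda>u. \<gamma> u * G (\<gamma> u) (quantile N Y u))"
    and intPsi: "integrable unif01 (\<lambda>u. Psi (\<gamma> u) (quantile N Y u))"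
  shows "\<exists>P. integrable N P \<and> (\<forall>w. Psi (\<gamma> (U w)) (Y w) \<le> P w)"
    and "integrable N (\<lambda>w. Psi (\<gamma> (U w)) (Y w)) \<Longrightarrow>
      (\<integral>w. Psi (\<gamma> (U w)) (Y w) \<partial>N) \<le> (\<integral>u. Psi (\<gamma> u) (quantile N Y u) \<partial>unif01)"
proof -
  interpret N: prob_space N by fact
  let ?q = "quantile N Y"
  have [measurable]: "U \<in> N \<rightarrow>\<^sub>M unif01" using U by (simp add: uniform01_def)
  have [measurable]: "\<gamma> \<in> borel_measurable unif01" using \<gamma> by (rule measurable_mono_unif01)
  have [measurable]: "?q \<in> borel_measurable unif01" using Y by (rule N.measurable_quantile)
  define P where "P w = enn2real (Pp (\<gamma> (U w)) (Y w) + Nn (\<gamma> (U w)) (Y w))" for w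
  define Q where "Q w = enn2real (Pn (\<gamma> (U w)) (Y w) + Np (\<gamma> (U w)) (Y w))" for w
  define p where "p u = enn2real (Pp (\<gamma> u) (?q u) + Nn (\<gamma> u) (?q u))" for u
  define r where "r u = enn2real (Pn (\<gamma> u) (?q u) + Np (\<gamma> u) (?q u))" for u
  have [measurable]: "P \<in> borel_measurable N" "Q \<in> borel_measurable N"
    "p \<in> borel_measurable unif01" "r \<in> borel_measurable unif01"
    unfolding P_def Q_def p_def r_def by measurable
  have nonneg: "0 \<le> P w" "0 \<le> Q w" "0 \<le> p u" "0 \<le> r u" for w u by (simp_all add: P_def Q_def p_def r_def)
  have enn: "ennreal (P w) = Pp (\<gamma> (U w)) (Y w) + Nn (\<gamma> (U w)) (Y w)"
    "ennreal (Q w) = Pn (\<gamma> (U w)) (Y w) + Np (\<gamma> (U w)) (Y w)"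
    "ennreal (p u) = Pp (\<gamma> u) (?q u) + Nn (\<gamma> u) (?q u)"
    "ennreal (r u) = Pn (\<gamma> u) (?q u) + Np (\<gamma> u) (?q u)" for w u
    using negative_parts_finite positive_parts_finite by (simp_all add: P_def Q_def p_def r_def)
  have Psi: "Psi (\<gamma> (U w)) (Y w) = P w - Q w" "Psi (\<gamma> u) (?q u) = p u - r u" for w u
    by (simp_all add: Psi_eq_parts P_def Q_def p_def r_def)
  have p_le: "p u \<le> 2 * \<bar>\<gamma> u * G (\<gamma> u) (?q u)\<bar>" for u
    using positive_parts_le[of "\<gamma> u" "?q u"] unfolding enn[symmetric] by (simp only: ennreal_le_iff abs_ge_zero mult_nonneg_nonneg zero_le_numeral)
  have "integrable unif01 (\<lambda>u. 2 * \<bar>\<gamma> u * G (\<gamma> u) (?q u)\<bar>)" using intG by simp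
  then have intp: "integrable unif01 p"
    by (rule Bochner_Integration.integrable_bound) (use p_le nonneg in auto)
  have intr: "integrable unif01 r"
    using Bochner_Integration.integrable_diff[OF intp intPsi] by (simp add: Psi)
  have le: "(\<integral>\<^sup>+w. ennreal (P w) \<partial>N) \<le> (\<integral>\<^sup>+u. ennreal (p u) \<partial>unif01)"
    "(\<integral>\<^sup>+u. ennreal (r u) \<partial>unif01) \<le> (\<integral>\<^sup>+w. ennreal (Q w) \<partial>N)"
    unfolding enn by (rule parts_rearrangement[OF N U Y \<gamma>])+
  have intP: "integrable N P"
    using le(1) nn_integral_eq_integral[OF intp] nonneg
    by (intro integrableI_bounded) (auto simp: le_less_trans)
  then show "\<exists>P. integrable N P \<and> (\<forall>w. Psi (\<gamma> (U w)) (Y w) \<le> P w)"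
    using nonneg by (intro exI[of _ P]) (auto simp: Psi)
  assume "integrable N (\<lambda>w. Psi (\<gamma> (U w)) (Y w))"
  from Bochner_Integration.integrable_diff[OF intP this] have intQ: "integrable N Q" by (simp add: Psi)
  have "integral\<^sup>L N P \<le> integral\<^sup>L unif01 p"
    using le(1) nonneg by (simp add: nn_integral_eq_integral intP intp ennreal_le_iff integral_nonneg_AE)
  moreover have "integral\<^sup>L unif01 r \<le> integral\<^sup>L N Q"
    using le(2) nonneg by (simp add: nn_integral_eq_integral intQ intr ennreal_le_iff integral_nonneg_AE)
  ultimately show "(\<integral>w. Psi (\<gamma> (U w)) (Y w) \<partial>N) \<le> (\<integral>u. Psi (\<gamma> u) (?q u) \<partial>unif01)"
    unfolding Psi using intP intQ intp intr by simp
qed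

end

section \<open>The bounds\<close>

context comonotone_ball
begin

lemma integral_bregman_quantile:
  assumes [measurable]: "p \<in> borel_measurable unif01"
    and eq: "bregman_wasserstein_quantile (\<phi> i) p (q i) = ennreal \<epsilon>" and "0 < \<epsilon>"
  shows "has_bochner_integral unif01 (\<lambda>u. bregman_div (\<phi> i) (p u) (q i u)) \<epsilon>"
proof (rule has_bochner_integral_nn_integral)
  show "(\<integral>\<^sup>+u. ennreal (bregman_div (\<phi> i) (p u) (q i u)) \<partial>unif01) = ennreal \<epsilon>"
    using eq by (simp add: bregman_wasserstein_quantile_def nn_integral_unif01)
qed (use \<open>0 < \<epsilon>\<close> in \<open>auto simp: strict_generator.bregman_div_nonneg[OF generators]\<close>)

text \<open>Weak duality with one multiplier per component. The penalty
  \<open>l i * \<epsilon>\<close> missing from the rearranged value is returned by the budget of the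
  coupling, so only the excess \<open>\<delta>\<close> of a near-optimal coupling remains.\<close>

lemma signed_choquet_le:
  assumes l: "\<And>i. 0 < l i" and "0 < \<epsilon>"
    and eq: "\<And>i. bregman_wasserstein_quantile (\<phi> i) (G_inv (\<phi> i) \<gamma> (q i) (l i)) (q i) = ennreal \<epsilon>"
    and Z: "Z \<in> bregman_ball M (separable \<phi>) \<epsilon> X"
  shows "signed_choquet M h (\<lambda>w. \<beta> \<bullet> Z w)
    \<le> (\<Sum>i\<in>UNIV. \<beta> $ i * (\<integral>u. \<gamma> u * G_inv (\<phi> i) \<gamma> (q i) (l i) u \<partial>unif01))"
proof -
  interpret unif01: prob_space unif01 by (rule prob_space_unif01)
  interpret N: pair_prob_space M unif01 ..
  let ?N = "M \<Otimes>\<^sub>M unif01"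
  let ?v = "signed_choquet M h (\<lambda>w. \<beta> \<bullet> Z w)"
  let ?g = "\<lambda>i. \<integral>u. \<gamma> u * G_inv (\<phi> i) \<gamma> (q i) (l i) u \<partial>unif01"
  \<comment> \<open>Components of weight 0 add nothing to the value, and
    \<open>integrable_G_inv\<close> covers only those of positive weight.\<close>
  define I where "I = {i. 0 < \<beta> $ i}"
  have sum_I: "(\<Sum>i\<in>UNIV. \<beta> $ i * f i) = (\<Sum>i\<in>I. \<beta> $ i * f i)" for f
    using \<beta>_nonneg by (intro sum.mono_neutral_right) (auto simp: I_def less_le)
  have Zm[measurable]: "Z \<in> borel_measurable M"
    and Zle: "bregman_wasserstein M (separable \<phi>) (distr M borel Z) (distr M borel X) \<le> ennreal \<epsilon>"
    using Z by (auto simp: bregman_ball_def)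
  \<comment> \<open>The infimum need not be attained; \<open>\<delta>\<close> is the price of an
    actual coupling.\<close>
  have main: "?v \<le> (\<Sum>i\<in>I. \<beta> $ i * ?g i) + \<delta> * (\<Sum>i\<in>I. \<beta> $ i * l i)" if "0 < \<delta>" for \<delta>
  proof -
    have "bregman_wasserstein M (separable \<phi>) (distr M borel Z) (distr M borel X) < ennreal (\<epsilon> + \<delta>)"
      using Zle \<open>0 < \<epsilon>\<close> \<open>0 < \<delta>\<close> by (elim order_le_less_trans) (simp add: ennreal_less_iff)
    then obtain Z' X' where Z'[measurable]: "Z' \<in> borel_measurable M" and X'[measurable]: "X' \<in> borel_measurable M"
      and dZ: "distr M borel Z' = distr M borel Z" and dX: "distr M borel X' = distr M borel X"
      and div: "(\<integral>\<^sup>+w. ennreal (bregman_div (separable \<phi>) (Z' w) (X' w)) \<partial>M) < ennreal (\<epsilon> + \<delta>)"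
      unfolding bregman_wasserstein_def INF_less_iff by auto
    define S where "S w = \<beta> \<bullet> Z' w" for w
    have [measurable]: "S \<in> borel_measurable M" unfolding S_def by measurable
    obtain U where U: "uniform01 ?N U" and US: "AE z in ?N. quantile M S (U z) = S (fst z)"
      using distributional_transform[of S] by auto
    have [measurable]: "U \<in> ?N \<rightarrow>\<^sub>M unif01" using U by (simp add: uniform01_def)
    have comp: "(\<lambda>z. f (fst z) $ i) \<in> borel_measurable ?N" if "f \<in> borel_measurable M" for f :: "'w \<Rightarrow> real ^ 'n" and i
      by (rule measurable_compose[OF measurable_compose[OF measurable_fst that] borel_measurable_nth])
    note [measurable] = comp[OF Z'] comp[OF X']
      measurable_compose[OF Z' borel_measurable_nth] measurable_compose[OF X' borel_measurable_nth]
    \<comment> \<open>\<open>Z'\<close> shares only its law with \<open>Z\<close>, which is all that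
      the quantile function depends on.\<close>
    have qS: "quantile M S = quantile M (\<lambda>w. \<beta> \<bullet> Z w)"
    proof (rule quantile_cong_distr)
      have "distr M borel S = distr (distr M borel Z') borel (\<lambda>x. \<beta> \<bullet> x)"
        by (subst distr_distr) (auto simp: comp_def S_def[abs_def])
      also have "\<dots> = distr M borel (\<lambda>w. \<beta> \<bullet> Z w)"
        unfolding dZ by (subst distr_distr) (auto simp: comp_def)
      finally show "distr M borel S = distr M borel (\<lambda>w. \<beta> \<bullet> Z w)" .
    qed
    have qY: "quantile ?N (\<lambda>z. X' (fst z) $ i) = q i" for i
      unfolding q_def
    proof (rule quantile_cong_distr)
      have "distr ?N borel (\<lambda>z. X' (fst z) $ i) = distr (distr (distr ?N M fst) borel X') borel (\<lambda>x. x $ i)"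
        by (simp add: distr_distr comp_def)
      also have "\<dots> = distr (distr M borel X) borel (\<lambda>x. x $ i)"
        by (simp only: unif01.distr_pair_fst dX)
      also have "\<dots> = distr M borel (\<lambda>w. X w $ i)" by (simp add: distr_distr comp_def)
      finally show "distr ?N borel (\<lambda>z. X' (fst z) $ i) = distr M borel (\<lambda>w. X w $ i)" .
    qed
    have "has_bochner_integral unif01 (\<lambda>u. \<gamma> u * quantile M S u) ?v"
      unfolding qS by (intro signed_choquet_eq_integral_quantile finite_on_ball Z) (unfold_locales, measurable)
    then have "has_bochner_integral ?N (\<lambda>z. \<gamma> (U z) * quantile M S (U z)) ?v"
      by (simp add: has_bochner_integral_iff uniform01_integral[OF U, of "\<lambda>u. \<gamma> u * quantile M S u"]
          uniform01_integrable[OF U, of "\<lambda>u. \<gamma> u * quantile M S u"])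
    also have "?this \<longleftrightarrow> has_bochner_integral ?N (\<lambda>z. \<gamma> (U z) * S (fst z)) ?v"
      using US by (intro has_bochner_integral_cong_AE) auto
    finally have v: "has_bochner_integral ?N (\<lambda>z. \<gamma> (U z) * S (fst z)) ?v" .
    define b where "b k z = bregman_div (\<phi> k) (Z' (fst z) $ k) (X' (fst z) $ k)" for k and z :: "'w \<times> real"
    have [measurable]: "b k \<in> borel_measurable ?N" for k unfolding b_def by measurable
    have b_nonneg: "0 \<le> b k z" for k z
      by (simp add: b_def strict_generator.bregman_div_nonneg[OF generators])
    \<comment> \<open>Each component is charged with the entire cost of the coupling, as the other
      summands are non-negative.\<close>
    have b_le: "(\<integral>\<^sup>+z. ennreal (b k z) \<partial>?N) \<le> ennreal (\<epsilon> + \<delta>)" for k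
    proof -
      have "(\<integral>\<^sup>+z. ennreal (b k z) \<partial>?N) = (\<integral>\<^sup>+w. ennreal (bregman_div (\<phi> k) (Z' w $ k) (X' w $ k)) \<partial>distr ?N M fst)"
        by (subst nn_integral_distr) (measurable, simp add: b_def)
      also have "\<dots> \<le> (\<integral>\<^sup>+w. ennreal (bregman_div (separable \<phi>) (Z' w) (X' w)) \<partial>M)"
        unfolding unif01.distr_pair_fst ennreal_bregman_div_separable
        by (intro nn_integral_mono member_le_sum) auto
      finally show ?thesis using div by simp
    qed
    have b_int: "integrable ?N (b k)" for k
      using b_le[of k] b_nonneg by (intro integrableI_bounded) (auto simp: le_less_trans)
    have Eb: "integral\<^sup>L ?N (b k) \<le> \<epsilon> + \<delta>" for k
      using b_le[of k] b_nonneg \<open>0 < \<epsilon>\<close> \<open>0 < \<delta>\<close> by (simp add: nn_integral_eq_integral[OF b_int] ennreal_le_iff del: ennreal_plus)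
    define \<psi> where "\<psi> i z = lagrangian.Psi (\<phi> i) (l i) (\<gamma> (U z)) (X' (fst z) $ i)" for i z
    define \<psi>q where "\<psi>q i u = lagrangian.Psi (\<phi> i) (l i) (\<gamma> u) (q i u)" for i u
    \<comment> \<open>An integrable minorant of the weighted sum of the \<open>\<psi> i\<close>: the
      integrand of the Choquet value minus all penalties.\<close>
    define R where "R z = \<gamma> (U z) * S (fst z) - (\<Sum>i\<in>I. \<beta> $ i * l i * b i z)" for z
    have R_int: "integrable ?N R" unfolding R_def
      using v b_int by (intro Bochner_Integration.integrable_diff Bochner_Integration.integrable_sum
          integrable_mult_right) (auto simp: has_bochner_integral_iff)
    have R_le: "R z \<le> (\<Sum>i\<in>I. \<beta> $ i * \<psi> i z)" for z
    proof -
      have "S (fst z) = (\<Sum>i\<in>I. \<beta> $ i * Z' (fst z) $ i)"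
        using sum_I by (simp add: S_def inner_vec_def)
      then have "R z = (\<Sum>i\<in>I. \<beta> $ i * (\<gamma> (U z) * Z' (fst z) $ i - l i * b i z))"
        by (simp add: R_def sum_distrib_left sum_subtractf algebra_simps)
      also have "\<dots> \<le> (\<Sum>i\<in>I. \<beta> $ i * \<psi> i z)"
        unfolding b_def \<psi>_def
        by (intro sum_mono mult_left_mono lagrangian.Psi_ge lagrangian_generator l \<beta>_nonneg)
      finally show ?thesis .
    qed
    have G_int: "integrable unif01 (\<lambda>u. \<gamma> u * lagrangian.G (\<phi> i) (l i) (\<gamma> u) (q i u))" if "i \<in> I" for i
      using integrable_G_inv[OF l, of i] that eq[of i] by (simp add: I_def G_inv_eq[OF l])
    have \<psi>q: "has_bochner_integral unif01 (\<psi>q i) (?g i - l i * \<epsilon>)" if "i \<in> I" for i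
    proof -
      have "G_inv (\<phi> i) \<gamma> (q i) (l i) \<in> borel_measurable unif01"
        by (intro measurable_mono_unif01 mono_G_inv l)
      from integral_bregman_quantile[OF this eq \<open>0 < \<epsilon>\<close>]
      have "has_bochner_integral unif01 (\<lambda>u. \<gamma> u * G_inv (\<phi> i) \<gamma> (q i) (l i) u
          - l i * bregman_div (\<phi> i) (G_inv (\<phi> i) \<gamma> (q i) (l i) u) (q i u)) (?g i - l i * \<epsilon>)"
        using G_int[OF that]
        by (intro has_bochner_integral_diff has_bochner_integral_mult_right)
          (auto simp: has_bochner_integral_iff G_inv_eq[OF l])
      then show ?thesis
        by (simp add: \<psi>q_def[abs_def] G_inv_eq[OF l] lagrangian.Psi_def[OF lagrangian_generator[OF l]])
    qed
    have rearr: "\<exists>P. integrable ?N P \<and> (\<forall>z. \<psi> i z \<le> P z)"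
      "integrable ?N (\<psi> i) \<Longrightarrow> integral\<^sup>L ?N (\<psi> i) \<le> integral\<^sup>L unif01 (\<psi>q i)" if "i \<in> I" for i
      using lagrangian.Psi_rearrangement[OF lagrangian_generator[OF l, of i] N.prob_space_axioms U comp[OF X', of i]
          mono_weight, unfolded qY, OF G_int[OF that]] \<psi>q[OF that]
      unfolding \<psi>_def[abs_def] \<psi>q_def[abs_def] has_bochner_integral_iff by blast+
    have "\<forall>i. \<exists>P. i \<in> I \<longrightarrow> integrable ?N P \<and> (\<forall>z. \<psi> i z \<le> P z)"
      using rearr(1) by blast
    then have "\<exists>P. \<forall>i. i \<in> I \<longrightarrow> integrable ?N (P i) \<and> (\<forall>z. \<psi> i z \<le> P i z)"
      by (rule choice)
    then obtain P where "\<forall>i. i \<in> I \<longrightarrow> integrable ?N (P i) \<and> (\<forall>z. \<psi> i z \<le> P i z)"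
      by (rule exE)
    then have P: "\<And>i. i \<in> I \<Longrightarrow> integrable ?N (P i)" "\<And>i z. i \<in> I \<Longrightarrow> \<psi> i z \<le> P i z"
      by blast+
    have \<psi>_measurable [measurable]: "\<psi> i \<in> borel_measurable ?N" for i
      unfolding \<psi>_def by (intro lagrangian.Psi_measurable lagrangian_generator l) measurable
    \<comment> \<open>Each \<open>\<psi> j\<close> is bounded above by \<open>P j\<close> and the
      weighted sum is bounded below by \<open>R\<close>. Moving the other summands across bounds the
      single term below as well.\<close>
    have \<psi>_int: "integrable ?N (\<psi> i)" if i: "i \<in> I" for i
    proof -
      have "integrable ?N (\<lambda>z. \<bar>R z\<bar> + (\<Sum>j\<in>I. \<beta> $ j * \<bar>P j z\<bar>))"
        using R_int P(1) by (intro Bochner_Integration.integrable_add Bochner_Integration.integrable_sum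
            integrable_mult_right integrable_abs)
      then have "integrable ?N (\<lambda>z. \<beta> $ i * \<psi> i z)"
      proof (rule Bochner_Integration.integrable_bound)
        show "AE z in ?N. norm (\<beta> $ i * \<psi> i z) \<le> norm (\<bar>R z\<bar> + (\<Sum>j\<in>I. \<beta> $ j * \<bar>P j z\<bar>))"
        proof (rule AE_I2)
          fix z
          have le: "\<beta> $ j * \<psi> j z \<le> \<beta> $ j * \<bar>P j z\<bar>" if "j \<in> I" for j
            using P(2)[OF that, of z] \<beta>_nonneg by (intro mult_left_mono) auto
          have "(\<Sum>j\<in>I. \<beta> $ j * \<psi> j z) = \<beta> $ i * \<psi> i z + (\<Sum>j\<in>I - {i}. \<beta> $ j * \<psi> j z)"
            using i by (intro sum.remove) auto
          also have "\<dots> \<le> \<beta> $ i * \<psi> i z + (\<Sum>j\<in>I - {i}. \<beta> $ j * \<bar>P j z\<bar>)"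
            using le by (intro add_left_mono sum_mono) auto
          also have "\<dots> \<le> \<beta> $ i * \<psi> i z + (\<Sum>j\<in>I. \<beta> $ j * \<bar>P j z\<bar>)"
            using \<beta>_nonneg by (intro add_left_mono sum_mono2) auto
          finally have "- \<bar>R z\<bar> - (\<Sum>j\<in>I. \<beta> $ j * \<bar>P j z\<bar>) \<le> \<beta> $ i * \<psi> i z"
            using R_le[of z] by linarith
          moreover have "\<beta> $ i * \<bar>P i z\<bar> \<le> (\<Sum>j\<in>I. \<beta> $ j * \<bar>P j z\<bar>)"
            using i \<beta>_nonneg by (intro member_le_sum) auto
          ultimately show "norm (\<beta> $ i * \<psi> i z) \<le> norm (\<bar>R z\<bar> + (\<Sum>j\<in>I. \<beta> $ j * \<bar>P j z\<bar>))"
            using le[OF i] by (simp only: real_norm_def)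
        qed
      qed measurable
      then show ?thesis using i by (simp add: I_def)
    qed
    have "?v - (\<Sum>i\<in>I. \<beta> $ i * l i * integral\<^sup>L ?N (b i)) = integral\<^sup>L ?N R"
      using v b_int unfolding R_def by (simp add: has_bochner_integral_iff)
    also have "\<dots> \<le> (\<integral>z. (\<Sum>i\<in>I. \<beta> $ i * \<psi> i z) \<partial>?N)"
      using R_int \<psi>_int R_le by (intro integral_mono Bochner_Integration.integrable_sum integrable_mult_right) auto
    also have "\<dots> = (\<Sum>i\<in>I. \<beta> $ i * integral\<^sup>L ?N (\<psi> i))"
      using \<psi>_int by simp
    also have "\<dots> \<le> (\<Sum>i\<in>I. \<beta> $ i * (?g i - l i * \<epsilon>))"
    proof (intro sum_mono mult_left_mono \<beta>_nonneg)
      fix i assume i: "i \<in> I"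
      have "integral\<^sup>L ?N (\<psi> i) \<le> integral\<^sup>L unif01 (\<psi>q i)"
        by (rule rearr(2)[OF i \<psi>_int[OF i]])
      then show "integral\<^sup>L ?N (\<psi> i) \<le> ?g i - l i * \<epsilon>"
        using \<psi>q[OF i] by (simp add: has_bochner_integral_iff)
    qed
    finally have "?v \<le> (\<Sum>i\<in>I. \<beta> $ i * (?g i - l i * \<epsilon>)) + (\<Sum>i\<in>I. \<beta> $ i * l i * integral\<^sup>L ?N (b i))" by simp
    also have "\<dots> \<le> (\<Sum>i\<in>I. \<beta> $ i * (?g i - l i * \<epsilon>)) + (\<Sum>i\<in>I. \<beta> $ i * l i * (\<epsilon> + \<delta>))"
      using Eb \<beta>_nonneg l by (intro add_left_mono sum_mono mult_left_mono) (auto simp: less_imp_le)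
    also have "\<dots> = (\<Sum>i\<in>I. \<beta> $ i * ?g i) + \<delta> * (\<Sum>i\<in>I. \<beta> $ i * l i)"
      by (simp add: sum.distrib[symmetric] sum_distrib_left algebra_simps)
    finally show ?thesis .
  qed
  let ?C = "\<Sum>i\<in>I. \<beta> $ i * l i"
  have C: "0 \<le> ?C" using \<beta>_nonneg l by (intro sum_nonneg mult_nonneg_nonneg) (auto simp: less_imp_le)
  have "?v \<le> (\<Sum>i\<in>I. \<beta> $ i * ?g i) + e" if "0 < e" for e
  proof -
    \<comment> \<open>The added 1 keeps the choice of \<delta> positive and well defined when
      \<open>?C = 0\<close>.\<close>
    have "e / (?C + 1) * ?C \<le> e" using C that by (simp add: field_simps)
    with main[of "e / (?C + 1)"] C that show ?thesis by simp
  qed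
  then have "?v \<le> (\<Sum>i\<in>I. \<beta> $ i * ?g i)" by (rule field_le_epsilon)
  then show ?thesis by (simp only: sum_I)
qed

text \<open>A larger multiplier moves \<open>G_inv\<close> towards \<open>p u\<close>, from above or
  from below according to the sign of \<open>\<gamma> u\<close>, so the divergence does not increase
  at any point.\<close>

lemma bregman_wasserstein_quantile_G_inv_antimono:
  assumes "0 < l" "l \<le> l'"
  shows "bregman_wasserstein_quantile (\<phi> i) (G_inv (\<phi> i) \<gamma> p l') p
    \<le> bregman_wasserstein_quantile (\<phi> i) (G_inv (\<phi> i) \<gamma> p l) p"
proof -
  interpret strict_generator "\<phi> i" by (rule generators)
  have inv: "1 / l' \<le> 1 / l" "0 \<le> 1 / l'" using assms by (simp_all add: frac_le)
  have "bregman_div (\<phi> i) (G_inv (\<phi> i) \<gamma> p l' u) (p u) \<le> bregman_div (\<phi> i) (G_inv (\<phi> i) \<gamma> p l u) (p u)" for u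
  proof (rule bregman_div_mono)
    show "p u \<le> G_inv (\<phi> i) \<gamma> p l' u \<and> G_inv (\<phi> i) \<gamma> p l' u \<le> G_inv (\<phi> i) \<gamma> p l u \<or>
      G_inv (\<phi> i) \<gamma> p l u \<le> G_inv (\<phi> i) \<gamma> p l' u \<and> G_inv (\<phi> i) \<gamma> p l' u \<le> p u"
    proof (cases "0 \<le> \<gamma> u")
      case True
      then have "1 / l' * \<gamma> u \<le> 1 / l * \<gamma> u" "0 \<le> 1 / l' * \<gamma> u"
        using inv by (intro mult_right_mono mult_nonneg_nonneg; simp)+
      then show ?thesis
        unfolding G_inv_def by (intro disjI1 conjI monoD[OF mono_inv_deriv]) (simp_all add: le_inv_deriv_iff)
    next
      case False
      then have "1 / l * \<gamma> u \<le> 1 / l' * \<gamma> u" "1 / l' * \<gamma> u \<le> 0"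
        using inv by (intro mult_right_mono_neg mult_nonneg_nonpos; simp)+
      then show ?thesis
        unfolding G_inv_def by (intro disjI2 conjI monoD[OF mono_inv_deriv]) (simp_all add: inv_deriv_le_iff)
    qed
  qed
  then show ?thesis
    unfolding bregman_wasserstein_quantile_def
    by (intro nn_integral_mono mult_right_mono ennreal_leI) auto
qed

text \<open>For different budgets the monotonicity of the divergence decides. For equal budgets, as
  with a single component, both multipliers solve the same equation and minimality decides.\<close>

lemma smallest_multiplier_antimono:
  assumes "smallest_multiplier (\<phi> i) \<gamma> p \<epsilon>\<^sub>1 l\<^sub>1" "smallest_multiplier (\<phi> i) \<gamma> p \<epsilon>\<^sub>2 l\<^sub>2" "\<epsilon>\<^sub>2 \<le> \<epsilon>\<^sub>1"
  shows "l\<^sub>1 \<le> l\<^sub>2"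
proof (rule ccontr)
  assume "\<not> l\<^sub>1 \<le> l\<^sub>2"
  then have "ennreal \<epsilon>\<^sub>1 \<le> ennreal \<epsilon>\<^sub>2"
    using bregman_wasserstein_quantile_G_inv_antimono[of l\<^sub>2 l\<^sub>1 i p] assms(1,2) by (simp add: smallest_multiplier_def)
  with ennreal_leI[OF assms(3)] have "ennreal \<epsilon>\<^sub>1 = ennreal \<epsilon>\<^sub>2" by (rule antisym[rotated])
  with assms(1,2) \<open>\<not> l\<^sub>1 \<le> l\<^sub>2\<close> show False unfolding smallest_multiplier_def by metis
qed

text \<open>One factor \<open>\<bar>\<gamma> u\<bar>\<close> comes from the weight in the integral,
  a second from the displacement of the argument of the Lipschitz inverse; together they produce the
  squared norm.\<close>

lemma G_inv_gap_le:
  assumes l: "0 < l" "l \<le> l'"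
    and int: "integrable unif01 (\<lambda>u. \<gamma> u * G_inv (\<phi> i) \<gamma> (q i) l u)"
      "integrable unif01 (\<lambda>u. \<gamma> u * G_inv (\<phi> i) \<gamma> (q i) l' u)"
    and L: "L-lipschitz_on UNIV (inv (deriv (\<phi> i)))"
    and "0 < b"
  shows "ereal (b * (\<integral>u. \<gamma> u * G_inv (\<phi> i) \<gamma> (q i) l u \<partial>unif01)
      - b * (\<integral>u. \<gamma> u * G_inv (\<phi> i) \<gamma> (q i) l' u \<partial>unif01))
    \<le> ereal (b * L * (1 / l - 1 / l')) * (L2norm \<gamma>)\<^sup>2"
proof -
  define c where "c = L * (1 / l - 1 / l')"
  have "0 \<le> L" using L by (rule lipschitz_on_nonneg)
  moreover have d: "0 \<le> 1 / l - 1 / l'" using l by (simp add: frac_le)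
  ultimately have c: "0 \<le> c" by (simp add: c_def)
  let ?G = "\<lambda>l u. G_inv (\<phi> i) \<gamma> (q i) l u"
  let ?D = "\<lambda>u. \<gamma> u * ?G l u - \<gamma> u * ?G l' u"
  have D: "?D u \<le> c * (\<gamma> u)\<^sup>2" for u
  proof -
    have "\<bar>?G l u - ?G l' u\<bar> \<le> L * \<bar>1 / l * \<gamma> u - 1 / l' * \<gamma> u\<bar>"
      using lipschitz_onD[OF L, of "deriv (\<phi> i) (q i u) + 1 / l * \<gamma> u" "deriv (\<phi> i) (q i u) + 1 / l' * \<gamma> u"]
      by (simp add: G_inv_def dist_real_def)
    also have "\<dots> = c * \<bar>\<gamma> u\<bar>"
      using d by (simp add: c_def abs_mult left_diff_distrib[symmetric] del: times_divide_eq_left)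
    finally have "\<bar>\<gamma> u\<bar> * \<bar>?G l u - ?G l' u\<bar> \<le> \<bar>\<gamma> u\<bar> * (c * \<bar>\<gamma> u\<bar>)" by (rule mult_left_mono) simp
    moreover have "?D u \<le> \<bar>\<gamma> u\<bar> * \<bar>?G l u - ?G l' u\<bar>"
      by (simp only: abs_mult[symmetric] right_diff_distrib[symmetric] abs_ge_self)
    moreover have "\<bar>\<gamma> u\<bar> * (c * \<bar>\<gamma> u\<bar>) = c * (\<gamma> u)\<^sup>2" by (simp add: power2_eq_square)
    ultimately show ?thesis by linarith
  qed
  have D_int: "integrable unif01 ?D" using int by simp
  have lhs: "b * (\<integral>u. \<gamma> u * ?G l u \<partial>unif01) - b * (\<integral>u. \<gamma> u * ?G l' u \<partial>unif01) = b * integral\<^sup>L unif01 ?D"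
    using int by (simp add: right_diff_distrib)
  have rhs: "b * L * (1 / l - 1 / l') = b * c" by (simp add: c_def)
  define s where "s = (\<integral>\<^sup>+u. ennreal ((\<gamma> u)\<^sup>2) \<partial>unif01)"
  have L2: "L2norm \<gamma> = (if s = \<infinity> then \<infinity> else ereal (sqrt (enn2real s)))"
    by (simp add: L2norm_def s_def nn_integral_unif01 Let_def)
  show ?thesis
  \<comment> \<open>For \<open>c = 0\<close> the right side is 0 even if the norm is infinite, so
    the integral itself must be shown non-positive. For positive \<open>c\<close> an infinite norm
    makes the bound trivial.\<close>
  proof (cases "c = 0")
    case True
    then have "integral\<^sup>L unif01 ?D \<le> 0"
      using D integral_mono[OF D_int, of "\<lambda>_. 0"] by simp
    then have "b * integral\<^sup>L unif01 ?D \<le> 0" using \<open>0 < b\<close> by (simp add: mult_le_0_iff)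
    then show ?thesis unfolding lhs rhs True by (simp flip: zero_ereal_def)
  next
    case False
    with c have c: "0 < c" by simp
    show ?thesis
    proof (cases "s = \<infinity>")
      case True
      then show ?thesis unfolding lhs rhs L2 using c \<open>0 < b\<close> by (simp add: power2_eq_square)
    next
      case False
      have sq: "integrable unif01 (\<lambda>u. (\<gamma> u)\<^sup>2)"
        using False by (intro integrableI_bounded) (auto simp: s_def less_top)
      have "s = ennreal (\<integral>u. (\<gamma> u)\<^sup>2 \<partial>unif01)"
        unfolding s_def by (rule nn_integral_eq_integral[OF sq]) simp
      then have s: "enn2real s = (\<integral>u. (\<gamma> u)\<^sup>2 \<partial>unif01)" by (simp add: integral_nonneg_AE)
      have "integral\<^sup>L unif01 ?D \<le> (\<integral>u. c * (\<gamma> u)\<^sup>2 \<partial>unif01)"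
        using D by (intro integral_mono D_int integrable_mult_right sq)
      also have "\<dots> = c * enn2real s" by (simp add: s)
      finally have "b * integral\<^sup>L unif01 ?D \<le> b * c * enn2real s"
        using \<open>0 < b\<close> by simp
      then show ?thesis unfolding lhs rhs L2 using False by (simp add: power2_eq_square)
    qed
  qed
qed

lemma choquet_bound_eq:
  "choquet_bound M \<phi> \<gamma> \<beta> X l = (\<Sum>i\<in>UNIV. \<beta> $ i * (\<integral>u. \<gamma> u * G_inv (\<phi> i) \<gamma> (q i) (l i) u \<partial>unif01))"
  by (simp add: choquet_bound_def integral_unif01 q_def)

end

theorem proposition7:
  fixes M :: "'w measure"
    and h \<gamma> :: "real \<Rightarrow> real"
    and \<phi> :: "'n::finite \<Rightarrow> real \<Rightarrow> real"
    and \<beta> :: "real ^ 'n"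
    and X :: "'w \<Rightarrow> real ^ 'n"
    and \<epsilon> :: real
    and lam_up lam_low :: "'n \<Rightarrow> real"
  assumes "prob_space M" and "nonatomic M"
    and "distortion h" and "distortion_weight h \<gamma>"
    and "mono_on {0<..<1} \<gamma>"
    and "\<And>k. bregman_generator (\<phi> k)" and "\<And>k. strictly_convex (\<phi> k)"
    and "\<And>k. filterlim (deriv (\<phi> k)) at_top at_top"
    and "\<And>k. filterlim (deriv (\<phi> k)) at_bot at_bot"
    and "\<And>i. 0 \<le> \<beta> $ i" and "\<beta> \<noteq> 0"
    and "0 < \<epsilon>"
    and "X \<in> borel_measurable M" and "comonotonic M X"
    and "\<And>Z. Z \<in> bregman_ball M (separable \<phi>) \<epsilon> X \<Longrightarrow> signed_choquet_finite M h (\<lambda>w. \<beta> \<bullet> Z w)"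
    and "\<And>i. smallest_multiplier (\<phi> i) \<gamma> (quantile M (\<lambda>w. X w $ i)) \<epsilon> (lam_up i)"
    and "\<And>i. smallest_multiplier (\<phi> i) \<gamma> (quantile M (\<lambda>w. X w $ i))
               (\<epsilon> / real CARD('n)) (lam_low i)"
  shows "ereal (choquet_bound M \<phi> \<gamma> \<beta> X lam_low)
           \<le> (SUP Z\<in>bregman_ball M (separable \<phi>) \<epsilon> X. ereal (signed_choquet M h (\<lambda>w. \<beta> \<bullet> Z w)))
       \<and> (SUP Z\<in>bregman_ball M (separable \<phi>) \<epsilon> X. ereal (signed_choquet M h (\<lambda>w. \<beta> \<bullet> Z w)))
           \<le> ereal (choquet_bound M \<phi> \<gamma> \<beta> X lam_up)
       \<and> (\<forall>L :: 'n \<Rightarrow> real. (\<forall>i. (L i)-lipschitz_on UNIV (inv (deriv (\<phi> i)))) \<longrightarrow>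
            ereal (choquet_bound M \<phi> \<gamma> \<beta> X lam_up - choquet_bound M \<phi> \<gamma> \<beta> X lam_low)
              \<le> (\<Sum>i\<in>UNIV. ereal (\<beta> $ i * L i * (1 / lam_up i - 1 / lam_low i)) * (L2norm \<gamma>)\<^sup>2))"
proof -
  interpret prob_space M by fact
  interpret comonotone_ball M h \<gamma> \<phi> \<beta> X \<epsilon>
    using assms by (unfold_locales) auto
  have card: "0 < real CARD('n)" "1 \<le> real CARD('n)" by (simp_all add: Suc_leI)
  then have le_\<epsilon>: "\<epsilon> / real CARD('n) \<le> \<epsilon>" using \<open>0 < \<epsilon>\<close> by (simp add: divide_le_eq)
  have up: "0 < lam_up i" "bregman_wasserstein_quantile (\<phi> i) (G_inv (\<phi> i) \<gamma> (q i) (lam_up i)) (q i) = ennreal \<epsilon>" for i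
    using assms(16)[of i] by (simp_all add: smallest_multiplier_def q_def)
  have low: "0 < lam_low i"
    "bregman_wasserstein_quantile (\<phi> i) (G_inv (\<phi> i) \<gamma> (q i) (lam_low i)) (q i) = ennreal (\<epsilon> / real CARD('n))" for i
    using assms(17)[of i] by (simp_all add: smallest_multiplier_def q_def)
  \<comment> \<open>This makes \<open>1 / lam_up i - 1 / lam_low i\<close> non-negative, as the gap
    estimate requires.\<close>
  have up_le_low: "lam_up i \<le> lam_low i" for i
    using smallest_multiplier_antimono[OF assms(16,17) le_\<epsilon>] .
  have int: "integrable unif01 (\<lambda>u. \<gamma> u * G_inv (\<phi> i) \<gamma> (q i) (lam_up i) u)"
    "integrable unif01 (\<lambda>u. \<gamma> u * G_inv (\<phi> i) \<gamma> (q i) (lam_low i) u)" if "0 < \<beta> $ i" for i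
    using integrable_G_inv[OF up(1) that] integrable_G_inv[OF low(1) that] up(2)[of i] low(2)[of i] le_\<epsilon>
    by (simp_all add: ennreal_leI)
  show ?thesis
  proof (intro conjI allI impI)
    obtain U where U: "uniform01 M U" using nonatomic_imp_uniform01[OF nonatomic] by blast
    let ?p = "\<lambda>i. G_inv (\<phi> i) \<gamma> (q i) (lam_low i)"
    have sum: "(\<Sum>i\<in>UNIV. bregman_wasserstein_quantile (\<phi> i) (?p i) (q i)) \<le> ennreal \<epsilon>"
      using \<open>0 < \<epsilon>\<close> card by (simp add: low(2) ennreal_of_nat_eq_real_of_nat ennreal_mult'[symmetric])
    have mono: "mono_on {0<..<1} (?p i)" for i by (rule mono_G_inv[OF low(1)])
    show "ereal (choquet_bound M \<phi> \<gamma> \<beta> X lam_low)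
        \<le> (SUP Z\<in>bregman_ball M (separable \<phi>) \<epsilon> X. ereal (signed_choquet M h (\<lambda>w. \<beta> \<bullet> Z w)))"
      unfolding choquet_bound_eq signed_choquet_comonotone(2)[OF U mono sum, symmetric]
      by (rule SUP_upper[OF mem_ballI[OF U mono sum]])
  next
    show "(SUP Z\<in>bregman_ball M (separable \<phi>) \<epsilon> X. ereal (signed_choquet M h (\<lambda>w. \<beta> \<bullet> Z w)))
        \<le> ereal (choquet_bound M \<phi> \<gamma> \<beta> X lam_up)"
      unfolding choquet_bound_eq
      by (intro SUP_least) (simp add: signed_choquet_le[OF up(1) \<open>0 < \<epsilon>\<close> up(2)])
  next
    fix L :: "'n \<Rightarrow> real" assume L: "\<forall>i. (L i)-lipschitz_on UNIV (inv (deriv (\<phi> i)))"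
    let ?g = "\<lambda>l i. \<integral>u. \<gamma> u * G_inv (\<phi> i) \<gamma> (q i) (l i) u \<partial>unif01"
    have "ereal (choquet_bound M \<phi> \<gamma> \<beta> X lam_up - choquet_bound M \<phi> \<gamma> \<beta> X lam_low)
        = (\<Sum>i\<in>UNIV. ereal (\<beta> $ i * ?g lam_up i - \<beta> $ i * ?g lam_low i))"
      by (simp add: choquet_bound_eq sum_subtractf)
    also have "\<dots> \<le> (\<Sum>i\<in>UNIV. ereal (\<beta> $ i * L i * (1 / lam_up i - 1 / lam_low i)) * (L2norm \<gamma>)\<^sup>2)"
    proof (rule sum_mono)
      fix i
      show "ereal (\<beta> $ i * ?g lam_up i - \<beta> $ i * ?g lam_low i)
          \<le> ereal (\<beta> $ i * L i * (1 / lam_up i - 1 / lam_low i)) * (L2norm \<gamma>)\<^sup>2"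
      \<comment> \<open>A zero weight makes both sides 0, also for an infinite norm; a positive
        weight gives access to the integrability in \<open>int\<close>.\<close>
      proof (cases "\<beta> $ i = 0")
        case False
        then have "0 < \<beta> $ i" using \<beta>_nonneg[of i] by simp
        then show ?thesis using L by (intro G_inv_gap_le up low up_le_low int) auto
      qed (simp flip: zero_ereal_def)
    qed
    finally show "ereal (choquet_bound M \<phi> \<gamma> \<beta> X lam_up - choquet_bound M \<phi> \<gamma> \<beta> X lam_low)
        \<le> (\<Sum>i\<in>UNIV. ereal (\<beta> $ i * L i * (1 / lam_up i - 1 / lam_low i)) * (L2norm \<gamma>)\<^sup>2)" .
  qed
qed

end
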